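(* Let $k$ be a field and let $R=k[t^a,t^b,t^c]\subset k[t]$ be a monomial ring with $a<b<c$ positive integers, $\gcd(a,b,c)=1$, and $R$ not Gorenstein. Let $$\varphi=\begin{bmatrix}X^{a_1}&Y^{b_2}\\ Y^{b_1}&Z^{c_2}\\ Z^{c_1}&X^{a_2}\end{bmatrix}$$ be the Herzog matrix such that $R\simeq k[X,Y,Z]/I_2(\varphi)$. Suppose that $a_1\le a_2$, $b_2\le b_1$, and $c_1\le c_2$. Then $$\operatorname{bideg}(R)=a_1b_2c_1 .$$
   Context: Let $\Gamma:k[X,Y,Z]\to R$ be the surjection of $k$-algebras with $X\mapsto t^a$, $Y\mapsto t^b$, $Z\mapsto t^c$. As $R$ is not Gorenstein, there are positive integers $a_1,a_2,b_1,b_2,c_1,c_2$ such that $\ker\Gamma=I_2(\varphi)$, the ideal generated by the $2\times2$ minors of the displayed matrix $\varphi$; such a $\varphi$ is called the Herzog matrix. A canonical ideal of $R$ is an ideal $\mathcal C$ isomorphic to a canonical module of $R$. The bi-canonical degree is $\operatorname{bideg}(R)=\lambda(\mathcal C^{**}/\mathcal C)=\lambda(R/\mathcal C)-\lambda(R/\mathcal C^{**})$, where $\lambda$ is length, $(-)^*=\operatorname{Hom}_R(-,R)$, and the bidual $\mathcal C^{**}$ is regarded as an ideal of $R$ containing $\mathcal C$; here $\mathcal C$ is taken to be a canonical ideal primary to the maximal ideal $\mathfrak m=(t^a,t^b,t^c)$ (equivalently, one computes $\operatorname{bideg}(R_{\mathfrak m})$), and the value does not depend on the choice of $\mathcal C$.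 *)

theory Defs
  imports
    "HOL-Algebra.Module"
    "HOL-Algebra.QuotRing"
    "HOL-Computational_Algebra.Polynomial_Factorial"
    "HOL-Library.Poly_Mapping"
    "HOL-Library.Product_Plus"
    "HOL-Library.Extended_Nat"
begin

section \<open>Modules, length, Hom\<close>

text \<open>The multiplicative fields \<open>mult\<close> and \<open>one\<close> of a module record carry no meaning; they are
  left \<open>undefined\<close> where there is no natural choice.\<close>

definition ring_on :: "'a::comm_ring_1 set \<Rightarrow> 'a ring" where
  "ring_on S = \<lparr>carrier = S, monoid.mult = (*), one = 1, zero = 0, add = (+)\<rparr>"

definition ideal_module :: "'a ring \<Rightarrow> 'a set \<Rightarrow> ('a, 'a) module" where
  "ideal_module A I =
    \<lparr>carrier = I, monoid.mult = monoid.mult A, one = \<one>\<^bsub>A\<^esub>, zero = zero A,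
     add = add A, module.smult = monoid.mult A\<rparr>"

definition quotient_module :: "'a ring \<Rightarrow> 'a set \<Rightarrow> ('a, 'a set) module" where
  "quotient_module A I =
    \<lparr>carrier = carrier (A Quot I), monoid.mult = monoid.mult (A Quot I), one = one (A Quot I),
     zero = zero (A Quot I), add = add (A Quot I),
     module.smult = (\<lambda>r X. (I +>\<^bsub>A\<^esub> r) \<otimes>\<^bsub>A Quot I\<^esub> X)\<rparr>"

definition free_module :: "'a ring \<Rightarrow> nat \<Rightarrow> ('a, nat \<Rightarrow> 'a) module" where
  "free_module A n =
    \<lparr>carrier = {..<n} \<rightarrow>\<^sub>E carrier A, monoid.mult = undefined, one = undefined,
     zero = (\<lambda>i\<in>{..<n}. \<zero>\<^bsub>A\<^esub>),
     add = (\<lambda>x y. \<lambda>i\<in>{..<n}. x i \<oplus>\<^bsub>A\<^esub> y i),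
     module.smult = (\<lambda>r x. \<lambda>i\<in>{..<n}. r \<otimes>\<^bsub>A\<^esub> x i)\<rparr>"

definition mod_hom :: "'a ring \<Rightarrow> ('a, 'm) module \<Rightarrow> ('a, 'n) module \<Rightarrow> ('m \<Rightarrow> 'n) set" where
  "mod_hom A M N =
    {f \<in> carrier M \<rightarrow>\<^sub>E carrier N.
      (\<forall>x\<in>carrier M. \<forall>y\<in>carrier M. f (x \<oplus>\<^bsub>M\<^esub> y) = f x \<oplus>\<^bsub>N\<^esub> f y) \<and>
      (\<forall>r\<in>carrier A. \<forall>x\<in>carrier M. f (r \<odot>\<^bsub>M\<^esub> x) = r \<odot>\<^bsub>N\<^esub> f x)}"

definition hom_module :: "'a ring \<Rightarrow> ('a, 'm) module \<Rightarrow> ('a, 'n) module \<Rightarrow> ('a, 'm \<Rightarrow> 'n) module" where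
  "hom_module A M N =
    \<lparr>carrier = mod_hom A M N, monoid.mult = undefined, one = undefined,
     zero = (\<lambda>x\<in>carrier M. \<zero>\<^bsub>N\<^esub>),
     add = (\<lambda>f g. \<lambda>x\<in>carrier M. f x \<oplus>\<^bsub>N\<^esub> g x),
     module.smult = (\<lambda>r f. \<lambda>x\<in>carrier M. r \<odot>\<^bsub>N\<^esub> f x)\<rparr>"

text \<open>\<open>quotient_length A M L N\<close> is the length of the \<open>A\<close>-module \<open>N / L\<close>, for submodules
  \<open>L \<subseteq> N\<close> of \<open>M\<close>.\<close>

definition quotient_length :: "'a ring \<Rightarrow> ('a, 'm) module \<Rightarrow> 'm set \<Rightarrow> 'm set \<Rightarrow> enat" where
  "quotient_length A M L N =
    Sup {enat n | n. \<exists>U. U 0 = L \<and> U n = N \<and> (\<forall>i\<le>n. submodule (U i) A M) \<and>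
                       (\<forall>i<n. U i \<subset> U (Suc i))}"

definition fin_gen_module :: "'a ring \<Rightarrow> ('a, 'm) module \<Rightarrow> bool" where
  "fin_gen_module A M \<longleftrightarrow>
    (\<exists>S. finite S \<and> S \<subseteq> carrier M \<and> (\<forall>N. submodule N A M \<and> S \<subseteq> N \<longrightarrow> N = carrier M))"

section \<open>Ext\<close>

text \<open>A resolution \<open>\<dots> \<rightarrow> A^n(2) \<rightarrow> A^n(1) \<rightarrow> A^n(0) \<rightarrow> M \<rightarrow> 0\<close> by free modules of finite rank,
  where \<open>d i\<close> maps \<open>A^n(i+1)\<close> to \<open>A^n(i)\<close>.\<close>

definition free_resolution ::
    "'a ring \<Rightarrow> ('a, 'm) module \<Rightarrow> (nat \<Rightarrow> nat) \<Rightarrow> (nat \<Rightarrow> (nat \<Rightarrow> 'a) \<Rightarrow> nat \<Rightarrow> 'a) \<Rightarrow>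
     ((nat \<Rightarrow> 'a) \<Rightarrow> 'm) \<Rightarrow> bool" where
  "free_resolution A M n d e \<longleftrightarrow>
    e \<in> mod_hom A (free_module A (n 0)) M \<and>
    (\<forall>i. d i \<in> mod_hom A (free_module A (n (Suc i))) (free_module A (n i))) \<and>
    e ` carrier (free_module A (n 0)) = carrier M \<and>
    d 0 ` carrier (free_module A (n 1)) = {x \<in> carrier (free_module A (n 0)). e x = \<zero>\<^bsub>M\<^esub>} \<and>
    (\<forall>i. d (Suc i) ` carrier (free_module A (n (Suc (Suc i)))) =
         {x \<in> carrier (free_module A (n (Suc i))). d i x = \<zero>\<^bsub>free_module A (n i)\<^esub>})"

definition cocycles ::
    "'a ring \<Rightarrow> (nat \<Rightarrow> nat) \<Rightarrow> (nat \<Rightarrow> (nat \<Rightarrow> 'a) \<Rightarrow> nat \<Rightarrow> 'a) \<Rightarrow> ('a, 'm) module \<Rightarrow> nat \<Rightarrow>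
     ((nat \<Rightarrow> 'a) \<Rightarrow> 'm) set" where
  "cocycles A n d N i =
    {f \<in> mod_hom A (free_module A (n i)) N.
      \<forall>x\<in>carrier (free_module A (n (Suc i))). f (d i x) = \<zero>\<^bsub>N\<^esub>}"

fun coboundaries ::
    "'a ring \<Rightarrow> (nat \<Rightarrow> nat) \<Rightarrow> (nat \<Rightarrow> (nat \<Rightarrow> 'a) \<Rightarrow> nat \<Rightarrow> 'a) \<Rightarrow> ('a, 'm) module \<Rightarrow> nat \<Rightarrow>
     ((nat \<Rightarrow> 'a) \<Rightarrow> 'm) set" where
  "coboundaries A n d N 0 = {\<lambda>x\<in>carrier (free_module A (n 0)). \<zero>\<^bsub>N\<^esub>}"
| "coboundaries A n d N (Suc i) =
    {\<lambda>x\<in>carrier (free_module A (n (Suc i))). g (d i x) | g. g \<in> mod_hom A (free_module A (n i)) N}"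

text \<open>\<open>Ext_length A M N i l\<close>: the module \<open>Ext^i_A(M, N)\<close>, computed as the cohomology of
  \<open>Hom_A(F, N)\<close> for a free resolution \<open>F\<close> of \<open>M\<close>, has length \<open>l\<close>. The length does not depend on
  \<open>F\<close>, and over a Noetherian ring every finitely generated \<open>M\<close> has such a resolution.\<close>

definition Ext_length ::
    "'a ring \<Rightarrow> ('a, 'm) module \<Rightarrow> ('a, 'n) module \<Rightarrow> nat \<Rightarrow> enat \<Rightarrow> bool" where
  "Ext_length A M N i l \<longleftrightarrow>
    (\<exists>n d e. free_resolution A M n d e \<and>
      quotient_length A (hom_module A (free_module A (n i)) N)
        (coboundaries A n d N i) (cocycles A n d N i) = l)"

section \<open>Canonical modules and Gorenstein rings\<close>

definition krull_dim :: "'a ring \<Rightarrow> enat" where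
  "krull_dim A =
    Sup {enat n | n. \<exists>P. (\<forall>i\<le>n. primeideal (P i) A) \<and> (\<forall>i<n. P i \<subset> P (Suc i))}"

text \<open>For a Noetherian local ring \<open>A\<close> of dimension \<open>d\<close> with maximal ideal \<open>\<mm>\<close> and residue field
  \<open>\<kappa> = A/\<mm>\<close>, a finitely generated module \<open>M\<close> is canonical iff \<open>dim Ext^i_A(\<kappa>, M)\<close> is \<open>1\<close> for
  \<open>i = d\<close> and \<open>0\<close> otherwise: vanishing below \<open>d\<close> says that \<open>M\<close> is maximal Cohen-Macaulay, the value
  at \<open>d\<close> that it has type one, and vanishing above \<open>d\<close> that its injective dimension is finite (in
  which case it equals \<open>d\<close>). As \<open>\<mm>\<close> annihilates \<open>Ext^i_A(\<kappa>, M)\<close>, its length over \<open>A\<close> is its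
  dimension over \<open>\<kappa>\<close>.\<close>

definition canonical_module_local :: "'a ring \<Rightarrow> 'a set \<Rightarrow> ('a, 'm) module \<Rightarrow> bool" where
  "canonical_module_local A \<mm> M \<longleftrightarrow>
    fin_gen_module A M \<and>
    (\<forall>i. Ext_length A (quotient_module A \<mm>) M i (if enat i = krull_dim A then 1 else 0))"

text \<open>By Baer's criterion, \<open>M\<close> has injective dimension at most \<open>b\<close> iff \<open>Ext^i_A(A/I, M) = 0\<close> for
  all \<open>i > b\<close> and all ideals \<open>I\<close>.\<close>

definition finite_inj_dim :: "'a ring \<Rightarrow> ('a, 'm) module \<Rightarrow> bool" where
  "finite_inj_dim A M \<longleftrightarrow>
    (\<exists>b. \<forall>i>b. \<forall>I. ideal I A \<longrightarrow> Ext_length A (quotient_module A I) M i 0)"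

text \<open>For a subring \<open>R\<close> of a field, a prime ideal \<open>\<pp>\<close> of \<open>R\<close> and an ideal \<open>I\<close> of \<open>R\<close>,
  \<open>localize R \<pp> I\<close> is the localization of \<open>I\<close> at \<open>\<pp>\<close>, realized inside that field.\<close>

definition localize :: "'f::field set \<Rightarrow> 'f set \<Rightarrow> 'f set \<Rightarrow> 'f set" where
  "localize R \<pp> I = {x / s | x s. x \<in> I \<and> s \<in> R \<and> s \<notin> \<pp>}"

definition canonical_ideal :: "'f::field set \<Rightarrow> 'f set \<Rightarrow> bool" where
  "canonical_ideal R C \<longleftrightarrow>
    ideal C (ring_on R) \<and>
    (\<forall>\<nn>. maximalideal \<nn> (ring_on R) \<longrightarrow>
      (let A = ring_on (localize R \<nn> R) in
        canonical_module_local A (localize R \<nn> \<nn>) (ideal_module A (localize R \<nn> C))))"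

definition gorenstein :: "'f::field set \<Rightarrow> bool" where
  "gorenstein R \<longleftrightarrow>
    (\<forall>\<nn>. maximalideal \<nn> (ring_on R) \<longrightarrow>
      (let A = ring_on (localize R \<nn> R) in finite_inj_dim A (ideal_module A (carrier A))))"

definition primary_to :: "'a::comm_ring_1 set \<Rightarrow> 'a set \<Rightarrow> 'a set \<Rightarrow> bool" where
  "primary_to R \<mm> C \<longleftrightarrow>
    ideal C (ring_on R) \<and> C \<noteq> R \<and>
    (\<forall>x\<in>R. \<forall>y\<in>R. x * y \<in> C \<longrightarrow> x \<in> C \<or> (\<exists>n. y ^ n \<in> C)) \<and>
    {x \<in> R. \<exists>n. x ^ n \<in> C} = \<mm>"

section \<open>The bi-canonical degree\<close>

definition dual_module :: "'a ring \<Rightarrow> ('a, 'm) module \<Rightarrow> ('a, 'm \<Rightarrow> 'a) module" where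
  "dual_module A M = hom_module A M (ideal_module A (carrier A))"

definition bidual_map :: "'a ring \<Rightarrow> ('a, 'm) module \<Rightarrow> 'm \<Rightarrow> ('m \<Rightarrow> 'a) \<Rightarrow> 'a" where
  "bidual_map A M = (\<lambda>x\<in>carrier M. \<lambda>f\<in>carrier (dual_module A M). f x)"

text \<open>The length of \<open>C** / C\<close>, where \<open>C\<close> is embedded in \<open>C**\<close> by the evaluation map.\<close>

definition bideg :: "'a::comm_ring_1 set \<Rightarrow> 'a set \<Rightarrow> enat" where
  "bideg R C =
    (let A = ring_on R; M = ideal_module A C; B = dual_module A (dual_module A M)
     in quotient_length A B (bidual_map A M ` C) (carrier B))"

section \<open>Monomial space curves and Herzog matrices\<close>

text \<open>The polynomial ring \<open>k[X,Y,Z]\<close>; the exponent \<open>(i, j, l)\<close> stands for \<open>X^i Y^j Z^l\<close>.\<close>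

type_synonym 'k poly3 = "(nat \<times> nat \<times> nat) \<Rightarrow>\<^sub>0 'k"

definition varX :: "'k::field poly3" where "varX = Poly_Mapping.single (1, 0, 0) 1"
definition varY :: "'k::field poly3" where "varY = Poly_Mapping.single (0, 1, 0) 1"
definition varZ :: "'k::field poly3" where "varZ = Poly_Mapping.single (0, 0, 1) 1"

definition Gamma :: "nat \<Rightarrow> nat \<Rightarrow> nat \<Rightarrow> 'k::field poly3 \<Rightarrow> 'k poly" where
  "Gamma a b c p =
    (\<Sum>(i, j, l)\<in>Poly_Mapping.keys p.
      Polynomial.smult (Poly_Mapping.lookup p (i, j, l)) (monom 1 a ^ i * monom 1 b ^ j * monom 1 c ^ l))"

text \<open>The ring \<open>k[t^a, t^b, t^c]\<close> and its ideal \<open>(t^a, t^b, t^c)\<close>, inside the field \<open>k(t)\<close>.\<close>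

definition monomial_ring :: "nat \<Rightarrow> nat \<Rightarrow> nat \<Rightarrow> 'k::field poly fract set" where
  "monomial_ring a b c = (\<lambda>p. Fract p 1) ` range (Gamma a b c)"

definition monomial_max_ideal :: "nat \<Rightarrow> nat \<Rightarrow> nat \<Rightarrow> 'k::field poly fract set" where
  "monomial_max_ideal a b c =
    Idl\<^bsub>ring_on (monomial_ring a b c)\<^esub> {Fract (monom 1 a) 1, Fract (monom 1 b) 1, Fract (monom 1 c) 1}"

definition herzog_matrix ::
    "nat \<Rightarrow> nat \<Rightarrow> nat \<Rightarrow> nat \<Rightarrow> nat \<Rightarrow> nat \<Rightarrow> 'k::field poly3 list list" where
  "herzog_matrix a1 a2 b1 b2 c1 c2 =
    [[varX ^ a1, varY ^ b2],
     [varY ^ b1, varZ ^ c2],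
     [varZ ^ c1, varX ^ a2]]"

text \<open>The ideal of \<open>2 \<times> 2\<close> minors of a matrix with two columns, given as the list of its rows.\<close>

definition I2 :: "'a::comm_ring_1 list list \<Rightarrow> 'a set" where
  "I2 \<phi> = Idl\<^bsub>ring_on UNIV\<^esub>
    {\<phi> ! i ! 0 * \<phi> ! j ! 1 - \<phi> ! i ! 1 * \<phi> ! j ! 0 | i j. i < j \<and> j < length \<phi>}"

end

theory Submission
  imports
    Defs
    "HOL-Computational_Algebra.Formal_Laurent_Series"
    "HOL-Computational_Algebra.Polynomial_FPS"
begin

text \<open>
  Let \<open>S\<close> be the semigroup generated by \<open>a, b, c\<close>. A canonical ideal \<open>C\<close> has a one-dimensional socle
  \<open>(C : \<mm>) / C \<cong> Ext\<^sup>1(k, C)\<close>, so it is the annihilator of a single functional on Laurent polynomials.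
  Such a functional is \<open>x \<mapsto> [t^g] (u x)\<close> for some \<open>g\<close> and some Laurent series \<open>u\<close>, whence \<open>u C\<close> is
  spanned, up to completion, by the monomials with exponent in \<open>K = {n. g - n \<notin> S}\<close>. Colons of such
  modules are again of this form, and lengths of quotients are numbers of exponents, so that
  \<open>bideg R\<close> is the cardinality of \<open>(S - (S - K)) - K\<close>, where \<open>S - E = {n. n + E \<subseteq> S}\<close>.

  The reflection \<open>n \<mapsto> g - n\<close> maps this set onto the complement in \<open>S\<close> of the exponents of the
  trace ideal \<open>K \<cdot> (R : K)\<close>. The Herzog relations show that \<open>S\<close> has two pseudo-Frobenius
  numbers, differing by \<open>\<delta> = a a\<^sub>1 - b b\<^sub>2 = b b\<^sub>1 - c c\<^sub>2 = c c\<^sub>1 - a a\<^sub>2\<close>, and hence that the trace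
  exponents are the \<open>q \<in> S\<close> with \<open>q + \<delta> \<in> S\<close> or \<open>q - \<delta> \<in> S\<close>. Under the hypotheses on the exponents
  these are the degrees of the monomials in \<open>(X^a\<^sub>1, Y^b\<^sub>2, Z^c\<^sub>1)\<close>, and the remaining
  \<open>a\<^sub>1 b\<^sub>2 c\<^sub>1\<close> monomials have pairwise distinct degrees.
\<close>

unbundle fps_syntax

section \<open>The semigroup of a Herzog matrix\<close>

text \<open>The obstacle is that \<open>C\<close> is an arbitrary ideal: it need not be spanned by
  monomials, and the series \<open>u\<close> that straightens it out need not be a rational
  function. So there may be no element \<open>x\<close> of the ring with \<open>x u = t^e\<close>.
  All exponent sets involved contain every large integer, however, so errors of high order are
  harmless, and a Laurent polynomial \<open>x\<close> such that \<open>x u\<close> agrees with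
  \<open>t^e\<close> up to a prescribed order serves the same purpose. Lengths are then read off
  from the orders of the series \<open>x u\<close>.

  Canonicity is a condition on a localization, whereas the functional lives over \<open>k\<close>.
  The two meet in the socle, on which an element of \<open>R\<close> acts through its constant term;
  a denominator outside \<mm> has nonzero constant term and so can be removed.

  The number \<delta> is the difference of the degrees of the two entries in a row of the matrix,
  the same for each row because the minors are homogeneous. Exchanging one entry for the other
  inside a monomial moves its degree by \<delta> up or down; this turns divisibility by an entry
  into membership in the trace exponents.\<close>

definition mon_deg :: "nat \<Rightarrow> nat \<Rightarrow> nat \<Rightarrow> nat \<times> nat \<times> nat \<Rightarrow> nat" where
  "mon_deg a b c = (\<lambda>(i, j, l). a * i + b * j + c * l)"

lemma monom_one_power: "monom (1::'k::field) n ^ i = monom 1 (n * i)"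
  by (induction i) (simp_all add: mult_monom monom_eq_1_iff)

section \<open>The map \<open>Gamma\<close> and its image\<close>

lemma Gamma_alt:
  fixes p :: "'k::field poly3"
  assumes "finite A" "Poly_Mapping.keys p \<subseteq> A"
  shows "Gamma a b c p = (\<Sum>e\<in>A. monom (Poly_Mapping.lookup p e) (mon_deg a b c e))"
proof -
  have "Gamma a b c p = (\<Sum>e\<in>Poly_Mapping.keys p. monom (Poly_Mapping.lookup p e) (mon_deg a b c e))"
    unfolding Gamma_def
    by (rule sum.cong) (auto simp: mon_deg_def monom_one_power mult_monom smult_monom)
  also have "\<dots> = (\<Sum>e\<in>A. monom (Poly_Mapping.lookup p e) (mon_deg a b c e))"
    by (rule sum.mono_neutral_left) (use assms in \<open>auto simp: in_keys_iff\<close>)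
  finally show ?thesis .
qed

lemma Gamma_add: "Gamma a b c (p + q) = Gamma a b c p + Gamma a b c (q :: 'k::field poly3)"
proof -
  let ?A = "Poly_Mapping.keys p \<union> Poly_Mapping.keys q"
  have "Poly_Mapping.keys (p + q) \<subseteq> ?A" by (rule Poly_Mapping.keys_add)
  then show ?thesis
    by (simp add: Gamma_alt[where A = ?A] sum.distrib lookup_add add_monom[symmetric])
qed

lemma Gamma_0: "Gamma a b c 0 = 0"
  by (simp add: Gamma_def)

lemma Gamma_diff: "Gamma a b c (p - q) = Gamma a b c p - Gamma a b c (q :: 'k::field poly3)"
  using Gamma_add[of a b c "p - q" q] by simp

lemma Gamma_single: "Gamma a b c (Poly_Mapping.single e (x::'k::field)) = monom x (mon_deg a b c e)"
  by (subst Gamma_alt[where A = "{e}"]) auto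

lemma Gamma_sum: "finite A \<Longrightarrow> Gamma a b c (\<Sum>x\<in>A. f x) = (\<Sum>x\<in>A. Gamma a b c (f x :: 'k::field poly3))"
  by (induction rule: finite_induct) (simp_all add: Gamma_add Gamma_0)

definition num_semigroup :: "nat \<Rightarrow> nat \<Rightarrow> nat \<Rightarrow> int set" where
  "num_semigroup a b c = range (\<lambda>e. int (mon_deg a b c e))"

text \<open>For the inclusion from right to left, one monomial is chosen for each degree in which
  \<open>q\<close> has a nonzero coefficient; the resulting combination is a preimage.\<close>

lemma range_Gamma:
  "range (Gamma a b c :: 'k::field poly3 \<Rightarrow> _) = {q. \<forall>n. coeff q n \<noteq> 0 \<longrightarrow> int n \<in> num_semigroup a b c}"
proof (intro subset_antisym subsetI)
  fix q :: "'k poly" assume "q \<in> range (Gamma a b c)"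
  then obtain p where p: "q = Gamma a b c p" by auto
  have coeff: "coeff q n = (\<Sum>e\<in>Poly_Mapping.keys p. coeff (monom (Poly_Mapping.lookup p e) (mon_deg a b c e)) n)" for n
    unfolding p by (subst Gamma_alt[where A = "Poly_Mapping.keys p"]) (auto simp: coeff_sum)
  have "int n \<in> num_semigroup a b c" if "coeff q n \<noteq> 0" for n
  proof -
    from that obtain e where "coeff (monom (Poly_Mapping.lookup p e) (mon_deg a b c e)) n \<noteq> 0"
      unfolding coeff by (rule sum.not_neutral_contains_not_neutral)
    then show ?thesis by (auto simp: num_semigroup_def split: if_splits)
  qed
  then show "q \<in> {q. \<forall>n. coeff q n \<noteq> 0 \<longrightarrow> int n \<in> num_semigroup a b c}" by blast
next
  fix q :: "'k poly" assume "q \<in> {q. \<forall>n. coeff q n \<noteq> 0 \<longrightarrow> int n \<in> num_semigroup a b c}"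
  then have "\<forall>n. \<exists>e. coeff q n \<noteq> 0 \<longrightarrow> n = mon_deg a b c e"
    by (auto simp: num_semigroup_def image_iff simp del: split_paired_Ex)
  then obtain r where r: "\<And>n. coeff q n \<noteq> 0 \<Longrightarrow> n = mon_deg a b c (r n)" by metis
  have "q = (\<Sum>n\<le>degree q. monom (coeff q n) n)" by (simp add: poly_as_sum_of_monoms)
  also have "\<dots> = (\<Sum>n\<le>degree q. Gamma a b c (Poly_Mapping.single (r n) (coeff q n)))"
  proof (rule sum.cong[OF refl])
    fix n
    show "monom (coeff q n) n = Gamma a b c (Poly_Mapping.single (r n) (coeff q n))"
      using r[of n] by (cases "coeff q n = 0") (simp_all add: Gamma_single Gamma_0)
  qed
  also have "\<dots> = Gamma a b c (\<Sum>n\<le>degree q. Poly_Mapping.single (r n) (coeff q n))"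
    by (simp add: Gamma_sum)
  finally show "q \<in> range (Gamma a b c)" by blast
qed

section \<open>Subrings and their ideals in elementary terms\<close>

lemma ring_on_simps [simp]:
  "carrier (ring_on S) = S" "monoid.mult (ring_on S) = (*)" "one (ring_on S) = 1"
  "zero (ring_on S) = 0" "add (ring_on S) = (+)"
  by (simp_all add: ring_on_def)

lemma cring_ring_on:
  fixes S :: "'a::comm_ring_1 set"
  assumes "0 \<in> S" "1 \<in> S" "\<And>x y. x \<in> S \<Longrightarrow> y \<in> S \<Longrightarrow> x + y \<in> S"
    "\<And>x. x \<in> S \<Longrightarrow> - x \<in> S" "\<And>x y. x \<in> S \<Longrightarrow> y \<in> S \<Longrightarrow> x * y \<in> S"
  shows "cring (ring_on S)"
proof (rule cringI)
  show "abelian_group (ring_on S)"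
    by (rule abelian_groupI) (use assms in \<open>auto simp: algebra_simps intro!: bexI[where x = "- _"]\<close>)
  show "comm_monoid (ring_on S)"
    by (rule comm_monoidI) (use assms in \<open>auto simp: algebra_simps\<close>)
qed (use assms in \<open>auto simp: algebra_simps\<close>)

lemma uminus_one_in_cring:
  assumes "cring (ring_on A)"
  shows "- 1 \<in> A"
proof -
  interpret cring "ring_on A" by fact
  have "\<ominus>\<^bsub>ring_on A\<^esub> 1 + 1 = 0" "\<ominus>\<^bsub>ring_on A\<^esub> 1 \<in> A"
    using l_neg[of 1] a_inv_closed[of 1] one_closed by simp_all
  then show ?thesis by (metis add_eq_0_iff2)
qed

lemma ideal_ring_on_iff:
  fixes S :: "'a::comm_ring_1 set"
  assumes "cring (ring_on S)"
  shows "ideal I (ring_on S) \<longleftrightarrow> I \<subseteq> S \<and> 0 \<in> I \<and> (\<forall>x\<in>I. \<forall>y\<in>I. x + y \<in> I) \<and> (\<forall>r\<in>S. \<forall>x\<in>I. r * x \<in> I)"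
proof
  interpret R: cring "ring_on S" by fact
  {
    assume "ideal I (ring_on S)"
    then interpret ideal I "ring_on S" .
    show "I \<subseteq> S \<and> 0 \<in> I \<and> (\<forall>x\<in>I. \<forall>y\<in>I. x + y \<in> I) \<and> (\<forall>r\<in>S. \<forall>x\<in>I. r * x \<in> I)"
      using a_subset zero_closed I_l_closed a_closed by auto
  }
  assume *: "I \<subseteq> S \<and> 0 \<in> I \<and> (\<forall>x\<in>I. \<forall>y\<in>I. x + y \<in> I) \<and> (\<forall>r\<in>S. \<forall>x\<in>I. r * x \<in> I)"
  have inv: "\<ominus>\<^bsub>ring_on S\<^esub> x = - x" if "x \<in> S" for x
    using R.r_neg[of x] that by (simp add: eq_neg_iff_add_eq_0 add.commute)
  have m1: "- 1 \<in> S" by (rule uminus_one_in_cring[OF assms])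
  show "ideal I (ring_on S)"
  proof (rule idealI)
    show "ring (ring_on S)" ..
    show "subgroup I (add_monoid (ring_on S))"
    proof (rule R.add.subgroupI)
      show "I \<subseteq> carrier (ring_on S)" "I \<noteq> {}" using * by auto
      fix x assume "x \<in> I"
      then have "- 1 * x \<in> I" using m1 * by blast
      then show "\<ominus>\<^bsub>ring_on S\<^esub> x \<in> I" using inv * \<open>x \<in> I\<close> by auto
    qed (use * in auto)
    fix x y assume "x \<in> I" "y \<in> carrier (ring_on S)"
    then have "y * x \<in> I" using * by simp
    then show "y \<otimes>\<^bsub>ring_on S\<^esub> x \<in> I" "x \<otimes>\<^bsub>ring_on S\<^esub> y \<in> I" by (simp_all add: mult.commute)
  qed
qed

lemma cring_ring_on_UNIV: "cring (ring_on UNIV)"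
  by (rule cring_ring_on) auto

section \<open>Minors of the Herzog matrix and degrees of monomials\<close>

lemma var_power:
  "varX ^ n = (Poly_Mapping.single (n, 0, 0) 1 :: 'k::field poly3)"
  "varY ^ n = (Poly_Mapping.single (0, n, 0) 1 :: 'k poly3)"
  "varZ ^ n = (Poly_Mapping.single (0, 0, n) 1 :: 'k poly3)"
proof -
  have one: "(1 :: 'k poly3) = Poly_Mapping.single (0, 0, 0) 1"
    by (metis single_one zero_prod_def)
  show "varX ^ n = (Poly_Mapping.single (n, 0, 0) 1 :: 'k::field poly3)"
    by (induction n) (simp_all add: one varX_def mult_single)
  show "varY ^ n = (Poly_Mapping.single (0, n, 0) 1 :: 'k poly3)"
    by (induction n) (simp_all add: one varY_def mult_single)
  show "varZ ^ n = (Poly_Mapping.single (0, 0, n) 1 :: 'k poly3)"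
    by (induction n) (simp_all add: one varZ_def mult_single)
qed

lemma herzog_minors:
  "{\<phi> ! i ! 0 * \<phi> ! j ! 1 - \<phi> ! i ! 1 * \<phi> ! j ! 0 | i j. i < j \<and> j < length \<phi>} =
   {Poly_Mapping.single (a1, 0, c2) 1 - Poly_Mapping.single (0, b1 + b2, 0) 1,
    Poly_Mapping.single (a1 + a2, 0, 0) 1 - Poly_Mapping.single (0, b2, c1) 1,
    Poly_Mapping.single (a2, b1, 0) 1 - Poly_Mapping.single (0, 0, c1 + c2) (1::'k::field)}"
  if "\<phi> = herzog_matrix a1 a2 b1 b2 c1 c2"
proof -
  have 1: "i < j \<and> j < length \<phi> \<longleftrightarrow> (i = 0 \<and> j = 1) \<or> (i = 0 \<and> j = 2) \<or> (i = 1 \<and> j = 2)" for i j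
    unfolding that herzog_matrix_def by auto
  have "{\<phi> ! i ! 0 * \<phi> ! j ! 1 - \<phi> ! i ! 1 * \<phi> ! j ! 0 | i j. i < j \<and> j < length \<phi>} =
    {\<phi> ! 0 ! 0 * \<phi> ! 1 ! 1 - \<phi> ! 0 ! 1 * \<phi> ! 1 ! 0, \<phi> ! 0 ! 0 * \<phi> ! 2 ! 1 - \<phi> ! 0 ! 1 * \<phi> ! 2 ! 0,
     \<phi> ! 1 ! 0 * \<phi> ! 2 ! 1 - \<phi> ! 1 ! 1 * \<phi> ! 2 ! 0}"
    unfolding 1 by blast
  then show ?thesis
    unfolding that herzog_matrix_def by (simp add: var_power mult_single add.commute)
qed

text \<open>As \<Delta> is closed under divisors of monomials, the polynomials without a term in
  \<Delta> form an ideal. It contains the minors as soon as none of their six terms is in \<Delta>,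
  and then it contains all of \<open>I2\<close>.\<close>

lemma lookup_I2_eq_0:
  fixes p :: "'k::field poly3"
  assumes p: "p \<in> I2 (herzog_matrix a1 a2 b1 b2 c1 c2)"
    and down: "\<And>e e'. e + e' \<in> \<Delta> \<Longrightarrow> e' \<in> \<Delta>"
    and out: "{(a1, 0, c2), (0, b1 + b2, 0), (a1 + a2, 0, 0), (0, b2, c1), (a2, b1, 0), (0, 0, c1 + c2)} \<inter> \<Delta> = {}"
    and e: "e \<in> \<Delta>"
  shows "Poly_Mapping.lookup p e = 0"
proof -
  let ?J = "{p :: 'k poly3. \<forall>e\<in>\<Delta>. Poly_Mapping.lookup p e = 0}"
  let ?G = "{Poly_Mapping.single (a1, 0, c2) 1 - Poly_Mapping.single (0, b1 + b2, 0) 1,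
    Poly_Mapping.single (a1 + a2, 0, 0) 1 - Poly_Mapping.single (0, b2, c1) 1,
    Poly_Mapping.single (a2, b1, 0) 1 - Poly_Mapping.single (0, 0, c1 + c2) (1::'k)}"
  have "ideal ?J (ring_on UNIV)"
  proof -
    have "Poly_Mapping.lookup (r * x) e = 0" if "x \<in> ?J" "e \<in> \<Delta>" for r x e
    proof (rule ccontr)
      assume "Poly_Mapping.lookup (r * x) e \<noteq> 0"
      then have "e \<in> Poly_Mapping.keys (r * x)" by (simp add: in_keys_iff)
      then obtain e1 e2 where "e = e1 + e2" "e2 \<in> Poly_Mapping.keys x"
        using keys_mult[of r x] by blast
      then show False using that down[of e1 e2] by (auto simp: in_keys_iff)
    qed
    then show ?thesis by (auto simp: ideal_ring_on_iff[OF cring_ring_on_UNIV] lookup_add)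
  qed
  moreover have "?G \<subseteq> ?J"
    using out by (auto simp: lookup_minus lookup_single when_def)
  ultimately have "I2 (herzog_matrix a1 a2 b1 b2 c1 c2) \<subseteq> ?J"
    unfolding I2_def herzog_minors[OF refl] genideal_def by blast
  then show ?thesis using p e by blast
qed

lemma minors_in_I2:
  "{Poly_Mapping.single (a1, 0, c2) 1 - Poly_Mapping.single (0, b1 + b2, 0) 1,
    Poly_Mapping.single (a1 + a2, 0, 0) 1 - Poly_Mapping.single (0, b2, c1) 1,
    Poly_Mapping.single (a2, b1, 0) 1 - Poly_Mapping.single (0, 0, c1 + c2) (1::'k::field)}
   \<subseteq> I2 (herzog_matrix a1 a2 b1 b2 c1 c2)"
proof -
  interpret cring "ring_on (UNIV :: 'k poly3 set)" by (rule cring_ring_on_UNIV)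
  show ?thesis unfolding I2_def herzog_minors[OF refl]
    by (rule genideal_self) auto
qed

text \<open>The last axiom: a monomial that is not divisible by any of the six terms of the minors is the
  only monomial of its degree.\<close>

locale herzog_semigroup =
  fixes a b c a1 a2 b1 b2 c1 c2 :: nat
  assumes pos: "0 < a" "0 < b" "0 < c" "0 < a1" "0 < a2" "0 < b1" "0 < b2" "0 < c1" "0 < c2"
    and gcd1: "gcd a (gcd b c) = 1"
    and eqX: "a * (a1 + a2) = b * b2 + c * c1"
    and eqY: "b * (b1 + b2) = a * a1 + c * c2"
    and eqZ: "c * (c1 + c2) = a * a2 + b * b1"
    and standard_unique:
      "\<lbrakk>\<not> (a1 \<le> i \<and> c2 \<le> l); j < b1 + b2; i < a1 + a2; \<not> (b2 \<le> j \<and> c1 \<le> l); \<not> (a2 \<le> i \<and> b1 \<le> j);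
        l < c1 + c2; a * i + b * j + c * l = a * i' + b * j' + c * l'\<rbrakk>
       \<Longrightarrow> i = i' \<and> j = j' \<and> l = l'"

lemma herzog_semigroup_if_kernel:
  assumes "0 < a" "0 < b" "0 < c" "0 < a1" "0 < a2" "0 < b1" "0 < b2" "0 < c1" "0 < c2"
    and "gcd a (gcd b c) = 1"
    and ker: "{p :: 'k::field poly3. Gamma a b c p = 0} = I2 (herzog_matrix a1 a2 b1 b2 c1 c2)"
  shows "herzog_semigroup a b c a1 a2 b1 b2 c1 c2"
proof
  have eq: "mon_deg a b c e = mon_deg a b c e'"
    if "Poly_Mapping.single e 1 - Poly_Mapping.single e' (1::'k) \<in> I2 (herzog_matrix a1 a2 b1 b2 c1 c2)" for e e'
  proof -
    have "Gamma a b c (Poly_Mapping.single e 1 - Poly_Mapping.single e' (1::'k)) = 0"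
      using that ker by blast
    then have "monom (1::'k) (mon_deg a b c e) = monom 1 (mon_deg a b c e')"
      by (simp add: Gamma_diff Gamma_single)
    then show ?thesis by (metis degree_monom_eq one_neq_zero)
  qed
  show "a * (a1 + a2) = b * b2 + c * c1"
    using eq[of "(a1 + a2, 0, 0)" "(0, b2, c1)"] minors_in_I2[of a1 c2 b1 b2 a2 c1] by (auto simp: mon_deg_def)
  show "b * (b1 + b2) = a * a1 + c * c2"
    using eq[of "(a1, 0, c2)" "(0, b1 + b2, 0)", symmetric] minors_in_I2[of a1 c2 b1 b2 a2 c1] by (auto simp: mon_deg_def)
  show "c * (c1 + c2) = a * a2 + b * b1"
    using eq[of "(a2, b1, 0)" "(0, 0, c1 + c2)", symmetric] minors_in_I2[of a1 c2 b1 b2 a2 c1] by (auto simp: mon_deg_def)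
next
  fix i j l i' j' l' :: nat
  assume std: "\<not> (a1 \<le> i \<and> c2 \<le> l)" "j < b1 + b2" "i < a1 + a2" "\<not> (b2 \<le> j \<and> c1 \<le> l)" "\<not> (a2 \<le> i \<and> b1 \<le> j)"
    "l < c1 + c2" and deg: "a * i + b * j + c * l = a * i' + b * j' + c * l'"
  \<comment> \<open>A difference of two monomials of equal degree is in the kernel. With \<Delta>
    the set of monomials divisible by none of the six terms, the coefficient of the first monomial
    must vanish, which is possible only if the two monomials coincide.\<close>
  let ?p = "Poly_Mapping.single (i, j, l) 1 - Poly_Mapping.single (i', j', l') (1::'k)"
  have "Gamma a b c ?p = 0" using deg by (simp add: Gamma_diff Gamma_single mon_deg_def)
  then have "?p \<in> I2 (herzog_matrix a1 a2 b1 b2 c1 c2)" using ker by blast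
  then have "Poly_Mapping.lookup ?p (i, j, l) = 0"
    by (rule lookup_I2_eq_0[where \<Delta> = "{(i, j, l). \<not> (a1 \<le> i \<and> c2 \<le> l) \<and> j < b1 + b2 \<and> i < a1 + a2 \<and>
      \<not> (b2 \<le> j \<and> c1 \<le> l) \<and> \<not> (a2 \<le> i \<and> b1 \<le> j) \<and> l < c1 + c2}"])
      (use std in auto)
  then show "i = i' \<and> j = j' \<and> l = l'"
    by (auto simp: lookup_minus lookup_single when_def split: if_splits)
qed (use assms in auto)

section \<open>Numerical semigroups\<close>

lemma num_semigroup_iff:
  "n \<in> num_semigroup a b c \<longleftrightarrow> (\<exists>i j l. n = int (a * i + b * j + c * l))"
  by (auto simp: num_semigroup_def mon_deg_def image_iff)

lemma num_semigroupI: "int (a * i + b * j + c * l) \<in> num_semigroup a b c"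
  by (auto simp: num_semigroup_iff)

lemma num_semigroup_0: "0 \<in> num_semigroup a b c"
  using num_semigroupI[of a 0 b 0 c 0] by simp

lemma num_semigroup_add:
  assumes "m \<in> num_semigroup a b c" "n \<in> num_semigroup a b c"
  shows "m + n \<in> num_semigroup a b c"
proof -
  obtain i j l i' j' l' where "m = int (a * i + b * j + c * l)" "n = int (a * i' + b * j' + c * l')"
    using assms unfolding num_semigroup_iff by blast
  then have "m + n = int (a * (i + i') + b * (j + j') + c * (l + l'))" by (simp add: algebra_simps)
  then show ?thesis by (simp only: num_semigroupI)
qed

lemma num_semigroup_nonneg: "n \<in> num_semigroup a b c \<Longrightarrow> 0 \<le> n"
  unfolding num_semigroup_iff by auto

lemma num_semigroup_mult:
  assumes "n \<in> num_semigroup a b c"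
  shows "int k * n \<in> num_semigroup a b c"
  by (induction k) (auto simp: num_semigroup_0 algebra_simps intro: num_semigroup_add assms)

text \<open>Splitting the coefficients of a Bezout relation into positive and negative parts yields
  two consecutive elements \<open>y\<close> and \<open>y + 1\<close> of the semigroup, and these
  generate all large integers.\<close>

lemma num_semigroup_cofinite:
  assumes "gcd a (gcd b c) = 1"
  obtains N where "\<And>n. n \<ge> N \<Longrightarrow> n \<in> num_semigroup a b c"
proof -
  obtain v w where vw: "v * int b + w * int c = gcd (int b) (int c)" using bezout_int by blast
  obtain u z where uz: "u * int a + z * gcd (int b) (int c) = gcd (int a) (gcd (int b) (int c))"
    using bezout_int by blast
  have *: "u * int a + (z * v) * int b + (z * w) * int c = 1"
  proof -
    have "gcd (int a) (gcd (int b) (int c)) = 1" using assms by simp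
    then show ?thesis using uz by (simp only: vw[symmetric]) (simp add: algebra_simps)
  qed
  obtain u1 u2 v1 v2 w1 w2 :: nat
    where uvw: "u = int u1 - int u2" "z * v = int v1 - int v2" "z * w = int w1 - int w2"
    by (metis int_diff_cases)
  define y where "y = int (a * u2 + b * v2 + c * w2)"
  have y: "y \<in> num_semigroup a b c" unfolding y_def by (rule num_semigroupI)
  have "y + 1 = int (a * u1 + b * v1 + c * w1)"
    unfolding y_def *[symmetric] uvw by (simp add: algebra_simps)
  then have y1: "y + 1 \<in> num_semigroup a b c" by (simp only: num_semigroupI)
  have y0: "0 \<le> y" unfolding y_def by simp
  \<comment> \<open>With quotient \<open>q\<close> and remainder \<open>r\<close> of
    \<open>n\<close> by \<open>y\<close>, one has \<open>n = (q - r) y + r (y + 1)\<close>. The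
    bound \<open>y * y\<close> ensures that \<open>q\<close> is at least \<open>y\<close>, hence
    larger than \<open>r\<close>.\<close>
  have "n \<in> num_semigroup a b c" if "n \<ge> y * y" for n
  proof (cases "y = 0")
    case True
    then have "n = int (nat n) * (y + 1)" using that by simp
    then show ?thesis using num_semigroup_mult[OF y1] by metis
  next
    case False
    then have yp: "y > 0" using y0 by simp
    have q: "y \<le> n div y" using that yp zdiv_mono1[OF that yp] by simp
    have r: "0 \<le> n mod y" "n mod y < y" using yp by auto
    have "n = (n div y) * y + n mod y" by simp
    also have "\<dots> = int (nat (n div y - n mod y)) * y + int (nat (n mod y)) * (y + 1)"
      using q r by (simp add: algebra_simps)
    finally have "n = int (nat (n div y - n mod y)) * y + int (nat (n mod y)) * (y + 1)" .
    then show ?thesis using num_semigroup_add num_semigroup_mult y y1 by metis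
  qed
  then show ?thesis using that by blast
qed

definition set_colon :: "int set \<Rightarrow> int set \<Rightarrow> int set" where
  "set_colon A E = {n. \<forall>e\<in>E. n + e \<in> A}"

section \<open>Apery set, pseudo-Frobenius numbers and the bidual on the level of exponents\<close>

context herzog_semigroup
begin

abbreviation "S \<equiv> num_semigroup a b c"

text \<open>The monomials in \<open>Y\<close> and \<open>Z\<close> divisible by none of the terms of
  the minors that are free of \<open>X\<close>. Their degrees form the Apery set of \<open>S\<close>
  with respect to \<open>a\<close>, that is, the smallest element of \<open>S\<close> in each
  residue class modulo \<open>a\<close>.\<close>

definition apery :: "(nat \<times> nat) set" where
  "apery = {(j, l). j < b1 + b2 \<and> l < c1 + c2 \<and> \<not> (b2 \<le> j \<and> c1 \<le> l)}"

text \<open>Each rewriting of a monomial by one of the minors raises the exponent of \<open>X\<close>, hence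
  terminates.\<close>

lemma apery_reduce:
  "\<exists>k j' l'. (j', l') \<in> apery \<and> a * i + b * j + c * l = a * k + b * j' + c * l'"
proof (induction "b * j + c * l" arbitrary: i j l rule: less_induct)
  case less
  consider "(j, l) \<in> apery" | "b1 + b2 \<le> j" | "c1 + c2 \<le> l" | "b2 \<le> j" "c1 \<le> l"
    unfolding apery_def by fastforce
  then show ?case
  proof cases
    case 1
    then show ?thesis by blast
  next
    case 2
    then obtain x where x: "j = b1 + b2 + x" using le_Suc_ex by blast
    have "b * x + c * (l + c2) < b * j + c * l"
      using eqY pos unfolding x by (simp add: algebra_simps)
    moreover have "a * i + b * j + c * l = a * (i + a1) + b * x + c * (l + c2)"
      using eqY unfolding x by (simp add: algebra_simps)
    ultimately show ?thesis using less by presburger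
  next
    case 3
    then obtain x where x: "l = c1 + c2 + x" using le_Suc_ex by blast
    have "b * (j + b1) + c * x < b * j + c * l"
      using eqZ pos unfolding x by (simp add: algebra_simps)
    moreover have "a * i + b * j + c * l = a * (i + a2) + b * (j + b1) + c * x"
      using eqZ unfolding x by (simp add: algebra_simps)
    ultimately show ?thesis using less by presburger
  next
    case 4
    then obtain x y where x: "j = b2 + x" "l = c1 + y" using le_Suc_ex by metis
    have "b * x + c * y < b * j + c * l"
      using pos unfolding x by (simp add: algebra_simps)
    moreover have "a * i + b * j + c * l = a * (i + a1 + a2) + b * x + c * y"
      using eqX unfolding x by (simp add: algebra_simps)
    ultimately show ?thesis using less by presburger
  qed
qed

text \<open>Adding a large multiple of \<open>a\<close> moves \<open>n\<close> into
  \<open>S\<close>, where the rewriting applies; afterwards the multiple is subtracted again, so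
  that \<open>k\<close> may be negative.\<close>

lemma apery_representation:
  obtains k :: int and j l where "(j, l) \<in> apery" "n = int a * k + int (b * j + c * l)"
proof -
  obtain N where N: "\<And>n. n \<ge> N \<Longrightarrow> n \<in> S" using num_semigroup_cofinite[OF gcd1] by blast
  define M where "M = \<bar>N\<bar> + \<bar>n\<bar>"
  have "int a * M \<ge> 1 * M" using pos by (intro mult_right_mono) (auto simp: M_def)
  then have "n + int a * M \<in> S" by (intro N) (auto simp: M_def)
  then obtain i j l where "n + int a * M = int (a * i + b * j + c * l)" unfolding num_semigroup_iff by blast
  moreover obtain k j' l' where "(j', l') \<in> apery" "a * i + b * j + c * l = a * k + b * j' + c * l'"
    using apery_reduce by blast
  ultimately have "n = int a * (int k - M) + int (b * j' + c * l')" "(j', l') \<in> apery"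
    by (simp_all only: of_nat_add of_nat_mult) (simp add: algebra_simps)
  then show ?thesis using that by blast
qed

text \<open>If a negative \<open>k\<close> were possible, moving the multiple of \<open>a\<close> to
  the other side would give \<open>Y^j Z^l\<close> the same degree as a monomial divisible by
  \<open>X\<close>, against \<open>standard_unique\<close>.\<close>

lemma semigroup_iff_apery:
  assumes "(j, l) \<in> apery"
  shows "int a * k + int (b * j + c * l) \<in> S \<longleftrightarrow> k \<ge> 0"
proof
  assume "k \<ge> 0"
  then have "int a * k + int (b * j + c * l) = int (a * nat k + b * j + c * l)" by simp
  then show "int a * k + int (b * j + c * l) \<in> S" by (simp only: num_semigroupI)
next
  assume *: "int a * k + int (b * j + c * l) \<in> S"
  show "k \<ge> 0"
  proof (rule ccontr)
    assume "\<not> k \<ge> 0"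
    then obtain m where m: "k = - int m" "m > 0" by (metis not_le neg_int_cases)
    obtain i' j' l' where "int a * k + int (b * j + c * l) = int (a * i' + b * j' + c * l')"
      using * unfolding num_semigroup_iff by blast
    then have "int (a * 0 + b * j + c * l) = int (a * (i' + m) + b * j' + c * l')"
      using m by (simp add: algebra_simps)
    then have "a * 0 + b * j + c * l = a * (i' + m) + b * j' + c * l'" by (simp only: of_nat_eq_iff)
    from standard_unique[OF _ _ _ _ _ _ this] show False
      using assms m pos by (auto simp: apery_def)
  qed
qed

definition delta :: int where "delta = int (a * a1) - int (b * b2)"

lemma delta_eq: "delta = int (b * b1) - int (c * c2)" "delta = int (c * c1) - int (a * a2)"
proof -
  have "int (b * (b1 + b2)) = int (a * a1 + c * c2)" "int (a * (a1 + a2)) = int (b * b2 + c * c1)"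
    using eqX eqY by simp_all
  then show "delta = int (b * b1) - int (c * c2)" "delta = int (c * c1) - int (a * a2)"
    by (simp_all add: delta_def algebra_simps)
qed

definition pf :: int where "pf = int b * (int b1 + int b2 - 1) + int c * (int c1 - 1) - int a"

text \<open>The pseudo-Frobenius numbers are \<open>pf\<close> and \<open>pf - delta\<close>, coming from the two corners of the
  L-shaped set \<open>apery\<close>.\<close>

lemma pf_delta: "pf - delta = int b * (int b2 - 1) + int c * (int c1 + int c2 - 1) - int a"
  by (simp add: pf_def delta_eq(1) algebra_simps)

text \<open>A gap has a negative multiple of \<open>a\<close> in its representation. The L-shape is
  the union of two rectangles, and complementing \<open>(j, l)\<close> inside the rectangle that
  contains it writes the reflected number with nonnegative coefficients. Conversely,
  \<open>n\<close> in \<open>S\<close> would put one of the two pseudo-Frobenius numbers into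
  \<open>S\<close>.\<close>

lemma not_in_semigroup_iff: "n \<notin> S \<longleftrightarrow> pf - n \<in> S \<or> pf - delta - n \<in> S"
proof
  assume "n \<notin> S"
  obtain k j l where kjl: "(j, l) \<in> apery" "n = int a * k + int (b * j + c * l)"
    by (rule apery_representation)
  then have k: "k \<le> -1" using semigroup_iff_apery[OF kjl(1), of k] \<open>n \<notin> S\<close> by auto
  then obtain m where m: "k = - 1 - int m" by (metis zle_iff_zadd diff_diff_eq2 diff_eq_eq add.commute)
  consider "j < b1 + b2" "l < c1" | "j < b2" "l < c1 + c2"
    using kjl(1) unfolding apery_def by fastforce
  then show "pf - n \<in> S \<or> pf - delta - n \<in> S"
  proof cases
    case 1
    then obtain x y where xy: "b1 + b2 = j + x + 1" "c1 = l + y + 1"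
      by (metis less_iff_Suc_add Suc_eq_plus1)
    then have "int b1 + int b2 - 1 = int (j + x)" by linarith
    then have "pf - n = int (a * m + b * x + c * y)"
      unfolding pf_def by (simp add: kjl(2) m xy(2) algebra_simps)
    then show ?thesis by (simp only: num_semigroupI simp_thms)
  next
    case 2
    then obtain x y where xy: "b2 = j + x + 1" "c1 + c2 = l + y + 1"
      by (metis less_iff_Suc_add Suc_eq_plus1)
    then have "int c1 + int c2 - 1 = int (l + y)" by linarith
    then have "pf - delta - n = int (a * m + b * x + c * y)"
      unfolding pf_delta by (simp add: kjl(2) m xy(1) algebra_simps)
    then show ?thesis by (simp only: num_semigroupI simp_thms)
  qed
next
  assume *: "pf - n \<in> S \<or> pf - delta - n \<in> S"
  have corner: "(b1 + b2 - 1, c1 - 1) \<in> apery" "(b2 - 1, c1 + c2 - 1) \<in> apery"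
    using pos by (auto simp: apery_def)
  have "int (b1 + b2 - 1) = int b1 + int b2 - 1" "int (b2 - 1) = int b2 - 1"
    "int (c1 - 1) = int c1 - 1" "int (c1 + c2 - 1) = int c1 + int c2 - 1"
    using pos by linarith+
  then have "pf \<notin> S" "pf - delta \<notin> S"
    using semigroup_iff_apery[OF corner(1), of "-1"] semigroup_iff_apery[OF corner(2), of "-1"]
    unfolding pf_delta by (simp_all only: pf_def of_nat_add of_nat_mult) (simp_all add: algebra_simps)
  then show "n \<notin> S" using * num_semigroup_add[of n a b c "pf - n"] num_semigroup_add[of n a b c "pf - delta - n"]
    by auto
qed

text \<open>The exponents of the trace ideal \<open>K \<cdot> (R : K)\<close> of the canonical module.\<close>

definition trace_set :: "int set" where
  "trace_set = {q \<in> S. q + delta \<in> S \<or> q - delta \<in> S}"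

definition canonical_set :: "int \<Rightarrow> int set" where
  "canonical_set g = {n. g - n \<notin> S}"

text \<open>By \<open>not_in_semigroup_iff\<close> the canonical set is the union of the two
  translates of \<open>S\<close> by \<open>g - pf\<close> and \<open>g - pf + delta\<close>. Its
  dual is therefore, up to a shift, the set of all \<open>p\<close> with \<open>p\<close> and
  \<open>p + delta\<close> in \<open>S\<close>. Applying \<open>not_in_semigroup_iff\<close> once
  more turns the second dual into a condition on \<open>q = g - n\<close>.\<close>

lemma bidual_canonical_set: "set_colon S (set_colon S (canonical_set g)) = {n. g - n \<notin> trace_set}"
proof -
  have can: "n \<in> canonical_set g \<longleftrightarrow> pf - g + n \<in> S \<or> pf - delta - g + n \<in> S" for n
    unfolding canonical_set_def using not_in_semigroup_iff[of "g - n"] by (simp add: algebra_simps)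
  have dual: "set_colon S (canonical_set g) = {j. j + g - pf \<in> S \<and> j + g - pf + delta \<in> S}"
  proof (intro subset_antisym subsetI)
    fix j assume j: "j \<in> set_colon S (canonical_set g)"
    have "g - pf \<in> canonical_set g" "g - pf + delta \<in> canonical_set g"
      unfolding can by (simp_all add: num_semigroup_0)
    then show "j \<in> {j. j + g - pf \<in> S \<and> j + g - pf + delta \<in> S}"
      using j by (auto simp: set_colon_def algebra_simps)
  next
    fix j assume j: "j \<in> {j. j + g - pf \<in> S \<and> j + g - pf + delta \<in> S}"
    have "j + n \<in> S" if "n \<in> canonical_set g" for n
      using that j num_semigroup_add[of "j + g - pf" a b c "pf - g + n"]
        num_semigroup_add[of "j + g - pf + delta" a b c "pf - delta - g + n"] by (auto simp: can)
    then show "j \<in> set_colon S (canonical_set g)" by (simp add: set_colon_def)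
  qed
  have "n \<in> set_colon S (set_colon S (canonical_set g)) \<longleftrightarrow> g - n \<notin> trace_set" for n
  proof -
    define q where "q = g - n"
    have "n \<in> set_colon S (set_colon S (canonical_set g)) \<longleftrightarrow>
      (\<forall>p. p \<in> S \<and> p + delta \<in> S \<longrightarrow> n + (p - g + pf) \<in> S)"
    proof
      assume *: "n \<in> set_colon S (set_colon S (canonical_set g))"
      have "p - g + pf \<in> set_colon S (canonical_set g)" if "p \<in> S" "p + delta \<in> S" for p
        unfolding dual using that by simp
      then show "\<forall>p. p \<in> S \<and> p + delta \<in> S \<longrightarrow> n + (p - g + pf) \<in> S"
        using * unfolding set_colon_def[of S "set_colon S _"] by blast
    next
      assume *: "\<forall>p. p \<in> S \<and> p + delta \<in> S \<longrightarrow> n + (p - g + pf) \<in> S"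
      have "n + j \<in> S" if "j + g - pf \<in> S" "j + g - pf + delta \<in> S" for j
        using *[rule_format, of "j + g - pf"] that by simp
      then show "n \<in> set_colon S (set_colon S (canonical_set g))"
        unfolding dual by (simp add: set_colon_def)
    qed
    also have "\<dots> \<longleftrightarrow> (\<forall>p. p \<in> S \<and> p + delta \<in> S \<longrightarrow> q - p \<notin> S \<and> q - p - delta \<notin> S)"
    proof -
      have "n + (p - g + pf) \<in> S \<longleftrightarrow> q - p \<notin> S \<and> q - p - delta \<notin> S" for p
        using not_in_semigroup_iff[of "n + (p - g + pf)"] by (auto simp: q_def algebra_simps)
      then show ?thesis by simp
    qed
    also have "\<dots> \<longleftrightarrow> q \<notin> trace_set"
    proof
      assume *: "\<forall>p. p \<in> S \<and> p + delta \<in> S \<longrightarrow> q - p \<notin> S \<and> q - p - delta \<notin> S"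
      \<comment> \<open>If \<open>q + delta\<close> is in \<open>S\<close>, the choice
        \<open>p = q\<close> makes \<open>q - p\<close> zero; if \<open>q - delta\<close> is in
        \<open>S\<close>, the choice \<open>p = q - delta\<close> makes \<open>q - p - delta\<close>
        zero.\<close>
      then show "q \<notin> trace_set"
        using *[rule_format, of q] *[rule_format, of "q - delta"]
        by (auto simp: trace_set_def num_semigroup_0)
    next
      assume *: "q \<notin> trace_set"
      show "\<forall>p. p \<in> S \<and> p + delta \<in> S \<longrightarrow> q - p \<notin> S \<and> q - p - delta \<notin> S"
      proof (intro allI impI conjI notI)
        fix p assume p: "p \<in> S \<and> p + delta \<in> S" and "q - p \<in> S"
        then have "q - p + p \<in> S" "q - p + (p + delta) \<in> S" by (blast intro: num_semigroup_add)+
        then show False using * by (simp add: trace_set_def)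
      next
        fix p assume p: "p \<in> S \<and> p + delta \<in> S" and "q - p - delta \<in> S"
        then have "q - p - delta + p \<in> S" "q - p - delta + (p + delta) \<in> S" by (blast intro: num_semigroup_add)+
        then show False using * by (simp add: trace_set_def algebra_simps)
      qed
    qed
    finally show ?thesis unfolding q_def .
  qed
  then show ?thesis by blast
qed

end

section \<open>Counting the exponents outside the trace\<close>

locale ordered_herzog_semigroup = herzog_semigroup +
  assumes le: "a1 \<le> a2" "b2 \<le> b1" "c1 \<le> c2"
begin

text \<open>A monomial divisible by \<open>X^a1\<close>, \<open>Y^b2\<close> or \<open>Z^c1\<close>
  can exchange this factor for the other entry of its row, which moves its degree by
  \<open>delta\<close> up or down within \<open>S\<close>. For a monomial in the box, multiplying by
  \<open>X^a1\<close> or by \<open>Y^b2\<close> still gives a monomial divisible by no term of the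
  minors; this is where the inequalities between the exponents enter. Being alone in its degree, it
  leaves no room for a representation of \<open>n + delta\<close> or
  \<open>n - delta\<close>.\<close>

lemma semigroup_minus_trace:
  "S - trace_set = (\<lambda>(i, j, l). int (a * i + b * j + c * l)) ` ({..<a1} \<times> {..<b2} \<times> {..<c1})"
proof (intro subset_antisym subsetI)
  fix n assume n: "n \<in> S - trace_set"
  then have "n \<in> S" by blast
  then obtain i j l where ijl: "n = int (a * i + b * j + c * l)" unfolding num_semigroup_iff by blast
  have "i < a1"
  proof (rule ccontr)
    assume "\<not> i < a1"
    then obtain x where "i = a1 + x" by (metis le_Suc_ex not_less)
    then have "n - delta = int (a * x + b * (j + b2) + c * l)"
      by (simp add: ijl delta_def algebra_simps)
    then have "n - delta \<in> S" by (simp only: num_semigroupI)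
    then show False using n by (simp add: trace_set_def)
  qed
  moreover have "j < b2"
  proof (rule ccontr)
    assume "\<not> j < b2"
    then obtain x where "j = b2 + x" by (metis le_Suc_ex not_less)
    then have "n + delta = int (a * (i + a1) + b * x + c * l)"
      by (simp add: ijl delta_def algebra_simps)
    then have "n + delta \<in> S" by (simp only: num_semigroupI)
    then show False using n by (simp add: trace_set_def)
  qed
  moreover have "l < c1"
  proof (rule ccontr)
    assume "\<not> l < c1"
    then obtain x where "l = c1 + x" by (metis le_Suc_ex not_less)
    then have "n - delta = int (a * (i + a2) + b * j + c * x)"
      by (simp add: ijl delta_eq(2) algebra_simps)
    then have "n - delta \<in> S" by (simp only: num_semigroupI)
    then show False using n by (simp add: trace_set_def)
  qed
  ultimately show "n \<in> (\<lambda>(i, j, l). int (a * i + b * j + c * l)) ` ({..<a1} \<times> {..<b2} \<times> {..<c1})"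
    using ijl by force
next
  fix n assume "n \<in> (\<lambda>(i, j, l). int (a * i + b * j + c * l)) ` ({..<a1} \<times> {..<b2} \<times> {..<c1})"
  then obtain i j l where n: "n = int (a * i + b * j + c * l)" and b: "i < a1" "j < b2" "l < c1" by auto
  have "n + delta \<notin> S"
  proof
    assume "n + delta \<in> S"
    then obtain i' j' l' where "n + delta = int (a * i' + b * j' + c * l')" unfolding num_semigroup_iff by blast
    then have "int (a * (i + a1) + b * j + c * l) = int (a * i' + b * (j' + b2) + c * l')"
      by (simp add: n delta_def algebra_simps)
    then have "a * (i + a1) + b * j + c * l = a * i' + b * (j' + b2) + c * l'" by (simp only: of_nat_eq_iff)
    from standard_unique[OF _ _ _ _ _ _ this] show False using b le by auto
  qed
  moreover have "n - delta \<notin> S"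
  proof
    assume "n - delta \<in> S"
    then obtain i' j' l' where "n - delta = int (a * i' + b * j' + c * l')" unfolding num_semigroup_iff by blast
    then have "int (a * i + b * (j + b2) + c * l) = int (a * (i' + a1) + b * j' + c * l')"
      by (simp add: n delta_def algebra_simps)
    then have "a * i + b * (j + b2) + c * l = a * (i' + a1) + b * j' + c * l'" by (simp only: of_nat_eq_iff)
    from standard_unique[OF _ _ _ _ _ _ this] show False using b le by auto
  qed
  moreover have "n \<in> S" unfolding n by (rule num_semigroupI)
  ultimately show "n \<in> S - trace_set" by (simp add: trace_set_def)
qed

lemma finite_semigroup_minus_trace: "finite (S - trace_set)"
  unfolding semigroup_minus_trace by simp

lemma card_semigroup_minus_trace: "card (S - trace_set) = a1 * b2 * c1"
proof -
  have "inj_on (\<lambda>(i, j, l). int (a * i + b * j + c * l)) ({..<a1} \<times> {..<b2} \<times> {..<c1})"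
  proof (rule inj_onI, clarsimp)
    fix i j l i' j' l'
    assume *: "i < a1" "j < b2" "l < c1" "i' < a1" "j' < b2" "l' < c1"
      and "int a * int i + int b * int j + int c * int l = int a * int i' + int b * int j' + int c * int l'"
    then have "int (a * i + b * j + c * l) = int (a * i' + b * j' + c * l')" by simp
    then have "a * i + b * j + c * l = a * i' + b * j' + c * l'" by (simp only: of_nat_eq_iff)
    from standard_unique[OF _ _ _ _ _ _ this] show "i = i' \<and> j = j' \<and> l = l'" using * le by auto
  qed
  then show ?thesis
    unfolding semigroup_minus_trace by (subst card_image) (simp_all add: card_cartesian_product)
qed

lemma bidual_minus_canonical_set:
  "set_colon S (set_colon S (canonical_set g)) - canonical_set g = (\<lambda>q. g - q) ` (S - trace_set)"
proof -
  have "n \<in> set_colon S (set_colon S (canonical_set g)) - canonical_set g \<longleftrightarrow> g - n \<in> S - trace_set" for n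
    unfolding bidual_canonical_set by (auto simp: canonical_set_def)
  moreover have "n \<in> (\<lambda>q. g - q) ` (S - trace_set) \<longleftrightarrow> g - n \<in> S - trace_set" for n
    by (auto simp: image_iff intro!: bexI[of _ "g - n"])
  ultimately show ?thesis by blast
qed

lemma card_bidual_minus_canonical_set:
  "finite (set_colon S (set_colon S (canonical_set g)) - canonical_set g)"
  "card (set_colon S (set_colon S (canonical_set g)) - canonical_set g) = a1 * b2 * c1"
  unfolding bidual_minus_canonical_set
  by (simp_all add: finite_semigroup_minus_trace card_image inj_on_def card_semigroup_minus_trace)

end

section \<open>Modules and lengths\<close>

lemma ideal_module_simps [simp]:
  "carrier (ideal_module A I) = I" "zero (ideal_module A I) = zero A"
  "add (ideal_module A I) = add A" "module.smult (ideal_module A I) = monoid.mult A"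
  by (simp_all add: ideal_module_def)

lemma hom_module_simps [simp]:
  "carrier (hom_module A M N) = mod_hom A M N"
  "zero (hom_module A M N) = (\<lambda>x\<in>carrier M. \<zero>\<^bsub>N\<^esub>)"
  "add (hom_module A M N) = (\<lambda>f g. \<lambda>x\<in>carrier M. f x \<oplus>\<^bsub>N\<^esub> g x)"
  "module.smult (hom_module A M N) = (\<lambda>r f. \<lambda>x\<in>carrier M. r \<odot>\<^bsub>N\<^esub> f x)"
  by (simp_all add: hom_module_def)

lemma free_module_simps [simp]:
  "carrier (free_module A n) = {..<n} \<rightarrow>\<^sub>E carrier A"
  "zero (free_module A n) = (\<lambda>i\<in>{..<n}. \<zero>\<^bsub>A\<^esub>)"
  "add (free_module A n) = (\<lambda>x y. \<lambda>i\<in>{..<n}. x i \<oplus>\<^bsub>A\<^esub> y i)"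
  "module.smult (free_module A n) = (\<lambda>r x. \<lambda>i\<in>{..<n}. r \<otimes>\<^bsub>A\<^esub> x i)"
  by (simp_all add: free_module_def)

lemma (in Module.module) submodule_iff:
  "submodule U R M \<longleftrightarrow> U \<subseteq> carrier M \<and> \<zero>\<^bsub>M\<^esub> \<in> U \<and> (\<forall>x\<in>U. \<forall>y\<in>U. x \<oplus>\<^bsub>M\<^esub> y \<in> U) \<and>
     (\<forall>r\<in>carrier R. \<forall>x\<in>U. r \<odot>\<^bsub>M\<^esub> x \<in> U)"
proof
  assume U: "submodule U R M"
  then have "\<zero>\<^bsub>M\<^esub> \<in> U"
    using subgroup.one_closed[OF submodule.axioms(1)[OF U]] by simp
  then show "U \<subseteq> carrier M \<and> \<zero>\<^bsub>M\<^esub> \<in> U \<and> (\<forall>x\<in>U. \<forall>y\<in>U. x \<oplus>\<^bsub>M\<^esub> y \<in> U) \<and>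
     (\<forall>r\<in>carrier R. \<forall>x\<in>U. r \<odot>\<^bsub>M\<^esub> x \<in> U)"
    using submoduleE[OF U] by blast
next
  assume *: "U \<subseteq> carrier M \<and> \<zero>\<^bsub>M\<^esub> \<in> U \<and> (\<forall>x\<in>U. \<forall>y\<in>U. x \<oplus>\<^bsub>M\<^esub> y \<in> U) \<and>
     (\<forall>r\<in>carrier R. \<forall>x\<in>U. r \<odot>\<^bsub>M\<^esub> x \<in> U)"
  show "submodule U R M"
  proof (rule submoduleI)
    fix x assume x: "x \<in> U"
    then have "\<ominus>\<^bsub>M\<^esub> x = (\<ominus> \<one>) \<odot>\<^bsub>M\<^esub> x" using * by (subst smult_l_minus) auto
    then show "\<ominus>\<^bsub>M\<^esub> x \<in> U" using * x by simp
  qed (use * in blast)+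
qed

lemma mod_homD:
  assumes "f \<in> mod_hom A M N"
  shows "x \<in> carrier M \<Longrightarrow> f x \<in> carrier N"
    and "x \<in> carrier M \<Longrightarrow> y \<in> carrier M \<Longrightarrow> f (x \<oplus>\<^bsub>M\<^esub> y) = f x \<oplus>\<^bsub>N\<^esub> f y"
    and "r \<in> carrier A \<Longrightarrow> x \<in> carrier M \<Longrightarrow> f (r \<odot>\<^bsub>M\<^esub> x) = r \<odot>\<^bsub>N\<^esub> f x"
    and "f \<in> extensional (carrier M)"
  using assms by (auto simp: mod_hom_def PiE_iff)

lemma mod_homI:
  assumes "f \<in> extensional (carrier M)" "\<And>x. x \<in> carrier M \<Longrightarrow> f x \<in> carrier N"
    and "\<And>x y. x \<in> carrier M \<Longrightarrow> y \<in> carrier M \<Longrightarrow> f (x \<oplus>\<^bsub>M\<^esub> y) = f x \<oplus>\<^bsub>N\<^esub> f y"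
    and "\<And>r x. r \<in> carrier A \<Longrightarrow> x \<in> carrier M \<Longrightarrow> f (r \<odot>\<^bsub>M\<^esub> x) = r \<odot>\<^bsub>N\<^esub> f x"
  shows "f \<in> mod_hom A M N"
  using assms by (auto simp: mod_hom_def PiE_iff)

lemma mod_hom_zero:
  assumes "Module.module A M" "Module.module A N" "f \<in> mod_hom A M N"
  shows "f \<zero>\<^bsub>M\<^esub> = \<zero>\<^bsub>N\<^esub>"
proof -
  interpret M: Module.module A M by fact
  interpret N: Module.module A N by fact
  have "f (\<zero>\<^bsub>A\<^esub> \<odot>\<^bsub>M\<^esub> \<zero>\<^bsub>M\<^esub>) = \<zero>\<^bsub>A\<^esub> \<odot>\<^bsub>N\<^esub> f \<zero>\<^bsub>M\<^esub>"
    by (rule mod_homD(3)[OF assms(3)]) simp_all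
  then show ?thesis using mod_homD(1)[OF assms(3)] by simp
qed

lemma module_hom_module:
  assumes "Module.module A M" "Module.module A N"
  shows "Module.module A (hom_module A M N)"
proof -
  interpret M: Module.module A M by fact
  interpret N: Module.module A N by fact
  note D = mod_homD[of _ A M N]
  show ?thesis
  proof (rule Module.moduleI)
    show "cring A" ..
    show "abelian_group (hom_module A M N)"
    proof (rule abelian_groupI)
      fix f g assume fg: "f \<in> carrier (hom_module A M N)" "g \<in> carrier (hom_module A M N)"
      show "f \<oplus>\<^bsub>hom_module A M N\<^esub> g \<in> carrier (hom_module A M N)"
        using fg by (auto intro!: mod_homI simp: D N.smult_r_distr M.smult_closed N.a_ac)
      show "f \<oplus>\<^bsub>hom_module A M N\<^esub> g = g \<oplus>\<^bsub>hom_module A M N\<^esub> f"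
        using fg by (auto intro!: restrict_ext simp: D N.a_comm)
    next
      show "\<zero>\<^bsub>hom_module A M N\<^esub> \<in> carrier (hom_module A M N)"
        by (auto intro!: mod_homI)
    next
      fix f g h assume fgh: "f \<in> carrier (hom_module A M N)" "g \<in> carrier (hom_module A M N)"
        "h \<in> carrier (hom_module A M N)"
      then show "(f \<oplus>\<^bsub>hom_module A M N\<^esub> g) \<oplus>\<^bsub>hom_module A M N\<^esub> h =
        f \<oplus>\<^bsub>hom_module A M N\<^esub> (g \<oplus>\<^bsub>hom_module A M N\<^esub> h)"
        by (auto intro!: restrict_ext simp: D N.a_assoc)
    next
      fix f assume f: "f \<in> carrier (hom_module A M N)"
      show "\<zero>\<^bsub>hom_module A M N\<^esub> \<oplus>\<^bsub>hom_module A M N\<^esub> f = f"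
        using f by (auto intro!: extensionalityI[of _ "carrier M"] simp: D)
      show "\<exists>g\<in>carrier (hom_module A M N). g \<oplus>\<^bsub>hom_module A M N\<^esub> f = \<zero>\<^bsub>hom_module A M N\<^esub>"
      proof
        show "(\<lambda>x\<in>carrier M. \<ominus>\<^bsub>N\<^esub> f x) \<in> carrier (hom_module A M N)"
          using f by (auto intro!: mod_homI simp: D N.minus_add N.smult_r_minus)
        show "(\<lambda>x\<in>carrier M. \<ominus>\<^bsub>N\<^esub> f x) \<oplus>\<^bsub>hom_module A M N\<^esub> f = \<zero>\<^bsub>hom_module A M N\<^esub>"
          using f by (auto intro!: restrict_ext simp: D N.l_neg)
      qed
    qed
  next
    fix r f assume rf: "r \<in> carrier A" "f \<in> carrier (hom_module A M N)"
    show "r \<odot>\<^bsub>hom_module A M N\<^esub> f \<in> carrier (hom_module A M N)"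
    proof -
      have "r \<odot>\<^bsub>N\<^esub> (s \<odot>\<^bsub>N\<^esub> y) = s \<odot>\<^bsub>N\<^esub> (r \<odot>\<^bsub>N\<^esub> y)" if "s \<in> carrier A" "y \<in> carrier N" for s y
        using rf that by (simp flip: N.smult_assoc1 add: M.m_comm)
      then show ?thesis using rf by (auto intro!: mod_homI simp: D N.smult_r_distr)
    qed
  next
    fix r f g assume "r \<in> carrier A" "f \<in> carrier (hom_module A M N)" "g \<in> carrier (hom_module A M N)"
    then show "r \<odot>\<^bsub>hom_module A M N\<^esub> (f \<oplus>\<^bsub>hom_module A M N\<^esub> g) =
        r \<odot>\<^bsub>hom_module A M N\<^esub> f \<oplus>\<^bsub>hom_module A M N\<^esub> r \<odot>\<^bsub>hom_module A M N\<^esub> g"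
      by (auto intro!: restrict_ext simp: D N.smult_r_distr)
  next
    fix r s f assume rsf: "r \<in> carrier A" "s \<in> carrier A" "f \<in> carrier (hom_module A M N)"
    then show "(r \<oplus>\<^bsub>A\<^esub> s) \<odot>\<^bsub>hom_module A M N\<^esub> f =
        r \<odot>\<^bsub>hom_module A M N\<^esub> f \<oplus>\<^bsub>hom_module A M N\<^esub> s \<odot>\<^bsub>hom_module A M N\<^esub> f"
      by (auto intro!: restrict_ext simp: D N.smult_l_distr)
    show "(r \<otimes>\<^bsub>A\<^esub> s) \<odot>\<^bsub>hom_module A M N\<^esub> f = r \<odot>\<^bsub>hom_module A M N\<^esub> (s \<odot>\<^bsub>hom_module A M N\<^esub> f)"
      using rsf by (auto intro!: restrict_ext simp: D N.smult_assoc1)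
  next
    fix f assume "f \<in> carrier (hom_module A M N)"
    then show "\<one>\<^bsub>A\<^esub> \<odot>\<^bsub>hom_module A M N\<^esub> f = f"
      by (auto intro!: extensionalityI[of _ "carrier M"] simp: D)
  qed
qed

lemma module_free_module:
  assumes "cring A"
  shows "Module.module A (free_module A n)"
proof -
  interpret cring A by fact
  show ?thesis
  proof (rule Module.moduleI)
    show "cring A" by fact
    show "abelian_group (free_module A n)"
    proof (rule abelian_groupI)
      fix x assume x: "x \<in> carrier (free_module A n)"
      then show "\<zero>\<^bsub>free_module A n\<^esub> \<oplus>\<^bsub>free_module A n\<^esub> x = x"
        by (auto intro!: extensionalityI[of _ "{..<n}"] simp: PiE_iff)
      show "\<exists>y\<in>carrier (free_module A n). y \<oplus>\<^bsub>free_module A n\<^esub> x = \<zero>\<^bsub>free_module A n\<^esub>"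
        using x by (intro bexI[of _ "\<lambda>i\<in>{..<n}. \<ominus>\<^bsub>A\<^esub> x i"]) (auto intro!: restrict_ext simp: PiE_iff l_neg)
    qed (auto intro!: restrict_ext simp: PiE_iff a_ac)
  qed (auto intro!: restrict_ext extensionalityI[of _ "{..<n}"] simp: PiE_iff l_distr r_distr m_assoc)
qed

lemma module_ideal_module:
  fixes A :: "'a::comm_ring_1 set"
  assumes "cring (ring_on A)" "0 \<in> D" "\<And>x y. x \<in> D \<Longrightarrow> y \<in> D \<Longrightarrow> x + y \<in> D"
    "\<And>r x. r \<in> A \<Longrightarrow> x \<in> D \<Longrightarrow> r * x \<in> D"
  shows "Module.module (ring_on A) (ideal_module (ring_on A) D)"
proof -
  interpret cring "ring_on A" by fact
  have m1: "- 1 \<in> A" by (rule uminus_one_in_cring[OF assms(1)])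
  have neg: "- x \<in> D" if "x \<in> D" for x
    using assms(4)[OF m1 that] by simp
  show ?thesis
  proof (rule Module.moduleI)
    show "cring (ring_on A)" by fact
    show "abelian_group (ideal_module (ring_on A) D)"
    proof (rule abelian_groupI)
      fix x assume "x \<in> carrier (ideal_module (ring_on A) D)"
      then show "\<exists>y\<in>carrier (ideal_module (ring_on A) D).
        y \<oplus>\<^bsub>ideal_module (ring_on A) D\<^esub> x = \<zero>\<^bsub>ideal_module (ring_on A) D\<^esub>"
        using neg by (intro bexI[of _ "- x"]) auto
    qed (use assms in \<open>auto simp: algebra_simps\<close>)
  qed (use assms in \<open>auto simp: algebra_simps\<close>)
qed

lemma quotient_length_ge:
  assumes "U 0 = L" "U n = N" "\<And>i. i \<le> n \<Longrightarrow> submodule (U i) A M" "\<And>i. i < n \<Longrightarrow> U i \<subset> U (Suc i)"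
  shows "enat n \<le> quotient_length A M L N"
  unfolding quotient_length_def
  by (rule Sup_upper, rule CollectI, intro exI[of _ n] conjI exI[of _ U]) (use assms in auto)

text \<open>Only one inequality is shown, by transporting chains; the equality
  \<open>quotient_length_iso\<close> applies it to the isomorphism and to its inverse.\<close>

lemma quotient_length_iso_le:
  assumes M: "Module.module A M" and M': "Module.module A M'" and bij: "bij_betw \<theta> (carrier M) (carrier M')"
    and add: "\<And>x y. x \<in> carrier M \<Longrightarrow> y \<in> carrier M \<Longrightarrow> \<theta> (x \<oplus>\<^bsub>M\<^esub> y) = \<theta> x \<oplus>\<^bsub>M'\<^esub> \<theta> y"
    and smult: "\<And>r x. r \<in> carrier A \<Longrightarrow> x \<in> carrier M \<Longrightarrow> \<theta> (r \<odot>\<^bsub>M\<^esub> x) = r \<odot>\<^bsub>M'\<^esub> \<theta> x"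
  shows "quotient_length A M L N \<le> quotient_length A M' (\<theta> ` L) (\<theta> ` N)"
  unfolding quotient_length_def
proof (rule Sup_subset_mono, safe)
  interpret M: Module.module A M by fact
  interpret M': Module.module A M' by fact
  have cl: "\<theta> x \<in> carrier M'" if "x \<in> carrier M" for x using bij that by (auto simp: bij_betw_def)
  have zero: "\<theta> \<zero>\<^bsub>M\<^esub> = \<zero>\<^bsub>M'\<^esub>"
    using smult[of "\<zero>\<^bsub>A\<^esub>" "\<zero>\<^bsub>M\<^esub>"] cl by simp
  fix U :: "nat \<Rightarrow> _" and n
  assume U: "\<forall>i\<le>n. submodule (U i) A M" "\<forall>i<n. U i \<subset> U (Suc i)"
  have sub: "U i \<subseteq> carrier M" if "i \<le> n" for i using U(1) that by (simp add: M.submodule_iff)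
  have "submodule (\<theta> ` U i) A M'" if i: "i \<le> n" for i
  proof -
    have Ui: "submodule (U i) A M" using U(1) i by blast
    show ?thesis unfolding M'.submodule_iff
    proof (intro conjI ballI)
      show "\<theta> ` U i \<subseteq> carrier M'" using sub[OF i] cl by blast
      have "\<zero>\<^bsub>M\<^esub> \<in> U i" using Ui unfolding M.submodule_iff by blast
      then show "\<zero>\<^bsub>M'\<^esub> \<in> \<theta> ` U i" unfolding zero[symmetric] by (rule imageI)
    next
      fix x y assume "x \<in> \<theta> ` U i" "y \<in> \<theta> ` U i"
      then obtain u v where uv: "u \<in> U i" "v \<in> U i" "x = \<theta> u" "y = \<theta> v" by blast
      then have "x \<oplus>\<^bsub>M'\<^esub> y = \<theta> (u \<oplus>\<^bsub>M\<^esub> v)" using add[OF subsetD[OF sub[OF i] uv(1)] subsetD[OF sub[OF i] uv(2)]] by simp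
      then show "x \<oplus>\<^bsub>M'\<^esub> y \<in> \<theta> ` U i" using Ui uv unfolding M.submodule_iff by blast
    next
      fix r x assume "r \<in> carrier A" "x \<in> \<theta> ` U i"
      then obtain u where u: "u \<in> U i" "x = \<theta> u" by blast
      then have "r \<odot>\<^bsub>M'\<^esub> x = \<theta> (r \<odot>\<^bsub>M\<^esub> u)" using smult[OF \<open>r \<in> carrier A\<close> subsetD[OF sub[OF i] u(1)]] by simp
      then show "r \<odot>\<^bsub>M'\<^esub> x \<in> \<theta> ` U i" using Ui u \<open>r \<in> carrier A\<close> unfolding M.submodule_iff by blast
    qed
  qed
  moreover have "\<theta> ` U i \<subset> \<theta> ` U (Suc i)" if "i < n" for i
  proof -
    have "U i \<subset> U (Suc i)" "U (Suc i) \<subseteq> carrier M" "inj_on \<theta> (carrier M)"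
      using U(2) sub[of "Suc i"] that bij by (auto simp: bij_betw_def)
    then show ?thesis by (intro image_strict_mono) (auto intro: inj_on_subset)
  qed
  ultimately show "\<exists>n'. enat n = enat n' \<and> (\<exists>U'. U' 0 = \<theta> ` U 0 \<and> U' n' = \<theta> ` U n \<and>
      (\<forall>i\<le>n'. submodule (U' i) A M') \<and> (\<forall>i<n'. U' i \<subset> U' (Suc i)))"
    by (intro exI[of _ n] conjI exI[of _ "\<lambda>i. \<theta> ` U i"]) auto
qed

lemma quotient_length_iso:
  assumes M: "Module.module A M" and M': "Module.module A M'" and bij: "bij_betw \<theta> (carrier M) (carrier M')"
    and add: "\<And>x y. x \<in> carrier M \<Longrightarrow> y \<in> carrier M \<Longrightarrow> \<theta> (x \<oplus>\<^bsub>M\<^esub> y) = \<theta> x \<oplus>\<^bsub>M'\<^esub> \<theta> y"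
    and smult: "\<And>r x. r \<in> carrier A \<Longrightarrow> x \<in> carrier M \<Longrightarrow> \<theta> (r \<odot>\<^bsub>M\<^esub> x) = r \<odot>\<^bsub>M'\<^esub> \<theta> x"
    and sub: "L \<subseteq> carrier M" "N \<subseteq> carrier M"
  shows "quotient_length A M' (\<theta> ` L) (\<theta> ` N) = quotient_length A M L N"
proof (rule antisym)
  interpret M: Module.module A M by fact
  let ?\<eta> = "inv_into (carrier M) \<theta>"
  have inj: "inj_on \<theta> (carrier M)" and im: "\<theta> ` carrier M = carrier M'"
    using bij by (auto simp: bij_betw_def)
  have \<eta>: "?\<eta> (\<theta> x) = x" if "x \<in> carrier M" for x using inj that by simp
  have surj: "\<exists>x\<in>carrier M. y = \<theta> x" if "y \<in> carrier M'" for y using im that by blast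
  have "quotient_length A M' (\<theta> ` L) (\<theta> ` N) \<le> quotient_length A M (?\<eta> ` \<theta> ` L) (?\<eta> ` \<theta> ` N)"
  proof (rule quotient_length_iso_le[OF M' M])
    show "bij_betw ?\<eta> (carrier M') (carrier M)" using bij by (rule bij_betw_inv_into)
    show "?\<eta> (x \<oplus>\<^bsub>M'\<^esub> y) = ?\<eta> x \<oplus>\<^bsub>M\<^esub> ?\<eta> y" if "x \<in> carrier M'" "y \<in> carrier M'" for x y
      using surj[OF that(1)] surj[OF that(2)] by (auto simp: \<eta> simp flip: add)
    show "?\<eta> (r \<odot>\<^bsub>M'\<^esub> x) = r \<odot>\<^bsub>M\<^esub> ?\<eta> x" if "r \<in> carrier A" "x \<in> carrier M'" for r x
      using surj[OF that(2)] that(1) by (auto simp: \<eta> simp flip: smult)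
  qed
  moreover have "?\<eta> ` \<theta> ` X = X" if "X \<subseteq> carrier M" for X
    using that inj by (rule inv_into_image_cancel[rotated])
  ultimately show "quotient_length A M' (\<theta> ` L) (\<theta> ` N) \<le> quotient_length A M L N"
    using sub by simp
qed (rule quotient_length_iso_le[OF M M' bij add smult])

section \<open>The bidual of an ideal\<close>

definition colon :: "'f::field set \<Rightarrow> 'f set \<Rightarrow> 'f set" where
  "colon R I = {y. \<forall>x\<in>I. y * x \<in> R}"

text \<open>For a homomorphism \<open>f\<close> from \<open>C\<close> to \<open>R\<close>, both
  \<open>x0 * f x\<close> and \<open>x * f x0\<close> equal \<open>f (x0 * x)\<close>, so
  \<open>f\<close> is multiplication by \<open>f x0 / x0\<close>. Hence the dual is the colon inside
  the field, likewise for the bidual, and evaluation becomes the inclusion of \<open>C\<close> into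
  the double colon.\<close>

lemma bideg_eq_quotient_length:
  fixes R C :: "'f::field set"
  assumes cr: "cring (ring_on R)" and C: "ideal C (ring_on R)" and ne: "x0 \<in> C" "x0 \<noteq> 0"
  shows "bideg R C = quotient_length (ring_on R) (ideal_module (ring_on R) (colon R (colon R C))) C (colon R (colon R C))"
proof -
  interpret R: cring "ring_on R" by fact
  note C' = C[unfolded ideal_ring_on_iff[OF cr]]
  have R0: "0 \<in> R" and R1: "1 \<in> R" and Radd: "\<And>x y. x \<in> R \<Longrightarrow> y \<in> R \<Longrightarrow> x + y \<in> R"
    and Rmult: "\<And>x y. x \<in> R \<Longrightarrow> y \<in> R \<Longrightarrow> x * y \<in> R"
    using R.zero_closed R.one_closed R.add.m_closed R.m_closed by auto
  let ?A = "ring_on R"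
  let ?M = "ideal_module ?A C"
  let ?D = "dual_module ?A ?M"
  let ?B = "dual_module ?A ?D"
  let ?C2 = "colon R (colon R C)"
  have mM: "Module.module ?A ?M" by (rule module_ideal_module[OF cr]) (use C' in auto)
  have mR: "Module.module ?A (ideal_module ?A (carrier ?A))"
    by (rule module_ideal_module[OF cr]) (use R0 Radd Rmult in auto)
  have mD: "Module.module ?A ?D" unfolding dual_module_def by (rule module_hom_module[OF mM mR])
  have mB: "Module.module ?A ?B" unfolding dual_module_def[of _ ?D] by (rule module_hom_module[OF mD mR])
  have mC2: "Module.module ?A (ideal_module ?A ?C2)"
    by (rule module_ideal_module[OF cr]) (auto simp: colon_def R0 Radd Rmult distrib_right mult.assoc)
  have D: "f \<in> carrier ?D \<longleftrightarrow> f \<in> extensional C \<and> (\<forall>x\<in>C. f x \<in> R) \<and> (\<forall>x\<in>C. \<forall>y\<in>C. f (x + y) = f x + f y) \<and>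
      (\<forall>r\<in>R. \<forall>x\<in>C. f (r * x) = r * f x)" for f
    by (auto simp: dual_module_def mod_hom_def PiE_iff)
  have Dops: "f \<oplus>\<^bsub>?D\<^esub> g = (\<lambda>x\<in>C. f x + g x)" "r \<odot>\<^bsub>?D\<^esub> f = (\<lambda>x\<in>C. r * f x)" for f g r
    by (simp_all add: dual_module_def)
  have B: "\<Phi> \<in> carrier ?B \<longleftrightarrow> \<Phi> \<in> extensional (carrier ?D) \<and> (\<forall>f\<in>carrier ?D. \<Phi> f \<in> R) \<and>
      (\<forall>f\<in>carrier ?D. \<forall>g\<in>carrier ?D. \<Phi> (f \<oplus>\<^bsub>?D\<^esub> g) = \<Phi> f + \<Phi> g) \<and>
      (\<forall>r\<in>R. \<forall>f\<in>carrier ?D. \<Phi> (r \<odot>\<^bsub>?D\<^esub> f) = r * \<Phi> f)" for \<Phi>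
    unfolding dual_module_def[of _ ?D] by (auto simp: mod_hom_def PiE_iff)
  have Bops: "\<Phi> \<oplus>\<^bsub>?B\<^esub> \<Psi> = (\<lambda>x\<in>carrier ?D. \<Phi> x + \<Psi> x)" "r \<odot>\<^bsub>?B\<^esub> \<Phi> = (\<lambda>x\<in>carrier ?D. r * \<Phi> x)" for \<Phi> \<Psi> r
    unfolding dual_module_def[of _ ?D] by simp_all
  define y where "y f = f x0 / x0" for f :: "'f \<Rightarrow> 'f"
  have y: "f x = y f * x" if "f \<in> carrier ?D" "x \<in> C" for f x
  proof -
    have "x \<in> R" "x0 \<in> R" using that ne C' by auto
    then have "x0 * f x = x * f x0" using that ne unfolding D by (metis mult.commute)
    then show ?thesis using ne by (simp add: y_def field_simps)
  qed
  have y_colon: "y f \<in> colon R C" if "f \<in> carrier ?D" for f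
    using y[OF that] that unfolding D colon_def by auto
  define mul where "mul z = (\<lambda>x\<in>C. z * x)" for z
  have mul: "mul z \<in> carrier ?D" "y (mul z) = z" if "z \<in> colon R C" for z
    unfolding D using that C' ne by (auto simp: mul_def y_def colon_def distrib_left mult.left_commute)
  \<comment> \<open>\<open>mul 1\<close> is the inclusion of \<open>C\<close> into \<open>R\<close>;
    an element of the bidual will be recovered from its value there.\<close>
  have one: "1 \<in> colon R C" using C' by (auto simp: colon_def)
  have y_add: "y (f \<oplus>\<^bsub>?D\<^esub> g) = y f + y g" "y (r \<odot>\<^bsub>?D\<^esub> f) = r * y f" for f g r
    using ne by (simp_all add: y_def Dops add_divide_distrib)
  define \<theta> where "\<theta> z = (\<lambda>f\<in>carrier ?D. z * y f)" for z
  interpret D: Module.module ?A ?D by (rule mD)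
  have D_closed: "f \<oplus>\<^bsub>?D\<^esub> g \<in> carrier ?D" if "f \<in> carrier ?D" "g \<in> carrier ?D" for f g
    using that by simp
  have D_smult_closed: "r \<odot>\<^bsub>?D\<^esub> f \<in> carrier ?D" if "r \<in> R" "f \<in> carrier ?D" for f r
    using that by simp
  have \<theta>B: "\<theta> z \<in> carrier ?B" if "z \<in> ?C2" for z
    unfolding B using that y_colon
    by (auto simp: \<theta>_def D_closed D_smult_closed y_add distrib_left mult.left_commute colon_def[of R "colon R C"])
  have inj: "z = z'" if "\<theta> z = \<theta> z'" for z z'
  proof -
    have "\<theta> w (mul 1) = w" for w unfolding \<theta>_def using mul[OF one] by simp
    then show ?thesis using that by metis
  qed
  have surj: "\<Phi> \<in> \<theta> ` ?C2" if "\<Phi> \<in> carrier ?B" for \<Phi>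
  proof -
    note \<Phi> = that[unfolded B]
    define z where "z = \<Phi> (mul 1)"
    have eq: "\<Phi> f = z * y f" if f: "f \<in> carrier ?D" for f
    proof -
      \<comment> \<open>Every \<open>f\<close> becomes a multiple of the inclusion after
        multiplication by \<open>x0\<close>, so linearity of \<Phi> determines its value at
        \<open>f\<close>.\<close>
      have "x0 \<odot>\<^bsub>?D\<^esub> f = f x0 \<odot>\<^bsub>?D\<^esub> mul 1"
        unfolding Dops mul_def by (rule restrict_ext) (use y[OF f] ne in auto)
      moreover have "x0 \<in> R" "f x0 \<in> R" using ne C' f unfolding D by auto
      ultimately have "x0 * \<Phi> f = f x0 * z"
        using \<Phi> f mul(1)[OF one] unfolding z_def by metis
      then show ?thesis using ne by (simp add: y_def field_simps)
    qed
    have "z \<in> ?C2" unfolding colon_def[of R "colon R C"]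
    proof safe
      fix w assume "w \<in> colon R C"
      then show "z * w \<in> R" using eq[of "mul w"] mul[of w] \<Phi> by metis
    qed
    moreover have "\<Phi> = \<theta> z"
      by (rule extensionalityI[of _ "carrier ?D"]) (use \<Phi> eq in \<open>auto simp: \<theta>_def\<close>)
    ultimately show ?thesis by blast
  qed
  have bij: "bij_betw \<theta> (carrier (ideal_module ?A ?C2)) (carrier ?B)"
    unfolding bij_betw_def inj_on_def using inj surj \<theta>B by auto
  have CC2: "C \<subseteq> ?C2" by (auto simp: colon_def mult.commute)
  have "quotient_length ?A ?B (\<theta> ` C) (\<theta> ` ?C2) = quotient_length ?A (ideal_module ?A ?C2) C ?C2"
    by (rule quotient_length_iso[OF mC2 mB bij])
      (auto simp: \<theta>_def Bops distrib_right mult.assoc CC2 intro!: restrict_ext)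
  moreover have "\<theta> ` C = bidual_map ?A ?M ` C"
  proof (rule image_cong[OF refl])
    fix x assume x: "x \<in> C"
    then show "\<theta> x = bidual_map ?A ?M x"
      unfolding \<theta>_def bidual_map_def by (auto intro!: restrict_ext simp: y mult.commute)
  qed
  moreover have "\<theta> ` ?C2 = carrier ?B" using bij by (simp add: bij_betw_def)
  ultimately show ?thesis by (simp add: bideg_def Let_def)
qed

section \<open>The socle and \<open>Ext\<^sup>1\<close>\<close>

lemma quotient_module_ring_on:
  fixes A :: "'a::comm_ring_1 set"
  assumes cr: "cring (ring_on A)" and m: "ideal m (ring_on A)"
  defines "Q \<equiv> quotient_module (ring_on A) m" and "cl \<equiv> \<lambda>r. m +>\<^bsub>ring_on A\<^esub> r"
  shows "carrier Q = cl ` A"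
    and "r \<in> A \<Longrightarrow> s \<in> A \<Longrightarrow> cl r \<oplus>\<^bsub>Q\<^esub> cl s = cl (r + s)"
    and "r \<in> A \<Longrightarrow> s \<in> A \<Longrightarrow> r \<odot>\<^bsub>Q\<^esub> cl s = cl (r * s)"
    and "r \<in> A \<Longrightarrow> s \<in> A \<Longrightarrow> cl r = cl s \<longleftrightarrow> r - s \<in> m"
    and "\<zero>\<^bsub>Q\<^esub> = cl 0"
proof -
  interpret R: cring "ring_on A" by fact
  interpret ideal m "ring_on A" by fact
  note m' = m[unfolded ideal_ring_on_iff[OF cr]]
  have cl: "cl r = (\<lambda>h. h + r) ` m" for r
    by (auto simp: cl_def a_r_coset_def')
  show "carrier Q = cl ` A"
    by (auto simp: Q_def quotient_module_def FactRing_def A_RCOSETS_def' cl_def)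
  show "cl r \<oplus>\<^bsub>Q\<^esub> cl s = cl (r + s)" if "r \<in> A" "s \<in> A"
    using a_rcos_sum[of r s] that by (simp add: Q_def quotient_module_def FactRing_def cl_def)
  show "r \<odot>\<^bsub>Q\<^esub> cl s = cl (r * s)" if "r \<in> A" "s \<in> A"
    using rcoset_mult_add[of r s] that by (simp add: Q_def quotient_module_def FactRing_def cl_def)
  show "\<zero>\<^bsub>Q\<^esub> = cl 0"
    by (simp add: Q_def quotient_module_def FactRing_def cl)
  show "cl r = cl s \<longleftrightarrow> r - s \<in> m" if "r \<in> A" "s \<in> A"
  proof
    assume "cl r = cl s"
    moreover have "r \<in> cl r" unfolding cl using m' by (auto intro!: image_eqI[of _ _ 0])
    ultimately show "r - s \<in> m" unfolding cl by auto
  next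
    have *: "cl r \<subseteq> cl s" if "r - s \<in> m" for r s
    proof
      fix x assume "x \<in> cl r"
      then obtain h where "h \<in> m" "x = h + r" unfolding cl by blast
      then have "h + (r - s) \<in> m" "x = h + (r - s) + s" using that m' by auto
      then show "x \<in> cl s" unfolding cl by blast
    qed
    have m1: "- 1 \<in> A" by (rule uminus_one_in_cring[OF cr])
    assume rs: "r - s \<in> m"
    then have "- 1 * (r - s) \<in> m" using m' m1 by blast
    then have "s - r \<in> m" by simp
    then show "cl r = cl s" using * rs by blast
  qed
qed

text \<open>A free module is projective: representatives of the images of the basis vectors define a
  linear form with values in \<open>A\<close> that lifts \<open>e\<close>.\<close>

lemma mod_hom_quotient_lift:
  fixes A :: "'a::comm_ring_1 set"
  assumes cr: "cring (ring_on A)" and m: "ideal m (ring_on A)"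
    and e: "e \<in> mod_hom (ring_on A) (free_module (ring_on A) n) (quotient_module (ring_on A) m)"
  obtains u where "\<And>i. i < n \<Longrightarrow> u i \<in> A"
    and "\<And>x. x \<in> carrier (free_module (ring_on A) n) \<Longrightarrow> e x = m +>\<^bsub>ring_on A\<^esub> (\<Sum>i<n. x i * u i)"
proof -
  let ?F = "free_module (ring_on A) n"
  note Q = quotient_module_ring_on[OF cr m]
  interpret R: cring "ring_on A" by fact
  interpret F: Module.module "ring_on A" ?F by (rule module_free_module[OF cr])
  have closed: "0 \<in> A" "1 \<in> A" "\<And>x y. x \<in> A \<Longrightarrow> y \<in> A \<Longrightarrow> x + y \<in> A" "\<And>x y. x \<in> A \<Longrightarrow> y \<in> A \<Longrightarrow> x * y \<in> A"
    using R.zero_closed R.one_closed R.add.m_closed R.m_closed by auto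
  define bas where "bas j = (\<lambda>i\<in>{..<n}. if i = j then 1 else 0 :: 'a)" for j
  have bas: "bas j \<in> carrier ?F" for j by (auto simp: bas_def closed)
  have "\<exists>u. u \<in> A \<and> e (bas j) = m +>\<^bsub>ring_on A\<^esub> u" for j
    using mod_homD(1)[OF e bas[of j]] unfolding Q(1) by blast
  then obtain u where u: "\<And>j. u j \<in> A" "\<And>j. e (bas j) = m +>\<^bsub>ring_on A\<^esub> u j" by metis
  have sum: "(\<Sum>i<k. x i * u i) \<in> A" if "x \<in> carrier ?F" "k \<le> n" for x k
    using that(2)
  proof (induction k)
    case (Suc k)
    then have "x k * u k \<in> A" using that(1) u by (auto simp: PiE_iff intro!: closed)
    then show ?case using Suc closed by simp
  qed (simp add: closed)
  have "e x = m +>\<^bsub>ring_on A\<^esub> (\<Sum>i<n. x i * u i)" if x: "x \<in> carrier ?F" for x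
  proof -
    \<comment> \<open>The truncations of \<open>x\<close> let linearity be applied one coordinate at
      a time, starting from the zero vector.\<close>
    define y where "y k = (\<lambda>i\<in>{..<n}. if i < k then x i else 0)" for k
    have y: "y k \<in> carrier ?F" for k using x by (auto simp: y_def closed PiE_iff)
    have "k \<le> n \<Longrightarrow> e (y k) = m +>\<^bsub>ring_on A\<^esub> (\<Sum>i<k. x i * u i)" for k
    proof (induction k)
      case 0
      have "y 0 = 0 \<odot>\<^bsub>?F\<^esub> bas 0" by (auto simp: y_def intro!: restrict_ext)
      then have "e (y 0) = 0 \<odot>\<^bsub>quotient_module (ring_on A) m\<^esub> e (bas 0)"
        using mod_homD(3)[OF e _ bas[of 0], of 0] closed by simp
      then show ?case using Q(3)[of 0 "u 0"] u closed by simp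
    next
      case (Suc k)
      have xk: "x k \<in> A" using x Suc.prems by (auto simp: PiE_iff)
      have "y (Suc k) = y k \<oplus>\<^bsub>?F\<^esub> (x k \<odot>\<^bsub>?F\<^esub> bas k)"
        by (auto simp: y_def bas_def less_Suc_eq intro!: restrict_ext)
      moreover have "x k \<odot>\<^bsub>?F\<^esub> bas k \<in> carrier ?F" using F.smult_closed[of "x k" "bas k"] bas[of k] xk by auto
      ultimately have "e (y (Suc k)) = e (y k) \<oplus>\<^bsub>quotient_module (ring_on A) m\<^esub> e (x k \<odot>\<^bsub>?F\<^esub> bas k)"
        using mod_homD(2)[OF e y] by metis
      also have "e (x k \<odot>\<^bsub>?F\<^esub> bas k) = m +>\<^bsub>ring_on A\<^esub> (x k * u k)"
        using mod_homD(3)[OF e _ bas[of k], of "x k"] xk Q(3)[of "x k" "u k"] u by simp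
      also have "e (y k) = m +>\<^bsub>ring_on A\<^esub> (\<Sum>i<k. x i * u i)" using Suc by simp
      finally show ?case using Q(2)[of "\<Sum>i<k. x i * u i" "x k * u k"] sum[OF x, of k] Suc.prems xk u closed by simp
    qed
    moreover have "y n = x"
      by (rule extensionalityI[of _ "{..<n}"]) (use x in \<open>auto simp: y_def PiE_iff\<close>)
    ultimately show ?thesis by (metis order_refl)
  qed
  then show ?thesis using that u by blast
qed

text \<open>The class in \<open>Ext\<^sup>1\<^sub>A(A/m, D) \<cong> (D : m) / D\<close> of a cocycle \<open>f\<close> is \<open>f w / \<tau>\<close>, where \<open>d\<^sub>0 w = \<tau> x\<^sub>0\<close> for a
  lift \<open>x\<^sub>0\<close> of \<open>1\<close>.\<close>

lemma Ext1_length_le_1: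
  fixes A :: "'f::field set"
  assumes cr: "cring (ring_on A)" and m: "ideal m (ring_on A)"
    and D: "0 \<in> D" "\<And>x y. x \<in> D \<Longrightarrow> y \<in> D \<Longrightarrow> x + y \<in> D" "\<And>r x. r \<in> A \<Longrightarrow> x \<in> D \<Longrightarrow> r * x \<in> D"
    and ext: "Ext_length (ring_on A) (quotient_module (ring_on A) m) (ideal_module (ring_on A) D) 1 len" "len \<le> 1"
    and \<tau>: "\<tau> \<in> m" "\<tau> \<noteq> 0"
    and y0: "\<And>r. r \<in> m \<Longrightarrow> r * y0 \<in> D" "y0 \<notin> D"
    and y1: "\<And>r. r \<in> m \<Longrightarrow> r * y1 \<in> D"
  shows "\<exists>\<alpha>\<in>A. y1 - \<alpha> * y0 \<in> D"
proof (rule ccontr)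
  assume contra: "\<not> (\<exists>\<alpha>\<in>A. y1 - \<alpha> * y0 \<in> D)"
  let ?A = "ring_on A"
  let ?Q = "quotient_module ?A m"
  let ?D = "ideal_module ?A D"
  obtain n d e where res: "free_resolution ?A ?Q n d e"
    and len: "quotient_length ?A (hom_module ?A (free_module ?A (n 1)) ?D) (coboundaries ?A n d ?D 1) (cocycles ?A n d ?D 1) = len"
    using ext unfolding Ext_length_def by blast
  let ?F = "\<lambda>i. free_module ?A (n i)"
  let ?H = "hom_module ?A (?F 1) ?D"
  let ?Z = "cocycles ?A n d ?D 1"
  let ?B = "coboundaries ?A n d ?D 1"
  note Q = quotient_module_ring_on[OF cr m]
  note m' = m[unfolded ideal_ring_on_iff[OF cr]]
  interpret R: cring ?A by fact
  have closed: "0 \<in> A" "1 \<in> A" "\<And>x y. x \<in> A \<Longrightarrow> y \<in> A \<Longrightarrow> x + y \<in> A" "\<And>x y. x \<in> A \<Longrightarrow> y \<in> A \<Longrightarrow> x * y \<in> A"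
    using R.zero_closed R.one_closed R.add.m_closed R.m_closed by auto
  have m1: "- 1 \<in> A" by (rule uminus_one_in_cring[OF cr])
  have D_diff: "x - y \<in> D" if "x \<in> D" "y \<in> D" for x y
    using D(2)[OF that(1) D(3)[OF m1 that(2)]] by simp
  have mD: "Module.module ?A ?D" by (rule module_ideal_module[OF cr D])
  have mF: "Module.module ?A (?F i)" for i by (rule module_free_module[OF cr])
  interpret F0: Module.module ?A "?F 0" by (rule mF)
  interpret F1: Module.module ?A "?F 1" by (rule mF)
  interpret H: Module.module ?A ?H by (rule module_hom_module[OF mF mD])
  interpret H0: Module.module ?A "hom_module ?A (?F 0) ?D" by (rule module_hom_module[OF mF mD])
  have e: "e \<in> mod_hom ?A (?F 0) ?Q" and d: "\<And>i. d i \<in> mod_hom ?A (?F (Suc i)) (?F i)"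
    and e_surj: "e ` carrier (?F 0) = carrier ?Q"
    and ex0: "d 0 ` carrier (?F 1) = {x \<in> carrier (?F 0). e x = \<zero>\<^bsub>?Q\<^esub>}"
    and ex1: "\<And>i. d (Suc i) ` carrier (?F (Suc (Suc i))) = {x \<in> carrier (?F (Suc i)). d i x = \<zero>\<^bsub>?F i\<^esub>}"
    using res unfolding free_resolution_def by blast+
  note d0 = mod_homD[OF d[of 0], folded One_nat_def]
  obtain u where u: "\<And>i. i < n 0 \<Longrightarrow> u i \<in> A"
    and eu: "\<And>x. x \<in> carrier (?F 0) \<Longrightarrow> e x = m +>\<^bsub>?A\<^esub> (\<Sum>i<n 0. x i * u i)"
    using mod_hom_quotient_lift[OF cr m e] by blast
  \<comment> \<open>\<open>L\<close> is the linear form lifting \<open>e\<close>, so exactness turns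
    membership in the image of \<open>d 0\<close> into the condition that \<open>L\<close> takes a
    value in \<open>m\<close>.\<close>
  define L where "L x = (\<Sum>i<n 0. x i * u i)" for x
  have L_A: "L x \<in> A" if "x \<in> carrier (?F 0)" for x
  proof -
    have "(\<Sum>i<k. x i * u i) \<in> A" if "k \<le> n 0" for k
      using that
    proof (induction k)
      case (Suc k)
      then have "x k * u k \<in> A" using \<open>x \<in> carrier (?F 0)\<close> u by (auto simp: PiE_iff intro!: closed)
      then show ?case using Suc closed by simp
    qed (simp add: closed)
    then show ?thesis by (simp add: L_def)
  qed
  have L_add: "L (x \<oplus>\<^bsub>?F 0\<^esub> y) = L x + L y" and L_smult: "L (r \<odot>\<^bsub>?F 0\<^esub> x) = r * L x" for x y r
    by (simp_all add: L_def sum.distrib distrib_right sum_distrib_left mult.assoc)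
  have L_zero: "L \<zero>\<^bsub>?F 0\<^esub> = 0" by (simp add: L_def)
  have e_zero: "e x = \<zero>\<^bsub>?Q\<^esub> \<longleftrightarrow> L x \<in> m" if "x \<in> carrier (?F 0)" for x
    using eu[OF that] Q(4)[OF L_A[OF that] closed(1)] Q(5) by (simp add: L_def)
  have "m +>\<^bsub>?A\<^esub> 1 \<in> carrier ?Q" unfolding Q(1) using closed by blast
  then obtain x0 where x0: "x0 \<in> carrier (?F 0)" "e x0 = m +>\<^bsub>?A\<^esub> 1" using e_surj by (metis imageE)
  have Lx0: "L x0 - 1 \<in> m"
    using x0 eu[OF x0(1)] Q(4)[OF L_A[OF x0(1)] closed(2)] by (simp add: L_def)
  have \<tau>A: "\<tau> \<in> A" using \<tau> m' by blast
  have L_d0: "L (d 0 x) \<in> m" if "x \<in> carrier (?F 1)" for x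
    using ex0 e_zero that by blast
  have "\<tau> \<odot>\<^bsub>?F 0\<^esub> x0 \<in> carrier (?F 0)" using F0.smult_closed[of \<tau> x0] \<tau>A x0 by simp
  moreover have "L (\<tau> \<odot>\<^bsub>?F 0\<^esub> x0) \<in> m"
    unfolding L_smult using m' \<tau> L_A[OF x0(1)] by (metis mult.commute)
  ultimately have "\<tau> \<odot>\<^bsub>?F 0\<^esub> x0 \<in> d 0 ` carrier (?F 1)"
    unfolding ex0 using e_zero by blast
  \<comment> \<open>The vector \<open>x0\<close> itself is not in the image of \<open>d 0\<close>,
    but its multiple by \<tau> is. Since \<tau> is nonzero in a field, it can be divided out again
    in \<psi>.\<close>
  then obtain w where w: "w \<in> carrier (?F 1)" "d 0 w = \<tau> \<odot>\<^bsub>?F 0\<^esub> x0" by (metis imageE)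
  define \<psi> where "\<psi> f = f w / \<tau>" for f :: "(nat \<Rightarrow> 'f) \<Rightarrow> 'f"
  have \<psi>_add: "\<psi> (f \<oplus>\<^bsub>?H\<^esub> g) = \<psi> f + \<psi> g" and \<psi>_smult: "\<psi> (r \<odot>\<^bsub>?H\<^esub> f) = r * \<psi> f"
    and \<psi>_zero: "\<psi> \<zero>\<^bsub>?H\<^esub> = 0" for f g r
    using w(1) by (simp_all add: \<psi>_def add_divide_distrib)
  have Z: "f \<in> ?Z \<longleftrightarrow> f \<in> carrier ?H \<and> (\<forall>x\<in>carrier (?F (Suc 1)). f (d 1 x) = 0)" for f
    by (simp add: cocycles_def)
  have d1: "d 1 x \<in> carrier (?F 1)" if "x \<in> carrier (?F (Suc 1))" for x
    using mod_homD(1)[OF d[of 1] that] .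
  have dd: "d 0 (d 1 x) = \<zero>\<^bsub>?F 0\<^esub>" if "x \<in> carrier (?F (Suc 1))" for x
    using ex1[of 0] that by (metis (mono_tags, lifting) One_nat_def image_eqI mem_Collect_eq)
  \<comment> \<open>The inverse construction: for \<open>y\<close> with \<open>m y\<close> inside
    \<open>D\<close>, the composite \<open>L\<close> after \<open>d 0\<close> has values in
    \<open>m\<close>, so multiplying it by \<open>y\<close> lands in \<open>D\<close>. It vanishes
    on the image of \<open>d 1\<close>.\<close>
  define fy where "fy y = (\<lambda>x\<in>carrier (?F 1). y * L (d 0 x))" for y
  have fy_Z: "fy y \<in> ?Z" if "\<And>r. r \<in> m \<Longrightarrow> r * y \<in> D" for y
  proof -
    have "fy y \<in> mod_hom ?A (?F 1) ?D"
    proof (rule mod_homI)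
      show "fy y \<in> extensional (carrier (?F 1))" by (simp add: fy_def)
      show "fy y x \<in> carrier ?D" if "x \<in> carrier (?F 1)" for x
        using \<open>\<And>r. r \<in> m \<Longrightarrow> r * y \<in> D\<close>[OF L_d0[OF that]] that by (simp add: fy_def mult.commute[of y])
      show "fy y (x \<oplus>\<^bsub>?F 1\<^esub> x') = fy y x \<oplus>\<^bsub>?D\<^esub> fy y x'" if "x \<in> carrier (?F 1)" "x' \<in> carrier (?F 1)" for x x'
        unfolding fy_def using F1.add.m_closed[OF that] that d0(2)[OF that] L_add
        by (simp only: restrict_apply' ideal_module_simps ring_on_simps distrib_left)
      show "fy y (r \<odot>\<^bsub>?F 1\<^esub> x) = r \<odot>\<^bsub>?D\<^esub> fy y x" if "r \<in> carrier ?A" "x \<in> carrier (?F 1)" for r x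
        unfolding fy_def using F1.smult_closed[OF that] that d0(3)[OF that] L_smult
        by (simp only: restrict_apply' ideal_module_simps ring_on_simps mult.left_commute)
    qed
    moreover have "fy y (d 1 x) = 0" if "x \<in> carrier (?F (Suc 1))" for x
      unfolding fy_def using d1[OF that] dd[OF that] L_zero by (simp only: restrict_apply' mult_zero_right)
    ultimately show ?thesis unfolding Z by simp
  qed
  \<comment> \<open>The value is \<open>y * L x0\<close>, and \<open>L x0\<close> is congruent to 1
    modulo \<open>m\<close>; hence it equals \<open>y\<close> modulo \<open>D\<close>.\<close>
  have \<psi>_fy: "\<psi> (fy y) = y + (L x0 - 1) * y" for y
    using w \<tau> L_smult[of \<tau> x0] by (simp add: \<psi>_def fy_def algebra_simps)
  \<comment> \<open>The cocycles whose class is a multiple of that of \<open>y0\<close>. Being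
    neither all coboundaries nor all cocycles, they give a chain of length two, too long for the
    assumed bound.\<close>
  define U where "U = {f \<in> ?Z. \<exists>\<alpha>\<in>A. \<psi> f - \<alpha> * y0 \<in> D}"
  have Z_sub: "submodule ?Z ?A ?H"
    unfolding H.submodule_iff
  proof (intro conjI ballI)
    show "?Z \<subseteq> carrier ?H" using Z by blast
    show "\<zero>\<^bsub>?H\<^esub> \<in> ?Z" unfolding Z using H.zero_closed d1 by simp
    show "f \<oplus>\<^bsub>?H\<^esub> g \<in> ?Z" if "f \<in> ?Z" "g \<in> ?Z" for f g
      using that H.add.m_closed[of f g] d1 unfolding Z by simp
    show "r \<odot>\<^bsub>?H\<^esub> f \<in> ?Z" if "r \<in> carrier ?A" "f \<in> ?Z" for r f
      using that H.smult_closed[of r f] d1 unfolding Z by simp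
  qed
  have U_sub: "submodule U ?A ?H"
    unfolding H.submodule_iff
  proof (intro conjI ballI)
    note Z' = Z_sub[unfolded H.submodule_iff]
    show "U \<subseteq> carrier ?H" using Z' by (auto simp: U_def)
    show "\<zero>\<^bsub>?H\<^esub> \<in> U" unfolding U_def using Z' \<psi>_zero D(1) closed(1) by force
    show "f \<oplus>\<^bsub>?H\<^esub> g \<in> U" if fg: "f \<in> U" "g \<in> U" for f g
    proof -
      obtain \<alpha> \<beta> where ab: "\<alpha> \<in> A" "\<beta> \<in> A" "\<psi> f - \<alpha> * y0 \<in> D" "\<psi> g - \<beta> * y0 \<in> D"
        using fg unfolding U_def by blast
      have "\<psi> (f \<oplus>\<^bsub>?H\<^esub> g) - (\<alpha> + \<beta>) * y0 \<in> D"
        using D(2)[OF ab(3,4)] unfolding \<psi>_add by (simp add: algebra_simps)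
      moreover have "f \<oplus>\<^bsub>?H\<^esub> g \<in> ?Z" using Z' that unfolding U_def by blast
      ultimately show ?thesis using closed(3)[OF ab(1,2)] unfolding U_def by blast
    qed
    show "r \<odot>\<^bsub>?H\<^esub> f \<in> U" if rf: "r \<in> carrier ?A" "f \<in> U" for r f
    proof -
      obtain \<alpha> where a: "\<alpha> \<in> A" "\<psi> f - \<alpha> * y0 \<in> D" using rf unfolding U_def by blast
      have "\<psi> (r \<odot>\<^bsub>?H\<^esub> f) - (r * \<alpha>) * y0 \<in> D"
        using D(3)[OF _ a(2), of r] that unfolding \<psi>_smult by (simp add: algebra_simps)
      moreover have "r \<odot>\<^bsub>?H\<^esub> f \<in> ?Z" using Z' that unfolding U_def by blast
      ultimately show ?thesis using closed(4)[of r \<alpha>] that a unfolding U_def by auto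
    qed
  qed
  define pull where "pull g = (\<lambda>x\<in>carrier (?F 1). g (d 0 x))" for g :: "(nat \<Rightarrow> 'f) \<Rightarrow> 'f"
  have B: "?B = pull ` carrier (hom_module ?A (?F 0) ?D)"
    unfolding One_nat_def coboundaries.simps pull_def by (auto simp del: free_module_simps)
  have pull: "pull g \<in> ?Z" "\<psi> (pull g) \<in> D" if g: "g \<in> carrier (hom_module ?A (?F 0) ?D)" for g
  proof -
    have g': "g \<in> mod_hom ?A (?F 0) ?D" using g by simp
    note gD = mod_homD[OF g']
    have "pull g \<in> mod_hom ?A (?F 1) ?D"
    proof (rule mod_homI)
      show "pull g \<in> extensional (carrier (?F 1))" by (simp add: pull_def)
      show "pull g x \<in> carrier ?D" if "x \<in> carrier (?F 1)" for x
        using gD(1)[OF d0(1)[OF that]] that unfolding pull_def by (simp only: restrict_apply')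
      show "pull g (x \<oplus>\<^bsub>?F 1\<^esub> x') = pull g x \<oplus>\<^bsub>?D\<^esub> pull g x'" if "x \<in> carrier (?F 1)" "x' \<in> carrier (?F 1)" for x x'
        unfolding pull_def using F1.add.m_closed[OF that] that d0(2)[OF that] gD(2)[OF d0(1)[OF that(1)] d0(1)[OF that(2)]]
        by (simp only: restrict_apply')
      show "pull g (r \<odot>\<^bsub>?F 1\<^esub> x) = r \<odot>\<^bsub>?D\<^esub> pull g x" if "r \<in> carrier ?A" "x \<in> carrier (?F 1)" for r x
        unfolding pull_def using F1.smult_closed[OF that] that d0(3)[OF that] gD(3)[OF that(1) d0(1)[OF that(2)]]
        by (simp only: restrict_apply')
    qed
    moreover have "pull g (d 1 x) = 0" if "x \<in> carrier (?F (Suc 1))" for x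
      unfolding pull_def using d1[OF that] dd[OF that] mod_hom_zero[OF mF mD g']
      by (simp only: restrict_apply' ideal_module_simps ring_on_simps)
    ultimately show "pull g \<in> ?Z" unfolding Z by simp
    have "\<psi> (pull g) = g (\<tau> \<odot>\<^bsub>?F 0\<^esub> x0) / \<tau>"
      unfolding \<psi>_def pull_def using w by (simp only: restrict_apply')
    also have "\<dots> = g x0" using gD(3)[of \<tau> x0] \<tau>A x0 \<tau> by simp
    finally show "\<psi> (pull g) \<in> D" using gD(1)[OF x0(1)] by simp
  qed
  have B_sub: "submodule ?B ?A ?H"
    unfolding H.submodule_iff B
  proof (intro conjI ballI)
    show "pull ` carrier (hom_module ?A (?F 0) ?D) \<subseteq> carrier ?H"
      using pull(1) Z by blast
    have "\<zero>\<^bsub>?H\<^esub> = pull \<zero>\<^bsub>hom_module ?A (?F 0) ?D\<^esub>"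
      unfolding pull_def hom_module_simps by (rule restrict_ext) (use d0(1) in \<open>simp only: restrict_apply'\<close>)
    then show "\<zero>\<^bsub>?H\<^esub> \<in> pull ` carrier (hom_module ?A (?F 0) ?D)" using H0.zero_closed by blast
  next
    fix f g assume "f \<in> pull ` carrier (hom_module ?A (?F 0) ?D)" "g \<in> pull ` carrier (hom_module ?A (?F 0) ?D)"
    then obtain f' g' where fg: "f = pull f'" "g = pull g'"
      "f' \<in> carrier (hom_module ?A (?F 0) ?D)" "g' \<in> carrier (hom_module ?A (?F 0) ?D)" by blast
    have "f \<oplus>\<^bsub>?H\<^esub> g = pull (f' \<oplus>\<^bsub>hom_module ?A (?F 0) ?D\<^esub> g')"
      unfolding fg pull_def hom_module_simps by (rule restrict_ext) (use d0(1) in \<open>simp only: restrict_apply'\<close>)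
    then show "f \<oplus>\<^bsub>?H\<^esub> g \<in> pull ` carrier (hom_module ?A (?F 0) ?D)"
      using H0.add.m_closed[OF fg(3,4)] by blast
  next
    fix r f assume r: "r \<in> carrier ?A" and "f \<in> pull ` carrier (hom_module ?A (?F 0) ?D)"
    then obtain f' where f: "f = pull f'" "f' \<in> carrier (hom_module ?A (?F 0) ?D)" by blast
    have "r \<odot>\<^bsub>?H\<^esub> f = pull (r \<odot>\<^bsub>hom_module ?A (?F 0) ?D\<^esub> f')"
      unfolding f pull_def hom_module_simps by (rule restrict_ext) (use d0(1) in \<open>simp only: restrict_apply'\<close>)
    then show "r \<odot>\<^bsub>?H\<^esub> f \<in> pull ` carrier (hom_module ?A (?F 0) ?D)"
      using H0.smult_closed[OF r f(2)] by blast
  qed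
  have BU: "?B \<subset> U"
  proof
    show "?B \<subseteq> U"
    proof
      fix f assume "f \<in> ?B"
      then have "f \<in> ?Z" "\<psi> f - 0 * y0 \<in> D" unfolding B using pull by auto
      then show "f \<in> U" unfolding U_def using closed(1) by blast
    qed
    have "fy y0 \<in> U"
    proof -
      have "\<psi> (fy y0) - 1 * y0 \<in> D" using y0(1)[OF Lx0] unfolding \<psi>_fy by simp
      then show ?thesis unfolding U_def using fy_Z[OF y0(1)] closed(2) by blast
    qed
    moreover have "fy y0 \<notin> ?B"
    proof
      assume "fy y0 \<in> ?B"
      then obtain g where "g \<in> carrier (hom_module ?A (?F 0) ?D)" "fy y0 = pull g" unfolding B by (rule imageE)
      then have "\<psi> (fy y0) \<in> D" using pull(2)[of g] by simp
      from D_diff[OF this y0(1)[OF Lx0]] have "y0 \<in> D" unfolding \<psi>_fy by simp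
      then show False using y0 by blast
    qed
    ultimately show "?B \<noteq> U" by blast
  qed
  have UZ: "U \<subset> ?Z"
  proof
    show "U \<subseteq> ?Z" by (auto simp: U_def)
    have "fy y1 \<notin> U"
    proof
      assume "fy y1 \<in> U"
      then have "\<exists>\<alpha>\<in>A. \<psi> (fy y1) - \<alpha> * y0 \<in> D" unfolding U_def by simp
      then obtain \<alpha> where \<alpha>: "\<alpha> \<in> A" "y1 + (L x0 - 1) * y1 - \<alpha> * y0 \<in> D" unfolding \<psi>_fy by blast
      from D_diff[OF \<alpha>(2) y1[OF Lx0]] have "y1 - \<alpha> * y0 \<in> D" by (simp add: algebra_simps)
      then show False using contra \<open>\<alpha> \<in> A\<close> by blast
    qed
    then show "U \<noteq> ?Z" using fy_Z[OF y1] by blast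
  qed
  let ?V = "\<lambda>i::nat. if i = 0 then ?B else if i = 1 then U else ?Z"
  have "enat 2 \<le> quotient_length ?A ?H ?B ?Z"
    by (rule quotient_length_ge[where U = ?V])
      (use B_sub U_sub Z_sub BU UZ in \<open>auto simp: less_Suc_eq numeral_2_eq_2\<close>)
  then show False using len ext(2) by (metis enat_ord_simps(1) not_one_le_zero numeral_le_one_iff one_enat_def order_trans semiring_norm(69) of_nat_numeral)
qed

section \<open>Rational functions as Laurent series\<close>

definition poly_fls :: "'k::field poly \<Rightarrow> 'k fls" where
  "poly_fls p = fps_to_fls (fps_of_poly p)"

lemma poly_fls_simps:
  "poly_fls 0 = 0" "poly_fls 1 = 1" "poly_fls (p + q) = poly_fls p + poly_fls q"
  "poly_fls (p * q) = poly_fls p * poly_fls q" "poly_fls p = 0 \<longleftrightarrow> p = 0"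
proof -
  show "poly_fls p = 0 \<longleftrightarrow> p = 0"
    using fps_of_poly_eq_iff[of p 0] by (simp add: poly_fls_def)
qed (simp_all add: poly_fls_def fps_of_poly_add fps_of_poly_mult fls_times_fps_to_fls)

lemma poly_fls_nth: "poly_fls p $$ n = (if n < 0 then 0 else coeff p (nat n))"
  by (simp add: poly_fls_def)

text \<open>The expansion at \<open>t = 0\<close>, embedding \<open>k(t)\<close> into
  \<open>k((t))\<close>. The description by \<open>THE\<close> avoids choosing a numerator and a
  denominator; \<open>laurent_Fract\<close> shows that the choice does not matter.\<close>

definition laurent :: "'k::field poly fract \<Rightarrow> 'k fls" where
  "laurent x = (THE y. \<exists>p q. q \<noteq> 0 \<and> x = Fract p q \<and> y = poly_fls p / poly_fls q)"

lemma laurent_Fract: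
  assumes "q \<noteq> 0"
  shows "laurent (Fract p q) = poly_fls p / poly_fls q"
  unfolding laurent_def
proof (rule the_equality)
  show "\<exists>p' q'. q' \<noteq> 0 \<and> Fract p q = Fract p' q' \<and> poly_fls p / poly_fls q = poly_fls p' / poly_fls q'"
    using assms by blast
next
  fix y assume "\<exists>p' q'. q' \<noteq> 0 \<and> Fract p q = Fract p' q' \<and> y = poly_fls p' / poly_fls q'"
  then obtain p' q' where q': "q' \<noteq> 0" "Fract p q = Fract p' q'" "y = poly_fls p' / poly_fls q'" by blast
  then have "p * q' = p' * q" using assms by (simp add: eq_fract)
  then have "poly_fls p * poly_fls q' = poly_fls p' * poly_fls q" by (metis poly_fls_simps(4))
  then show "y = poly_fls p / poly_fls q" using q' assms by (simp add: poly_fls_simps(5) frac_eq_eq)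
qed

lemma laurent_to_poly: "laurent (Fract p 1) = poly_fls p"
  by (simp add: laurent_Fract poly_fls_simps)

lemma laurent_add: "laurent (x + y) = laurent x + laurent y"
  by (cases x, cases y) (simp add: laurent_Fract poly_fls_simps add_frac_eq)

lemma laurent_mult: "laurent (x * y) = laurent x * laurent y"
  by (cases x, cases y) (simp add: laurent_Fract poly_fls_simps)

lemma laurent_0: "laurent 0 = 0"
  by (simp add: Zero_fract_def laurent_to_poly poly_fls_simps)

lemma laurent_1: "laurent 1 = 1"
  by (simp add: One_fract_def laurent_to_poly poly_fls_simps)

lemma laurent_diff: "laurent (x - y) = laurent x - laurent y"
  using laurent_add[of "x - y" y] by simp

lemma laurent_eq_0_iff: "laurent x = 0 \<longleftrightarrow> x = 0"
proof
  assume *: "laurent x = 0"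
  show "x = 0"
  proof (rule ccontr)
    assume "x \<noteq> 0"
    then have "laurent x * laurent (inverse x) = 1" by (simp add: laurent_1 flip: laurent_mult)
    then show False using * by simp
  qed
qed (simp add: laurent_0)

lemma laurent_eq_iff: "laurent x = laurent y \<longleftrightarrow> x = y"
  using laurent_eq_0_iff[of "x - y"] by (simp add: laurent_diff)

lemma laurent_sum: "laurent (\<Sum>i\<in>A. h i) = (\<Sum>i\<in>A. laurent (h i))"
  by (induction A rule: infinite_finite_induct) (simp_all add: laurent_0 laurent_add)

lemma fls_nth_sum: "(\<Sum>i\<in>A. h i) $$ n = (\<Sum>i\<in>A. h i $$ n)"
  by (induction A rule: infinite_finite_induct) simp_all

definition tmon :: "'k::field \<Rightarrow> int \<Rightarrow> 'k poly fract" where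
  "tmon c n = (if n \<ge> 0 then Fract (monom c (nat n)) 1 else Fract [:c:] (monom 1 (nat (- n))))"

lemma laurent_tmon:
  fixes c :: "'k::field"
  shows "laurent (tmon c n) = fls_shift (- n) (fls_const c)"
proof (cases "n \<ge> 0")
  case True
  then show ?thesis
    by (intro fls_eqI) (auto simp: tmon_def laurent_to_poly poly_fls_nth nat_eq_iff)
next
  case False
  have 1: "poly_fls (monom (1::'k) (nat (- n))) = fls_X_intpow (- n)"
    by (rule fls_eqI) (use False in \<open>auto simp: poly_fls_nth nat_eq_iff\<close>)
  have 2: "poly_fls [:c:] = fls_const c"
    by (simp add: poly_fls_def fps_of_poly_const fps_const_to_fls)
  have "laurent (tmon c n) = fls_const c / fls_X_intpow (- n)"
    using False by (simp add: tmon_def laurent_Fract 1 2)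
  then show ?thesis by (simp only: fls_divide_X_intpow)
qed

lemma laurent_tmon_nth: "laurent (tmon c n) $$ i = (if i = n then c else 0)"
  by (auto simp: laurent_tmon)

lemma laurent_tmon_mult_nth: "(laurent (tmon c n) * f) $$ i = c * f $$ (i - n)"
proof -
  have "laurent (tmon c n) = fls_const c * fls_X_intpow n"
    by (rule fls_eqI) (simp add: laurent_tmon)
  then have "laurent (tmon c n) * f = fls_const c * (fls_X_intpow n * f)" by (simp add: mult.assoc)
  then show ?thesis by (simp add: fls_X_intpow_times_conv_shift)
qed

lemma tmon_mult: "tmon c m * tmon d n = tmon (c * d) (m + n)"
proof -
  have "laurent (tmon c m * tmon d n) = laurent (tmon (c * d) (m + n))"
    by (rule fls_eqI) (simp add: laurent_mult laurent_tmon_mult_nth laurent_tmon_nth)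
  then show ?thesis by (simp only: laurent_eq_iff)
qed

lemma tmon_add: "tmon c n + tmon d n = tmon (c + d) n"
proof -
  have "laurent (tmon c n + tmon d n) = laurent (tmon (c + d) n)"
    by (rule fls_eqI) (simp add: laurent_add laurent_tmon_nth)
  then show ?thesis by (simp only: laurent_eq_iff)
qed

lemma tmon_0: "tmon 0 n = 0"
  by (metis fls_const_0 fls_shift_zero laurent_eq_0_iff laurent_tmon)

lemma tmon_1_0: "tmon 1 0 = 1"
  by (simp add: tmon_def One_fract_def monom_eq_1)

lemma tmon_uminus_1_0: "tmon (- 1) 0 = - 1"
  using tmon_add[of "- 1" 0 1] by (simp add: tmon_0 tmon_1_0 eq_neg_iff_add_eq_0)

lemma tmon_power: "tmon 1 m ^ n = tmon 1 (m * int n)"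
  by (induction n) (simp_all add: tmon_1_0 tmon_mult algebra_simps)

lemma Fract_monom: "Fract (monom c n) 1 = tmon c (int n)"
  by (simp add: tmon_def)

definition supp :: "'k::field fls \<Rightarrow> int set" where
  "supp f = {n. f $$ n \<noteq> 0}"

lemma supp_mult:
  assumes "n \<in> supp (f * g)"
  obtains i j where "i \<in> supp f" "j \<in> supp g" "n = i + j"
proof -
  have "(f * g) $$ n \<noteq> 0" using assms by (simp add: supp_def)
  then obtain i where "f $$ i * g $$ (n - i) \<noteq> 0"
    unfolding fls_times_nth(2) by (rule sum.not_neutral_contains_not_neutral)
  then show ?thesis using that[of i "n - i"] by (auto simp: supp_def)
qed

lemma supp_subset_add: "supp (f + g) \<subseteq> supp f \<union> supp g"
  by (auto simp: supp_def)

lemma finite_supp_mult: "finite (supp f) \<Longrightarrow> finite (supp g) \<Longrightarrow> finite (supp (f * g))"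
  by (rule finite_subset[of _ "(\<lambda>(i, j). i + j) ` (supp f \<times> supp g)"]) (auto elim!: supp_mult)

text \<open>Orders add under multiplication. This bounds the effect of a truncation error
  \<open>w\<close> after multiplication by a fixed series.\<close>

lemma nth_mult_eq_0:
  fixes w f :: "'k::field fls"
  assumes "\<And>i. i \<le> B \<Longrightarrow> w $$ i = 0" "n \<le> B + fls_subdegree f"
  shows "(w * f) $$ n = 0"
proof (rule ccontr)
  assume "(w * f) $$ n \<noteq> 0"
  then have "n \<in> supp (w * f)" by (simp add: supp_def)
  then obtain i j where ij: "i \<in> supp w" "j \<in> supp f" "n = i + j" by (rule supp_mult)
  then have "i > B" using assms(1)[of i] by (force simp: supp_def)
  moreover have "j \<ge> fls_subdegree f" using ij(2) by (simp add: supp_def fls_subdegree_leI)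
  ultimately show False using assms(2) ij(3) by simp
qed

lemma finite_supp_tmon: "finite (supp (laurent (tmon c n)))"
  by (rule finite_subset[of _ "{n}"]) (auto simp: supp_def laurent_tmon_nth split: if_splits)

lemma laurent_approx:
  obtains x where "finite (supp (laurent x))" "\<And>i. i \<le> B \<Longrightarrow> laurent x $$ i = f $$ i"
proof -
  define x where "x = (\<Sum>i\<in>{fls_subdegree f..B}. tmon (f $$ i) i)"
  have x: "laurent x $$ n = (if n \<in> {fls_subdegree f..B} then f $$ n else 0)" for n
  proof -
    have "laurent x $$ n = (\<Sum>i\<in>{fls_subdegree f..B}. if n = i then f $$ i else 0)"
      by (simp add: x_def laurent_sum fls_nth_sum laurent_tmon_nth)
    then show ?thesis by simp
  qed
  show ?thesis
  proof
    show "finite (supp (laurent x))"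
      by (rule finite_subset[of _ "{fls_subdegree f..B}"]) (auto simp: supp_def x)
    show "laurent x $$ i = f $$ i" if "i \<le> B" for i using that by (auto simp: x)
  qed
qed

lemma laurent_tmon_decomposition:
  assumes "finite (supp (laurent x))"
  shows "(\<Sum>i\<in>supp (laurent x). tmon (laurent x $$ i) i) = x"
proof -
  have "laurent (\<Sum>i\<in>supp (laurent x). tmon (laurent x $$ i) i) $$ n = laurent x $$ n" for n
  proof -
    have "laurent (\<Sum>i\<in>supp (laurent x). tmon (laurent x $$ i) i) $$ n =
      (\<Sum>i\<in>supp (laurent x). if n = i then laurent x $$ i else 0)"
      by (simp add: laurent_sum fls_nth_sum laurent_tmon_nth)
    then show ?thesis using assms by (simp add: supp_def)
  qed
  then have "laurent (\<Sum>i\<in>supp (laurent x). tmon (laurent x $$ i) i) = laurent x" by (rule fls_eqI)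
  then show ?thesis by (simp only: laurent_eq_iff)
qed

section \<open>Twisted monomial modules\<close>

text \<open>Up to the factor \<open>f\<close> this is the span of the monomials with exponent in \<open>E\<close>.\<close>

definition frac_module :: "int set \<Rightarrow> 'k::field fls \<Rightarrow> 'k poly fract set" where
  "frac_module E f = {x. finite (supp (laurent x)) \<and> supp (laurent x * f) \<subseteq> E}"

definition cofinite_above :: "int set \<Rightarrow> bool" where
  "cofinite_above E \<longleftrightarrow> (\<exists>N. \<forall>n\<ge>N. n \<in> E)"

lemma frac_module_0: "0 \<in> frac_module E f"
  by (simp add: frac_module_def laurent_0 supp_def)

lemma frac_module_add:
  assumes "x \<in> frac_module E f" "y \<in> frac_module E f"
  shows "x + y \<in> frac_module E f"
proof -
  have "supp ((laurent x + laurent y) * f) \<subseteq> E"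
    using assms supp_subset_add[of "laurent x * f" "laurent y * f"] by (auto simp: frac_module_def distrib_right)
  then show ?thesis
    using assms finite_subset[OF supp_subset_add] by (auto simp: frac_module_def laurent_add)
qed

lemma frac_module_mult:
  assumes "x \<in> frac_module E f" "y \<in> frac_module E' f'" "\<And>n n'. n \<in> E \<Longrightarrow> n' \<in> E' \<Longrightarrow> n + n' \<in> E''"
  shows "x * y \<in> frac_module E'' (f * f')"
proof -
  have "n \<in> E''" if "n \<in> supp (laurent (x * y) * (f * f'))" for n
  proof -
    have "n \<in> supp ((laurent x * f) * (laurent y * f'))" using that by (simp add: laurent_mult ac_simps)
    then obtain i j where "i \<in> supp (laurent x * f)" "j \<in> supp (laurent y * f')" "n = i + j" by (rule supp_mult)
    then show ?thesis using assms by (auto simp: frac_module_def)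
  qed
  then show ?thesis using assms by (auto simp: frac_module_def laurent_mult finite_supp_mult)
qed

lemma frac_module_mono: "E \<subseteq> E' \<Longrightarrow> frac_module E f \<subseteq> frac_module E' f"
  by (auto simp: frac_module_def)

text \<open>The ideal choice would be \<open>t^e / f\<close>, which need not be a Laurent
  polynomial. A sufficiently long truncation \<open>x\<close> works: \<open>x f\<close> differs from
  \<open>t^e\<close> only in exponents so large that they belong to \<open>E\<close>.\<close>

lemma frac_module_approx:
  fixes f :: "'k::field fls"
  assumes f: "f \<noteq> 0" and E: "cofinite_above E" "e \<in> E"
  obtains x where "x \<in> frac_module E f" "\<And>i. i \<le> B \<Longrightarrow> (laurent x * f) $$ i = (if i = e then 1 else 0)"
proof -
  obtain N where N: "\<And>n. n \<ge> N \<Longrightarrow> n \<in> E" using E unfolding cofinite_above_def by blast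
  define B' where "B' = max B N"
  define h where "h = fls_X_intpow e * inverse f"
  have hf: "h * f = fls_X_intpow e" using f by (simp add: h_def mult.assoc)
  obtain x where x: "finite (supp (laurent x))" "\<And>i. i \<le> B' - fls_subdegree f \<Longrightarrow> laurent x $$ i = h $$ i"
    using laurent_approx by blast
  have eq: "(laurent x * f) $$ i = (if i = e then 1 else 0)" if "i \<le> B'" for i
  proof -
    have "((laurent x - h) * f) $$ i = 0"
      by (rule nth_mult_eq_0[of "B' - fls_subdegree f"]) (use x that in auto)
    then show ?thesis by (simp add: left_diff_distrib hf)
  qed
  have "n \<in> E" if "n \<in> supp (laurent x * f)" for n
  proof (cases "n \<le> B'")
    case True
    then show ?thesis using eq[of n] that E by (auto simp: supp_def split: if_splits)
  next
    case False
    then show ?thesis using N by (simp add: B'_def)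
  qed
  then have "x \<in> frac_module E f" using x by (auto simp: frac_module_def)
  then show ?thesis using that eq by (auto simp: B'_def)
qed

lemma tmon_in_frac_module:
  assumes "cofinite_above E"
  obtains n where "tmon 1 n \<in> frac_module E f"
proof -
  obtain N where N: "\<And>n. n \<ge> N \<Longrightarrow> n \<in> E" using assms unfolding cofinite_above_def by blast
  have "supp (laurent (tmon 1 (N - fls_subdegree f)) * f) \<subseteq> E"
    using N by (auto simp: supp_def laurent_tmon_mult_nth dest!: fls_subdegree_leI)
  then show ?thesis using that by (auto simp: frac_module_def finite_supp_tmon)
qed

text \<open>In the nontrivial inclusion, \<open>y x\<close> is the product of \<open>y / f\<close>
  and \<open>x f\<close>. Choosing \<open>x\<close> with \<open>x f\<close> close to
  \<open>t^e\<close>, one sees the coefficient of \<open>y / f\<close> at \<open>n\<close> reappear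
  in \<open>y x\<close> at \<open>n + e\<close>, which forces \<open>n + e\<close> into
  \<open>S\<close>.\<close>

lemma colon_frac_module:
  fixes f :: "'k::field fls"
  assumes f: "f \<noteq> 0" and E: "cofinite_above E"
  shows "colon (frac_module S 1) (frac_module E f) = frac_module (set_colon S E) (inverse f)"
proof (intro subset_antisym subsetI)
  fix y assume "y \<in> frac_module (set_colon S E) (inverse f)"
  then have "y * x \<in> frac_module S (inverse f * f)" if "x \<in> frac_module E f" for x
    using that by (rule frac_module_mult) (simp add: set_colon_def)
  then show "y \<in> colon (frac_module S 1) (frac_module E f)" using f by (simp add: colon_def)
next
  fix y assume y: "y \<in> colon (frac_module S 1) (frac_module E f)"
  \<comment> \<open>Elements of the colon are a priori arbitrary rational functions. A single
    monomial in the module shows that they are Laurent polynomials.\<close>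
  obtain m where "tmon 1 m \<in> frac_module E f" using tmon_in_frac_module[OF E] by blast
  then have "y * tmon 1 m \<in> frac_module S 1" using y by (simp add: colon_def)
  then have fin: "finite (supp (laurent (tmon 1 m) * laurent y))"
    by (simp add: frac_module_def laurent_mult mult.commute)
  have "finite (supp (laurent y))"
  proof (rule finite_subset[OF _ finite_imageI[OF fin]])
    show "supp (laurent y) \<subseteq> (\<lambda>i. i - m) ` supp (laurent (tmon 1 m) * laurent y)"
    proof
      fix i assume "i \<in> supp (laurent y)"
      then have "i + m \<in> supp (laurent (tmon 1 m) * laurent y)" by (simp add: supp_def laurent_tmon_mult_nth)
      then show "i \<in> (\<lambda>i. i - m) ` supp (laurent (tmon 1 m) * laurent y)" by (rule rev_image_eqI) simp
    qed
  qed
  moreover have "n + e \<in> S" if n: "n \<in> supp (laurent y * inverse f)" and e: "e \<in> E" for n e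
  proof -
    define z where "z = laurent y * inverse f"
    \<comment> \<open>The precision is chosen so that the error, after multiplication by
      \<open>z\<close>, starts beyond the exponent \<open>n + e\<close>.\<close>
    obtain x where x: "x \<in> frac_module E f"
      "\<And>i. i \<le> n + e - fls_subdegree z \<Longrightarrow> (laurent x * f) $$ i = (if i = e then 1 else 0)"
      using frac_module_approx[OF f E e] by blast
    define w where "w = laurent x * f - fls_X_intpow e"
    have "(w * z) $$ (n + e) = 0"
      by (rule nth_mult_eq_0[of "n + e - fls_subdegree z"]) (simp_all add: w_def x(2))
    moreover have "laurent (y * x) = (w + fls_X_intpow e) * z"
    proof -
      have "(w + fls_X_intpow e) * z = laurent x * laurent y * (f * inverse f)"
      proof -
        have "w + fls_X_intpow e = laurent x * f" by (simp add: w_def)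
        then show ?thesis by (simp only: z_def ac_simps)
      qed
      then show ?thesis using f by (simp add: laurent_mult)
    qed
    moreover have "(fls_X_intpow e * z) $$ (n + e) = z $$ n"
      by (simp add: fls_X_intpow_times_conv_shift)
    ultimately have "laurent (y * x) $$ (n + e) = z $$ n" by (simp add: distrib_right)
    then have "n + e \<in> supp (laurent (y * x))" using n by (simp add: supp_def z_def)
    moreover have "y * x \<in> frac_module S 1" using y x by (simp add: colon_def)
    ultimately show ?thesis by (auto simp: frac_module_def)
  qed
  ultimately show "y \<in> frac_module (set_colon S E) (inverse f)"
    by (auto simp: frac_module_def set_colon_def)
qed

text \<open>\<open>tag\<close> fixes the coefficient field, whose type is not visible in
  \<open>S\<close>.\<close>

locale semigroup_ring =
  fixes S :: "int set" and tag :: "'k::field itself"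
  assumes S0: "0 \<in> S" and S_add: "\<And>m n. m \<in> S \<Longrightarrow> n \<in> S \<Longrightarrow> m + n \<in> S"
    and S_nonneg: "\<And>n. n \<in> S \<Longrightarrow> 0 \<le> n"
begin

abbreviation R :: "'k poly fract set" where "R \<equiv> frac_module S 1"

definition S_ideal :: "int set \<Rightarrow> bool" where
  "S_ideal E \<longleftrightarrow> (\<forall>s\<in>S. \<forall>e\<in>E. s + e \<in> E)"

lemma S_ideal_canonical: "S_ideal {n. g - n \<notin> S}"
  unfolding S_ideal_def
proof (intro ballI)
  fix s e assume "s \<in> S" "e \<in> {n. g - n \<notin> S}"
  then show "s + e \<in> {n. g - n \<notin> S}" using S_add[of s "g - (s + e)"] by auto
qed

lemma tmon_in_R: "n \<in> S \<Longrightarrow> tmon c n \<in> R"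
  by (auto simp: frac_module_def finite_supp_tmon) (auto simp: supp_def laurent_tmon_nth split: if_splits)

lemma cring_R: "cring (ring_on R)"
proof (rule cring_ring_on)
  show "0 \<in> R" by (rule frac_module_0)
  show "1 \<in> R" using tmon_in_R[OF S0, of 1] by (simp add: tmon_1_0)
  show mult: "x * y \<in> R" if "x \<in> R" "y \<in> R" for x y
    using frac_module_mult[OF that S_add] by simp
  show "- x \<in> R" if "x \<in> R" for x
    using mult[OF tmon_in_R[OF S0, of "- 1"] that] by (simp add: tmon_uminus_1_0)
qed (rule frac_module_add)

lemma smult_frac_module:
  "S_ideal E \<Longrightarrow> r \<in> R \<Longrightarrow> x \<in> frac_module E f \<Longrightarrow> r * x \<in> frac_module E f"
  using frac_module_mult[of r S 1 x E f E] by (auto simp: S_ideal_def)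

lemma module_frac_module:
  "S_ideal E \<Longrightarrow> Module.module (ring_on R) (ideal_module (ring_on R) (frac_module E f))"
  by (rule module_ideal_module[OF cring_R]) (auto intro: frac_module_0 frac_module_add smult_frac_module)

lemma submodule_frac_module:
  assumes "S_ideal E" "S_ideal E'" "E \<subseteq> E'"
  shows "submodule (frac_module E f) (ring_on R) (ideal_module (ring_on R) (frac_module E' f))"
  using frac_module_mono[OF assms(3)]
  by (auto simp: module.submodule_iff[OF module_frac_module[OF assms(2)]] frac_module_0
      intro: frac_module_add smult_frac_module[OF assms(1)])

lemma frac_module_strict_mono:
  assumes "f \<noteq> 0" "cofinite_above E" "E \<subset> E'"
  shows "frac_module E f \<subset> frac_module E' f"
proof -
  obtain e where e: "e \<in> E'" "e \<notin> E" using assms by blast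
  have "cofinite_above E'" using assms unfolding cofinite_above_def by blast
  then obtain x where x: "x \<in> frac_module E' f" "\<And>i. i \<le> e \<Longrightarrow> (laurent x * f) $$ i = (if i = e then 1 else 0)"
    using frac_module_approx[OF assms(1) _ e(1), of e] by blast
  then have "e \<in> supp (laurent x * f)" by (simp add: supp_def)
  then have "x \<notin> frac_module E f" using e by (auto simp: frac_module_def)
  then show ?thesis using x frac_module_mono[of E E' f] assms by blast
qed

text \<open>The missing exponents are added from the largest downwards. Adding the largest one,
  \<open>e\<close>, keeps an \<open>S\<close>-ideal, because \<open>s + e\<close> is at least
  \<open>e\<close> and therefore equals \<open>e\<close> or is already present.\<close>

lemma frac_module_chain:
  assumes f: "f \<noteq> 0" and E': "S_ideal E'"
  shows "S_ideal E \<Longrightarrow> E \<subseteq> E' \<Longrightarrow> cofinite_above E \<Longrightarrow> finite (E' - E) \<Longrightarrow> card (E' - E) = n \<Longrightarrow>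
    \<exists>U. U 0 = frac_module E f \<and> U n = frac_module E' f \<and>
      (\<forall>i\<le>n. submodule (U i) (ring_on R) (ideal_module (ring_on R) (frac_module E' f))) \<and>
      (\<forall>i<n. U i \<subset> U (Suc i))"
proof (induction n arbitrary: E)
  case 0
  then have "E = E'" by auto
  then show ?case using submodule_frac_module[OF E' E'] by (intro exI[of _ "\<lambda>_. frac_module E' f"]) auto
next
  case (Suc n)
  have ne: "E' - E \<noteq> {}" using Suc.prems by auto
  define e where "e = Max (E' - E)"
  have e: "e \<in> E'" "e \<notin> E" using Max_in[OF Suc.prems(4) ne] by (auto simp: e_def)
  have e_max: "x \<le> e" if "x \<in> E'" "x \<notin> E" for x unfolding e_def using that Suc.prems(4) by simp
  have "s + e \<in> insert e E" if "s \<in> S" for s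
  proof -
    have "s + e \<in> E'" using E' that e by (auto simp: S_ideal_def)
    then show ?thesis using e_max[of "s + e"] S_nonneg[OF that] by auto
  qed
  then have id: "S_ideal (insert e E)" using Suc.prems(1) by (auto simp: S_ideal_def)
  have "E' - insert e E = (E' - E) - {e}" by blast
  then have "card (E' - insert e E) = n" "finite (E' - insert e E)" using Suc.prems e by auto
  moreover have cof: "cofinite_above (insert e E)" using Suc.prems(3) unfolding cofinite_above_def by blast
  ultimately obtain U where U: "U 0 = frac_module (insert e E) f" "U n = frac_module E' f"
    "\<forall>i\<le>n. submodule (U i) (ring_on R) (ideal_module (ring_on R) (frac_module E' f))" "\<forall>i<n. U i \<subset> U (Suc i)"
    using Suc.IH[OF id] e(1) Suc.prems(2) by (metis insert_subset)
  let ?U = "\<lambda>i. case i of 0 \<Rightarrow> frac_module E f | Suc j \<Rightarrow> U j"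
  have "submodule (?U i) (ring_on R) (ideal_module (ring_on R) (frac_module E' f))" if "i \<le> Suc n" for i
    using that U(3) submodule_frac_module[OF Suc.prems(1) E' Suc.prems(2)] by (cases i) auto
  moreover have "E \<subset> insert e E" using e by blast
  then have "?U i \<subset> ?U (Suc i)" if "i < Suc n" for i
    using that U(1,4) frac_module_strict_mono[OF f Suc.prems(3), of "insert e E"] by (cases i) auto
  ultimately show ?case using U(2) by (intro exI[of _ ?U]) auto
qed

section \<open>Orders of elements and lengths of quotients\<close>

definition lead :: "'k fls \<Rightarrow> 'k poly fract set \<Rightarrow> int set" where
  "lead f U = {k. \<exists>x\<in>U. (laurent x * f) $$ k \<noteq> 0 \<and> (\<forall>i<k. (laurent x * f) $$ i = 0)}"

lemma lead_mono: "U \<subseteq> V \<Longrightarrow> lead f U \<subseteq> lead f V"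
  unfolding lead_def by blast

lemma lead_frac_module: "lead f (frac_module E f) \<subseteq> E"
  by (auto simp: lead_def frac_module_def supp_def)

lemma subset_lead_frac_module:
  assumes "f \<noteq> 0" "cofinite_above E"
  shows "E \<subseteq> lead f (frac_module E f)"
proof
  fix e assume "e \<in> E"
  then obtain x where "x \<in> frac_module E f" "\<And>i. i \<le> e \<Longrightarrow> (laurent x * f) $$ i = (if i = e then 1 else 0)"
    using frac_module_approx[OF assms, of e e] by blast
  then show "e \<in> lead f (frac_module E f)" by (auto simp: lead_def intro!: bexI[of _ x])
qed

text \<open>Elimination of lowest terms: as long as \<open>x f\<close> has order below
  \<open>N\<close>, some element of \<open>U\<close> has the same order, and subtracting a scalar
  multiple of it raises the order. From order \<open>N\<close> on, \<open>x\<close> lies in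
  \<open>frac_module E f\<close>. The induction is on the distance \<open>d\<close> from
  \<open>N\<close>.\<close>

lemma eq_if_lead_eq:
  assumes E: "cofinite_above E" and sub: "frac_module E f \<subseteq> U" "U \<subseteq> V" and lead: "lead f V \<subseteq> lead f U"
    and fin: "\<And>x. x \<in> V \<Longrightarrow> finite (supp (laurent x))"
    and U: "\<And>x y. x \<in> U \<Longrightarrow> y \<in> U \<Longrightarrow> x + y \<in> U" "\<And>r x. r \<in> R \<Longrightarrow> x \<in> U \<Longrightarrow> r * x \<in> U"
    and V: "\<And>x y. x \<in> V \<Longrightarrow> y \<in> V \<Longrightarrow> x + y \<in> V" "\<And>r x. r \<in> R \<Longrightarrow> x \<in> V \<Longrightarrow> r * x \<in> V"
  shows "V = U"
proof -
  obtain N where N: "\<And>n. n \<ge> N \<Longrightarrow> n \<in> E" using E unfolding cofinite_above_def by blast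
  have "x \<in> V \<Longrightarrow> (\<And>i. i < N - int d \<Longrightarrow> (laurent x * f) $$ i = 0) \<Longrightarrow> x \<in> U" for d x
  proof (induction d arbitrary: x)
    case 0
    have "n \<in> E" if "n \<in> supp (laurent x * f)" for n
      using that 0(2)[of n] N[of n] by (cases "n < N") (auto simp: supp_def)
    then have "supp (laurent x * f) \<subseteq> E" by blast
    then have "x \<in> frac_module E f" using fin[OF 0(1)] by (simp add: frac_module_def)
    then show ?case using sub by blast
  next
    case (Suc d)
    define k where "k = N - int (Suc d)"
    show ?case
    proof (cases "(laurent x * f) $$ k = 0")
      case True
      have "(laurent x * f) $$ i = 0" if "i < N - int d" for i
        using Suc.prems(2)[of i] True that by (cases "i = k") (auto simp: k_def)
      then show ?thesis using Suc by blast
    next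
      case False
      then have "k \<in> lead f V" using Suc.prems by (auto simp: lead_def k_def)
      then obtain z where z: "z \<in> U" "(laurent z * f) $$ k \<noteq> 0" "\<And>i. i < k \<Longrightarrow> (laurent z * f) $$ i = 0"
        using lead unfolding lead_def by blast
      define q where "q = (laurent x * f) $$ k / (laurent z * f) $$ k"
      define y where "y = tmon q 0 * z"
      have y: "y \<in> U" unfolding y_def by (rule U(2)[OF tmon_in_R[OF S0] z(1)])
      have y_nth: "(laurent y * f) $$ i = q * (laurent z * f) $$ i" for i
        by (simp add: y_def laurent_mult mult.assoc laurent_tmon_mult_nth)
      have my: "- y \<in> U" using U(2)[OF tmon_in_R[OF S0, of "- 1"] y] by (simp add: tmon_uminus_1_0)
      have "x - y \<in> V" using V(1)[OF Suc.prems(1), of "- y"] my sub by auto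
      moreover have "(laurent (x - y) * f) $$ i = 0" if "i < N - int d" for i
      proof (cases "i = k")
        case True
        then show ?thesis using z(2) by (simp add: laurent_diff left_diff_distrib y_nth q_def)
      next
        case False
        then show ?thesis using that z(3)[of i] Suc.prems(2)[of i]
          by (simp add: laurent_diff left_diff_distrib y_nth k_def)
      qed
      ultimately have "x - y \<in> U" by (rule Suc.IH)
      then show ?thesis using U(1)[OF _ y] by force
    qed
  qed
  moreover have "\<exists>d. \<forall>i<N - int d. (laurent x * f) $$ i = 0" for x
    by (rule exI[of _ "nat (N - fls_subdegree (laurent x * f))"]) auto
  ultimately show ?thesis using sub by blast
qed

text \<open>The chain that adds one exponent at a time gives the lower bound. In an arbitrary chain
  each proper inclusion enlarges the set of orders, which always contains \<open>E\<close> and stays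
  inside \<open>E'\<close>; this gives the upper bound.\<close>

lemma quotient_length_frac_module:
  assumes f: "f \<noteq> 0" and E: "S_ideal E" "S_ideal E'" "E \<subseteq> E'" "cofinite_above E" "finite (E' - E)"
  shows "quotient_length (ring_on R) (ideal_module (ring_on R) (frac_module E' f)) (frac_module E f) (frac_module E' f)
    = enat (card (E' - E))"
proof (rule antisym)
  let ?M = "ideal_module (ring_on R) (frac_module E' f)"
  interpret M: Module.module "ring_on R" ?M by (rule module_frac_module[OF E(2)])
  obtain U where "U 0 = frac_module E f" "U (card (E' - E)) = frac_module E' f"
    "\<forall>i\<le>card (E' - E). submodule (U i) (ring_on R) ?M" "\<forall>i<card (E' - E). U i \<subset> U (Suc i)"
    using frac_module_chain[OF f E(2) E(1,3,4,5) refl] by blast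
  then show "enat (card (E' - E)) \<le> quotient_length (ring_on R) ?M (frac_module E f) (frac_module E' f)"
    by (intro quotient_length_ge[of U]) auto
  show "quotient_length (ring_on R) ?M (frac_module E f) (frac_module E' f) \<le> enat (card (E' - E))"
    unfolding quotient_length_def
  proof (rule Sup_least)
    fix l assume "l \<in> {enat n |n. \<exists>U. U 0 = frac_module E f \<and> U n = frac_module E' f \<and>
      (\<forall>i\<le>n. submodule (U i) (ring_on R) ?M) \<and> (\<forall>i<n. U i \<subset> U (Suc i))}"
    then obtain n U where l: "l = enat n" and U0: "U 0 = frac_module E f" and Un: "U n = frac_module E' f"
      and U: "\<And>i. i \<le> n \<Longrightarrow> submodule (U i) (ring_on R) ?M" and strict: "\<And>i. i < n \<Longrightarrow> U i \<subset> U (Suc i)" by blast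
    have sub: "U i \<subseteq> frac_module E' f" if "i \<le> n" for i
      using U[OF that] unfolding M.submodule_iff by simp
    have sup: "frac_module E f \<subseteq> U i" if "i \<le> n" for i
      using that
    proof (induction i)
      case (Suc i)
      then show ?case using strict[of i] by auto
    qed (simp add: U0)
    have lead_sub: "lead f (U i) \<subseteq> E'" if "i \<le> n" for i
      using lead_frac_module[of f E'] lead_mono[OF sub[OF that], of f] by blast
    have "i \<le> n \<Longrightarrow> i \<le> card (lead f (U i) - E)" for i
    proof (induction i)
      case (Suc i)
      have le: "lead f (U i) \<subseteq> lead f (U (Suc i))" using strict[of i] Suc.prems by (intro lead_mono) auto
      have "\<not> lead f (U (Suc i)) \<subseteq> lead f (U i)"
      proof
        assume *: "lead f (U (Suc i)) \<subseteq> lead f (U i)"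
        have cl: "\<And>x y. x \<in> U j \<Longrightarrow> y \<in> U j \<Longrightarrow> x + y \<in> U j" "\<And>r x. r \<in> R \<Longrightarrow> x \<in> U j \<Longrightarrow> r * x \<in> U j"
          if "j \<le> n" for j
          using U[OF that] unfolding M.submodule_iff by auto
        have i: "i \<le> n" "Suc i \<le> n" "i < n" using Suc.prems by auto
        have "finite (supp (laurent x))" if "x \<in> U (Suc i)" for x
          using sub[OF i(2)] that by (auto simp: frac_module_def)
        then have "U (Suc i) = U i"
          using eq_if_lead_eq[OF E(4) sup[OF i(1)] psubset_imp_subset[OF strict[OF i(3)]] *] cl[OF i(1)] cl[OF i(2)]
          by blast
        then show False using strict[of i] Suc.prems by auto
      qed
      then obtain k where k: "k \<in> lead f (U (Suc i))" "k \<notin> lead f (U i)" by blast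
      have "E \<subseteq> lead f (U i)"
        using subset_lead_frac_module[OF f E(4)] lead_mono[OF sup[of i], of f] Suc.prems by auto
      then have "lead f (U i) - E \<subset> lead f (U (Suc i)) - E" using k le by blast
      moreover have "finite (lead f (U (Suc i)) - E)"
        by (rule finite_subset[OF _ E(5)]) (use lead_sub[OF Suc.prems] in auto)
      ultimately have "card (lead f (U i) - E) < card (lead f (U (Suc i)) - E)" by (rule psubset_card_mono[rotated])
      then show ?case using Suc by simp
    qed simp
    then have "n \<le> card (lead f (U n) - E)" by simp
    also have "\<dots> \<le> card (E' - E)" using lead_sub[of n] E(5) by (intro card_mono) auto
    finally show "l \<le> enat (card (E' - E))" by (simp add: l)
  qed
qed

end

section \<open>Canonical ideals\<close>

context semigroup_ring
begin

definition \<mm> :: "'k poly fract set" where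
  "\<mm> = {x \<in> R. laurent x $$ 0 = 0}"

lemma R_nth_neg: "x \<in> R \<Longrightarrow> n < 0 \<Longrightarrow> laurent x $$ n = 0"
  using S_nonneg[of n] by (auto simp: frac_module_def supp_def)

lemma R_ring:
  shows R_0: "0 \<in> R" and R_1: "1 \<in> R" and R_add: "\<And>x y. x \<in> R \<Longrightarrow> y \<in> R \<Longrightarrow> x + y \<in> R"
    and R_mult: "\<And>x y. x \<in> R \<Longrightarrow> y \<in> R \<Longrightarrow> x * y \<in> R"
    and R_uminus: "\<And>x. x \<in> R \<Longrightarrow> - x \<in> R"
proof -
  interpret cring "ring_on R" by (rule cring_R)
  show "0 \<in> R" "1 \<in> R" "\<And>x y. x \<in> R \<Longrightarrow> y \<in> R \<Longrightarrow> x + y \<in> R" "\<And>x y. x \<in> R \<Longrightarrow> y \<in> R \<Longrightarrow> x * y \<in> R"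
    using zero_closed one_closed add.m_closed m_closed by auto
  show "- x \<in> R" if "x \<in> R" for x
    using m_closed[of "tmon (- 1) 0" x] tmon_in_R[OF S0, of "- 1"] that by (simp add: tmon_uminus_1_0)
qed

lemma \<mm>_subset: "\<mm> \<subseteq> R"
  by (auto simp: \<mm>_def)

lemma R_decomposition:
  assumes "x \<in> R"
  obtains y where "y \<in> \<mm>" "x = tmon (laurent x $$ 0) 0 + y"
proof
  have "x + (- tmon (laurent x $$ 0) 0) \<in> R"
    using assms by (intro R_add R_uminus tmon_in_R S0)
  then show "x - tmon (laurent x $$ 0) 0 \<in> \<mm>" by (simp add: \<mm>_def laurent_diff laurent_tmon_nth)
qed simp

lemma \<mm>_mult_nth_0:
  assumes "x \<in> \<mm>" "y \<in> R"
  shows "laurent (x * y) $$ 0 = 0"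
  unfolding laurent_mult
proof (rule nth_mult_eq_0[of 0])
  show "laurent x $$ i = 0" if "i \<le> 0" for i
    using R_nth_neg[of x i] assms that by (cases "i = 0") (auto simp: \<mm>_def)
  have "0 \<le> fls_subdegree (laurent y)"
  proof (rule ccontr)
    assume *: "\<not> 0 \<le> fls_subdegree (laurent y)"
    then have "laurent y \<noteq> 0" by auto
    then have "laurent y $$ fls_subdegree (laurent y) \<noteq> 0" by simp
    then show False using R_nth_neg[OF assms(2)] * by simp
  qed
  then show "0 \<le> 0 + fls_subdegree (laurent y)" by simp
qed

lemma ideal_\<mm>: "ideal \<mm> (ring_on R)"
  unfolding ideal_ring_on_iff[OF cring_R]
proof (intro conjI ballI)
  fix r x assume "r \<in> R" "x \<in> \<mm>"
  then show "r * x \<in> \<mm>"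
    using \<mm>_mult_nth_0[of x r] R_mult[of r x] by (auto simp: \<mm>_def mult.commute)
qed (auto simp: \<mm>_def R_0 R_add laurent_0 laurent_add)

text \<open>Exponents in \<open>S\<close> are nonnegative, so the constant term is multiplicative on
  \<open>R\<close>; \<mm> is the set of elements where it vanishes.\<close>

lemma R_mult_nth_0:
  assumes "x \<in> R" "y \<in> R"
  shows "laurent (x * y) $$ 0 = laurent x $$ 0 * laurent y $$ 0"
proof -
  obtain x' where x': "x' \<in> \<mm>" "x = tmon (laurent x $$ 0) 0 + x'" using R_decomposition[OF assms(1)] .
  have "laurent (x * y) = laurent (tmon (laurent x $$ 0) 0) * laurent y + laurent (x' * y)"
    by (subst x'(2)) (simp add: distrib_right laurent_add laurent_mult)
  then show ?thesis using \<mm>_mult_nth_0[OF x'(1) assms(2)] by (simp add: laurent_tmon_mult_nth)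
qed

lemma not_\<mm>_mult: "x \<in> R - \<mm> \<Longrightarrow> y \<in> R - \<mm> \<Longrightarrow> x * y \<in> R - \<mm>"
  by (auto simp: \<mm>_def R_mult R_mult_nth_0)

lemma one_not_\<mm>: "1 \<in> R - \<mm>"
  by (simp add: \<mm>_def R_1 laurent_1)

lemma maximalideal_\<mm>: "maximalideal \<mm> (ring_on R)"
proof (rule maximalidealI[OF ideal_\<mm>])
  show "carrier (ring_on R) \<noteq> \<mm>" using one_not_\<mm> by auto
  fix J assume J: "ideal J (ring_on R)" "\<mm> \<subseteq> J" "J \<subseteq> carrier (ring_on R)"
  note J' = J(1)[unfolded ideal_ring_on_iff[OF cring_R]]
  show "J = \<mm> \<or> J = carrier (ring_on R)"
  proof (rule disjCI)
    assume "J \<noteq> carrier (ring_on R)"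
    then have "1 \<notin> J" using J' J(3) by (metis mult.right_neutral ring_on_simps(1) subsetI subset_antisym)
    have "x \<in> \<mm>" if x: "x \<in> J" for x
    proof (rule ccontr)
      assume "x \<notin> \<mm>"
      moreover have xR: "x \<in> R" using J' x by blast
      ultimately have nz: "laurent x $$ 0 \<noteq> 0" by (simp add: \<mm>_def)
      obtain y where y: "y \<in> \<mm>" "x = tmon (laurent x $$ 0) 0 + y" using R_decomposition[OF xR] .
      have "- 1 * y \<in> J" using J' R_uminus[OF R_1] J(2) y(1) by blast
      then have "x + - 1 * y \<in> J" using J' x by blast
      then have "tmon (laurent x $$ 0) 0 \<in> J" by (subst (asm) y(2)) simp
      then have "tmon (inverse (laurent x $$ 0)) 0 * tmon (laurent x $$ 0) 0 \<in> J"
        using J' tmon_in_R[OF S0] by blast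
      then show False using \<open>1 \<notin> J\<close> nz by (simp add: tmon_mult tmon_1_0)
    qed
    then show "J = \<mm>" using J(2) by blast
  qed
qed

section \<open>Localization at \<mm> and the socle\<close>

lemma localize_module:
  assumes I: "ideal I (ring_on R)"
  shows "0 \<in> localize R \<mm> I"
    and "x \<in> localize R \<mm> I \<Longrightarrow> y \<in> localize R \<mm> I \<Longrightarrow> x + y \<in> localize R \<mm> I"
    and "r \<in> localize R \<mm> R \<Longrightarrow> x \<in> localize R \<mm> I \<Longrightarrow> r * x \<in> localize R \<mm> I"
    and "I \<subseteq> localize R \<mm> I"
proof -
  note I' = I[unfolded ideal_ring_on_iff[OF cring_R]]
  have loc: "x \<in> localize R \<mm> J \<longleftrightarrow> (\<exists>p s. x = p / s \<and> p \<in> J \<and> s \<in> R - \<mm>)" for x J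
    unfolding localize_def by blast
  have nz: "s \<noteq> 0" if "s \<in> R - \<mm>" for s using that R_0 by (auto simp: \<mm>_def laurent_0)
  show sub: "I \<subseteq> localize R \<mm> I"
  proof
    fix x assume "x \<in> I"
    then show "x \<in> localize R \<mm> I"
      unfolding loc using one_not_\<mm> by (intro exI[of _ x] exI[of _ 1]) auto
  qed
  then show "0 \<in> localize R \<mm> I" using I' by blast
  show "x + y \<in> localize R \<mm> I" if xy: "x \<in> localize R \<mm> I" "y \<in> localize R \<mm> I"
  proof -
    obtain p s q t where *: "x = p / s" "y = q / t" "p \<in> I" "q \<in> I" "s \<in> R - \<mm>" "t \<in> R - \<mm>"
      using xy unfolding loc by blast
    have "x + y = (t * p + s * q) / (s * t)" using nz * by (simp add: field_simps)
    moreover have "t * p + s * q \<in> I" using I' * by blast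
    ultimately show ?thesis unfolding loc using not_\<mm>_mult * by blast
  qed
  show "r * x \<in> localize R \<mm> I" if rx: "r \<in> localize R \<mm> R" "x \<in> localize R \<mm> I"
  proof -
    obtain p s q t where *: "r = p / s" "x = q / t" "p \<in> R" "q \<in> I" "s \<in> R - \<mm>" "t \<in> R - \<mm>"
      using rx unfolding loc by blast
    have "r * x = (p * q) / (s * t)" using * by simp
    moreover have "p * q \<in> I" using I' * by blast
    ultimately show ?thesis unfolding loc using not_\<mm>_mult * by blast
  qed
qed

lemma ideal_R: "ideal R (ring_on R)"
  unfolding ideal_ring_on_iff[OF cring_R] by (simp add: R_0 R_add R_mult)

lemma cring_localize: "cring (ring_on (localize R \<mm> R))"
proof (rule cring_ring_on)
  note L = localize_module[OF ideal_R]
  show "0 \<in> localize R \<mm> R" by (rule L(1))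
  show "1 \<in> localize R \<mm> R" using L(4) R_1 by blast
  show "- x \<in> localize R \<mm> R" if "x \<in> localize R \<mm> R" for x
    using L(3)[of "- 1" x] L(4) R_uminus[OF R_1] that by auto
qed (use localize_module[OF ideal_R] in blast)+

lemma ideal_localize:
  assumes I: "ideal I (ring_on R)"
  shows "ideal (localize R \<mm> I) (ring_on (localize R \<mm> R))"
proof -
  have "I \<subseteq> R" using I unfolding ideal_ring_on_iff[OF cring_R] by blast
  then have "localize R \<mm> I \<subseteq> localize R \<mm> R" unfolding localize_def by blast
  then show ?thesis
    unfolding ideal_ring_on_iff[OF cring_localize] using localize_module[OF I] by blast
qed

text \<open>Modulo \<open>C\<close>, the elements \<open>y0\<close> and \<open>y1\<close> are
  annihilated by \<mm>, so \<open>s\<close> and \<open>r\<close> act on them through their constant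
  terms, and that of \<open>s\<close> is invertible in \<open>k\<close>.\<close>

lemma mem_if_unit_multiple:
  assumes C: "ideal C (ring_on R)" and s: "s \<in> R - \<mm>" and r: "r \<in> R"
    and y0: "\<And>q. q \<in> \<mm> \<Longrightarrow> q * y0 \<in> C" and y1: "\<And>q. q \<in> \<mm> \<Longrightarrow> q * y1 \<in> C"
    and mem: "s * y1 - r * y0 \<in> C"
  shows "y1 - tmon (laurent r $$ 0 / laurent s $$ 0) 0 * y0 \<in> C"
proof -
  note C' = C[unfolded ideal_ring_on_iff[OF cring_R]]
  have C_diff: "x - y \<in> C" if "x \<in> C" "y \<in> C" for x y
  proof -
    have "- 1 * y \<in> C" using C' R_uminus[OF R_1] that by blast
    then have "x + - 1 * y \<in> C" using C' that by blast
    then show ?thesis by simp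
  qed
  define s0 r0 where "s0 = laurent s $$ 0" and "r0 = laurent r $$ 0"
  have nz: "s0 \<noteq> 0" using s by (auto simp: s0_def \<mm>_def)
  obtain s' where s': "s' \<in> \<mm>" "s = tmon s0 0 + s'" using R_decomposition[of s] s unfolding s0_def by blast
  obtain r' where r': "r' \<in> \<mm>" "r = tmon r0 0 + r'" using R_decomposition[OF r] unfolding r0_def by blast
  have "s * y1 - r * y0 - (s' * y1 - r' * y0) \<in> C"
    by (intro C_diff mem y0 y1 s'(1) r'(1))
  moreover have "s * y1 - r * y0 - (s' * y1 - r' * y0) = tmon s0 0 * y1 - tmon r0 0 * y0"
    unfolding s'(2) r'(2) by (simp add: algebra_simps)
  ultimately have "tmon s0 0 * y1 - tmon r0 0 * y0 \<in> C" by simp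
  then have "tmon (inverse s0) 0 * (tmon s0 0 * y1 - tmon r0 0 * y0) \<in> C"
    using C' tmon_in_R[OF S0] by blast
  moreover have "tmon (inverse s0) 0 * (tmon s0 0 * y1 - tmon r0 0 * y0) = y1 - tmon (r0 / s0) 0 * y0"
  proof -
    have "tmon (inverse s0) 0 * (tmon s0 0 * y1) = y1" "tmon (inverse s0) 0 * (tmon r0 0 * y0) = tmon (r0 / s0) 0 * y0"
      using nz by (simp_all add: tmon_mult tmon_1_0 field_simps flip: mult.assoc)
    then show ?thesis by (simp only: right_diff_distrib)
  qed
  ultimately show ?thesis by (simp add: s0_def r0_def)
qed

text \<open>\<open>Ext1_length_le_1\<close> over the local ring gives a relation between
  \<open>y0\<close> and \<open>y1\<close> with a coefficient in that ring; clearing denominators and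
  passing to constant terms replaces the coefficient by a scalar.\<close>

lemma canonical_ideal_socle:
  assumes can: "canonical_ideal R C" and \<tau>: "\<tau> \<in> \<mm>" "\<tau> \<noteq> 0"
    and y0: "\<And>q. q \<in> \<mm> \<Longrightarrow> q * y0 \<in> C" "y0 \<notin> C" and y1: "\<And>q. q \<in> \<mm> \<Longrightarrow> q * y1 \<in> C"
  shows "\<exists>\<kappa>. y1 - tmon \<kappa> 0 * y0 \<in> C"
proof -
  have C: "ideal C (ring_on R)" using can by (simp add: canonical_ideal_def)
  note C' = C[unfolded ideal_ring_on_iff[OF cring_R]]
  let ?A = "localize R \<mm> R" and ?D = "localize R \<mm> C"
  have loc: "x \<in> localize R \<mm> J \<longleftrightarrow> (\<exists>p s. x = p / s \<and> p \<in> J \<and> s \<in> R - \<mm>)" for x J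
    unfolding localize_def by blast
  have nz: "s \<noteq> 0" if "s \<in> R - \<mm>" for s using that R_0 by (auto simp: \<mm>_def laurent_0)
  have "canonical_module_local (ring_on ?A) (localize R \<mm> \<mm>) (ideal_module (ring_on ?A) ?D)"
    using can maximalideal_\<mm> unfolding canonical_ideal_def Let_def by blast
  then have ext: "Ext_length (ring_on ?A) (quotient_module (ring_on ?A) (localize R \<mm> \<mm>)) (ideal_module (ring_on ?A) ?D) 1
     (if enat 1 = krull_dim (ring_on ?A) then 1 else 0)"
    unfolding canonical_module_local_def by blast
  have loc_mult: "r * y \<in> ?D" if r: "r \<in> localize R \<mm> \<mm>" and y: "\<And>q. q \<in> \<mm> \<Longrightarrow> q * y \<in> C" for r y
  proof -
    obtain p s where ps: "r = p / s" "p \<in> \<mm>" "s \<in> R - \<mm>" using r unfolding loc by blast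
    have "r * y = (p * y) / s" using ps(1) by simp
    then show ?thesis unfolding loc using y[OF ps(2)] ps(3) by blast
  qed
  have y0D: "y0 \<notin> ?D"
  proof
    assume "y0 \<in> ?D"
    then obtain p s where ps: "y0 = p / s" "p \<in> C" "s \<in> R - \<mm>" unfolding loc by blast
    \<comment> \<open>The case \<open>r = 0\<close> of the descent to constant terms:
      \<open>s y0\<close> in \<open>C\<close> with \<open>s\<close> outside \<mm> already puts
      \<open>y0\<close> into \<open>C\<close>.\<close>
    then have "s * y0 - 0 * y0 \<in> C" using nz by simp
    from mem_if_unit_multiple[OF C ps(3) R_0 y0(1) y0(1) this]
    show False using y0(2) by (simp add: laurent_0 tmon_0)
  qed
  have "\<exists>\<alpha>\<in>?A. y1 - \<alpha> * y0 \<in> ?D"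
  proof (rule Ext1_length_le_1[OF cring_localize ideal_localize[OF ideal_\<mm>] localize_module(1-3)[OF C] ext])
    \<comment> \<open>The length is 1 or 0 depending on the dimension; the bound holds for both
      values.\<close>
    show "(if enat 1 = krull_dim (ring_on ?A) then 1 else 0) \<le> (1::enat)" by simp
    show "\<tau> \<in> localize R \<mm> \<mm>" using localize_module(4)[OF ideal_\<mm>] \<tau> by blast
  qed (use \<tau> y0D loc_mult[OF _ y0(1)] loc_mult[OF _ y1] in auto)
  then obtain \<alpha> where \<alpha>: "\<alpha> \<in> ?A" "y1 - \<alpha> * y0 \<in> ?D" by blast
  obtain p s where ps: "\<alpha> = p / s" "p \<in> R" "s \<in> R - \<mm>" using \<alpha>(1) unfolding loc by blast
  obtain q t where qt: "y1 - \<alpha> * y0 = q / t" "q \<in> C" "t \<in> R - \<mm>" using \<alpha>(2) unfolding loc by blast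
  have "(s * t) * y1 - (t * p) * y0 = s * q"
  proof -
    have p: "p = s * \<alpha>" and q: "q = t * (y1 - \<alpha> * y0)"
      using ps(1) qt(1) nz[OF ps(3)] nz[OF qt(3)] by simp_all
    show ?thesis unfolding p q by (simp add: algebra_simps)
  qed
  moreover have "s * q \<in> C" using C' ps qt by blast
  ultimately have "(s * t) * y1 - (t * p) * y0 \<in> C" by simp
  then show ?thesis
    using mem_if_unit_multiple[OF C not_\<mm>_mult[OF ps(3) qt(3)] R_mult y0(1) y1] ps qt by blast
qed

end

section \<open>Functionals over the coefficient field\<close>

lemma linear_functional_exists:
  fixes C :: "'k::field poly fract set"
  assumes C: "0 \<in> C" "\<And>x y. x \<in> C \<Longrightarrow> y \<in> C \<Longrightarrow> x + y \<in> C" "\<And>c x. x \<in> C \<Longrightarrow> tmon c 0 * x \<in> C"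
    and t: "t \<notin> C"
  obtains \<phi> :: "'k poly fract \<Rightarrow> 'k"
  where "\<And>x y. \<phi> (x + y) = \<phi> x + \<phi> y" "\<And>c x. \<phi> (tmon c 0 * x) = c * \<phi> x"
    "\<And>x. x \<in> C \<Longrightarrow> \<phi> x = 0" "\<phi> t = 1"
proof -
  \<comment> \<open>The field \<open>k(t)\<close> as a vector space over \<open>k\<close>, whose
    scalars are the constants \<open>tmon c 0\<close>. A basis of \<open>C\<close> stays independent
    after adding \<open>t\<close>, so the values 0 on the basis and 1 at \<open>t\<close> extend
    linearly.\<close>
  let ?s = "\<lambda>(c::'k) x. tmon c 0 * x"
  interpret V: vector_space ?s
    by standard (simp_all add: distrib_left tmon_mult tmon_1_0 flip: tmon_add distrib_right mult.assoc)
  interpret K: vector_space "(*) :: 'k \<Rightarrow> 'k \<Rightarrow> 'k"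
    by standard (simp_all add: algebra_simps)
  interpret P: vector_space_pair ?s "(*) :: 'k \<Rightarrow> 'k \<Rightarrow> 'k" ..
  obtain B where B: "B \<subseteq> C" "V.independent B" "C \<subseteq> V.span B"
    using V.maximal_independent_subset by blast
  have "V.subspace C" using C by (auto simp: V.subspace_def)
  then have "V.span B \<subseteq> C" using B(1) by (simp add: V.span_minimal)
  then have "t \<notin> V.span B" using t by blast
  then have "V.independent (insert t B)" using B(2) by (rule V.independent_insertI)
  then obtain \<phi> where \<phi>: "Vector_Spaces.linear ?s (*) \<phi>" "\<forall>x\<in>insert t B. \<phi> x = (if x = t then 1 else 0)"
    using P.linear_independent_extend[of "insert t B" "\<lambda>x. if x = t then 1 else 0"] by blast
  interpret L: Vector_Spaces.linear ?s "(*)" \<phi> by (rule \<phi>(1))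
  have "\<phi> x = 0" if "x \<in> B" for x
    using \<phi>(2) B(1) t that by auto
  then have "\<phi> x = 0" if "x \<in> C" for x
    using P.linear_eq_0_on_span[OF \<phi>(1), of B x] B(3) that by blast
  then show ?thesis using that[of \<phi>] \<phi>(2) L.add L.scale by auto
qed

context semigroup_ring
begin

text \<open>A Macaulay inverse system: an ideal with one-dimensional socle is the annihilator of a single
  functional \<open>\<phi>\<close>, and every functional on Laurent polynomials is a coefficient of the product with
  a fixed Laurent series \<open>u\<close>.\<close>

lemma one_dim_socle_imp_frac_module:
  assumes C: "ideal C (ring_on R)" and one: "1 \<notin> C" and N: "\<And>n. n \<ge> N \<Longrightarrow> tmon 1 n \<in> C"
    and socle: "\<And>y0 y1. \<lbrakk>\<And>q. q \<in> \<mm> \<Longrightarrow> q * y0 \<in> C; y0 \<notin> C; \<And>q. q \<in> \<mm> \<Longrightarrow> q * y1 \<in> C\<rbrakk>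
      \<Longrightarrow> \<exists>\<kappa>. y1 - tmon \<kappa> 0 * y0 \<in> C"
  obtains g u where "u \<noteq> 0" "C = frac_module {n. g - n \<notin> S} u"
proof -
  note C' = C[unfolded ideal_ring_on_iff[OF cring_R]]
  have C_smult: "tmon c 0 * x \<in> C" if "x \<in> C" for c x using C' tmon_in_R[OF S0] that by blast
  \<comment> \<open>The exponent \<open>g\<close> is the largest one whose monomial is missing from
    \<open>C\<close>; it exists because 1 is missing and all large monomials are present. Laurent
    polynomials of order above \<open>g\<close> then lie in \<open>C\<close>.\<close>
  define G where "G = {n. 0 \<le> n \<and> tmon 1 n \<notin> C}"
  have "n \<in> {0..N}" if "n \<in> G" for n
    using N[of n] that by (cases "N \<le> n") (auto simp: G_def)
  then have "G \<subseteq> {0..N}" by blast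
  then have finG: "finite G" by (rule finite_subset) simp
  have neG: "G \<noteq> {}" using one by (auto simp: G_def tmon_1_0)
  define g where "g = Max G"
  have g: "0 \<le> g" "tmon 1 g \<notin> C" using Max_in[OF finG neG] by (auto simp: g_def G_def)
  have g_max: "tmon 1 n \<in> C" if "n > g" for n
  proof (rule ccontr)
    assume "tmon 1 n \<notin> C"
    then have "n \<in> G" using that g by (simp add: G_def)
    then show False using Max_ge[OF finG] that unfolding g_def by force
  qed
  have above: "x \<in> C" if x: "finite (supp (laurent x))" "\<And>i. i \<le> g \<Longrightarrow> laurent x $$ i = 0" for x
  proof -
    have sum: "(\<Sum>i\<in>F. h i) \<in> C" if "finite F" "\<And>i. i \<in> F \<Longrightarrow> h i \<in> C" for F and h :: "int \<Rightarrow> 'k poly fract"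
      using that by (induction F rule: finite_induct) (use C' in auto)
    have "tmon (laurent x $$ i) i \<in> C" if "i \<in> supp (laurent x)" for i
    proof -
      have "i > g" using that x(2)[of i] by (force simp: supp_def)
      then show ?thesis using C_smult[OF g_max[of i], of "laurent x $$ i"] by (simp add: tmon_mult)
    qed
    then have "(\<Sum>i\<in>supp (laurent x). tmon (laurent x $$ i) i) \<in> C" by (rule sum[OF x(1)])
    then show ?thesis by (simp only: laurent_tmon_decomposition[OF x(1)])
  qed
  have \<mm>_nth: "laurent q $$ i = 0" if "q \<in> \<mm>" "i \<le> 0" for q i
    using R_nth_neg[of q i] that by (cases "i = 0") (auto simp: \<mm>_def)
  have fin: "finite (supp (laurent x))" if "x \<in> R" for x using that by (simp add: frac_module_def)
  \<comment> \<open>Multiplication by an element of \<mm> raises the order, so \<open>t^g\<close>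
    represents a nonzero socle class; by hypothesis that class spans the socle.\<close>
  have g_socle: "q * tmon 1 g \<in> C" if q: "q \<in> \<mm>" for q
  proof (rule above)
    show "finite (supp (laurent (q * tmon 1 g)))"
      unfolding laurent_mult using fin[of q] q \<mm>_subset finite_supp_tmon by (intro finite_supp_mult) auto
    show "laurent (q * tmon 1 g) $$ i = 0" if "i \<le> g" for i
      using \<mm>_nth[OF q, of "i - g"] that by (simp add: laurent_mult mult.commute[of "laurent q"] laurent_tmon_mult_nth)
  qed
  obtain \<phi> :: "'k poly fract \<Rightarrow> 'k" where \<phi>: "\<And>x y. \<phi> (x + y) = \<phi> x + \<phi> y" "\<And>c x. \<phi> (tmon c 0 * x) = c * \<phi> x"
    "\<And>x. x \<in> C \<Longrightarrow> \<phi> x = 0" "\<phi> (tmon 1 g) = 1"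
    using linear_functional_exists[of C "tmon 1 g"] C' C_smult g(2) by blast
  have \<phi>_sum: "\<phi> (\<Sum>i\<in>F. h i) = (\<Sum>i\<in>F. \<phi> (h i))" if "finite F" for F and h :: "int \<Rightarrow> 'k poly fract"
    using that \<phi>(2)[of 0 0] by (induction F rule: finite_induct) (simp_all add: \<phi>(1))
  \<comment> \<open>The indices are reversed so that the coefficient of \<open>x u\<close> at
    \<open>g\<close> is the value of \<phi> at \<open>x\<close>. Monomials beyond \<open>g\<close>
    lie in \<open>C\<close>, where \<phi> vanishes; hence \<open>u\<close> has no terms of negative
    exponent.\<close>
  define u where "u = Abs_fls (\<lambda>i. \<phi> (tmon 1 (g - i)))"
  have u: "u $$ i = \<phi> (tmon 1 (g - i))" for i
    unfolding u_def by (rule nth_Abs_fls_ex_lower_bound) (use g_max \<phi>(3) in \<open>auto intro!: exI[of _ 0]\<close>)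
  have "u $$ 0 \<noteq> 0" using \<phi>(4) by (simp add: u)
  then have u0: "u \<noteq> 0" by auto
  have \<phi>_eq: "\<phi> x = (laurent x * u) $$ g" if x: "finite (supp (laurent x))" for x
  proof -
    have "\<phi> x = \<phi> (\<Sum>i\<in>supp (laurent x). tmon (laurent x $$ i) i)"
      by (simp only: laurent_tmon_decomposition[OF x])
    also have "\<dots> = (\<Sum>i\<in>supp (laurent x). laurent x $$ i * \<phi> (tmon 1 i))"
    proof (subst \<phi>_sum[OF x], rule sum.cong[OF refl])
      fix i
      show "\<phi> (tmon (laurent x $$ i) i) = laurent x $$ i * \<phi> (tmon 1 i)"
        using \<phi>(2)[of "laurent x $$ i" "tmon 1 i"] by (simp add: tmon_mult)
    qed
    also have "\<dots> = (\<Sum>i\<in>supp (laurent x). (laurent (tmon (laurent x $$ i) i) * u) $$ g)"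
      by (simp add: laurent_tmon_mult_nth u)
    also have "\<dots> = (laurent (\<Sum>i\<in>supp (laurent x). tmon (laurent x $$ i) i) * u) $$ g"
      by (simp add: laurent_sum sum_distrib_right fls_nth_sum)
    also have "\<dots> = (laurent x * u) $$ g"
      by (simp only: laurent_tmon_decomposition[OF x])
    finally show ?thesis .
  qed
  define K where "K = {n. g - n \<notin> S}"
  have K: "S_ideal K" unfolding K_def by (rule S_ideal_canonical)
  have "C \<subseteq> frac_module K u"
  proof
    fix x assume x: "x \<in> C"
    have xR: "x \<in> R" using x C' by blast
    have "n \<in> K" if n: "n \<in> supp (laurent x * u)" for n
    proof (rule ccontr)
      assume "n \<notin> K"
      \<comment> \<open>The coefficient of \<open>x u\<close> at \<open>n\<close> is the value of
        \<phi> at \<open>t^(g - n) x\<close>, which vanishes if \<open>g - n\<close> is in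
        \<open>S\<close>, because then this product stays in \<open>C\<close>.\<close>
      then have s: "g - n \<in> S" by (simp add: K_def)
      then have "tmon 1 (g - n) * x \<in> C" using C' tmon_in_R x by blast
      then have "\<phi> (tmon 1 (g - n) * x) = 0" by (rule \<phi>(3))
      moreover have "finite (supp (laurent (tmon 1 (g - n) * x)))"
        by (rule fin) (use R_mult tmon_in_R[OF s] xR in blast)
      ultimately have "(laurent (tmon 1 (g - n)) * (laurent x * u)) $$ g = 0"
        using \<phi>_eq by (simp add: laurent_mult mult.assoc)
      then show False using n by (simp add: laurent_tmon_mult_nth supp_def)
    qed
    then show "x \<in> frac_module K u" using fin[OF xR] by (auto simp: frac_module_def)
  qed
  \<comment> \<open>Downward induction on the order. By the induction hypothesis \<mm> carries
    \<open>x\<close> into \<open>C\<close>, so \<open>x\<close> is a scalar multiple of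
    \<open>t^g\<close> modulo \<open>C\<close>. Since \<open>g\<close> is not in \<open>K\<close>,
    the functional vanishes at \<open>x\<close>, and the scalar is zero.\<close>
  moreover have "x \<in> frac_module K u \<Longrightarrow> (\<And>i. i \<le> g - int d \<Longrightarrow> laurent x $$ i = 0) \<Longrightarrow> x \<in> C" for x d
  proof (induction d arbitrary: x)
    case 0
    then show ?case by (intro above) (auto simp: frac_module_def)
  next
    case (Suc d)
    have "q * x \<in> C" if q: "q \<in> \<mm>" for q
    proof (rule Suc.IH)
      show "q * x \<in> frac_module K u" using smult_frac_module[OF K] q \<mm>_subset Suc.prems by blast
      show "laurent (q * x) $$ i = 0" if i: "i \<le> g - int d" for i
      proof (rule ccontr)
        assume "laurent (q * x) $$ i \<noteq> 0"
        then have "i \<in> supp (laurent q * laurent x)" by (simp add: supp_def laurent_mult)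
        then obtain j l where jl: "j \<in> supp (laurent q)" "l \<in> supp (laurent x)" "i = j + l" by (rule supp_mult)
        have "j > 0" using jl(1) \<mm>_nth[OF q, of j] by (force simp: supp_def)
        moreover have "l > g - int (Suc d)" using jl(2) Suc.prems(2)[of l] by (force simp: supp_def)
        ultimately show False using i jl(3) by simp
      qed
    qed
    then obtain \<kappa> where \<kappa>: "x - tmon \<kappa> 0 * tmon 1 g \<in> C" using socle[OF g_socle g(2)] by blast
    have "\<phi> x = 0"
    proof -
      have "g \<notin> K" by (simp add: K_def S0)
      then have "(laurent x * u) $$ g = 0" using Suc.prems(1) by (auto simp: frac_module_def supp_def)
      then show ?thesis using \<phi>_eq Suc.prems(1) by (simp add: frac_module_def)
    qed
    moreover have "\<phi> x = \<phi> (x - tmon \<kappa> 0 * tmon 1 g) + \<phi> (tmon \<kappa> 0 * tmon 1 g)"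
      by (simp flip: \<phi>(1))
    ultimately have "\<kappa> = 0" using \<phi>(3)[OF \<kappa>] \<phi>(4) by (simp add: \<phi>(2))
    then show ?case using \<kappa> by (simp add: tmon_0)
  qed
  then have "frac_module K u \<subseteq> C"
  proof (intro subsetI)
    fix x assume *: "x \<in> frac_module K u"
      "\<And>x d. x \<in> frac_module K u \<Longrightarrow> (\<And>i. i \<le> g - int d \<Longrightarrow> laurent x $$ i = 0) \<Longrightarrow> x \<in> C"
    show "x \<in> C"
    proof (rule *(2)[OF *(1), of "nat (g - fls_subdegree (laurent x) + 1)"])
      show "laurent x $$ i = 0" if "i \<le> g - int (nat (g - fls_subdegree (laurent x) + 1))" for i
        by (rule fls_eq0_below_subdegree) (use that in linarith)
    qed
  qed
  ultimately show ?thesis using that[OF u0, of g] by (auto simp: K_def)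
qed

end

section \<open>The ring of a monomial space curve\<close>

lemma monomial_ring_eq: "monomial_ring a b c = (frac_module (num_semigroup a b c) 1 :: 'k::field poly fract set)"
proof (intro subset_antisym subsetI)
  fix x :: "'k poly fract" assume "x \<in> monomial_ring a b c"
  then obtain p where p: "x = Fract p 1" "\<And>n. coeff p n \<noteq> 0 \<Longrightarrow> int n \<in> num_semigroup a b c"
    unfolding monomial_ring_def range_Gamma by blast
  have "n \<in> int ` {..degree p} \<and> n \<in> num_semigroup a b c" if "n \<in> supp (laurent x)" for n
  proof -
    have "0 \<le> n" "coeff p (nat n) \<noteq> 0"
      using that by (auto simp: supp_def p(1) laurent_to_poly poly_fls_nth split: if_splits)
    then show ?thesis using p(2)[of "nat n"] by (auto simp: le_degree image_iff intro!: bexI[of _ "nat n"])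
  qed
  then have "supp (laurent x) \<subseteq> int ` {..degree p}" "supp (laurent x) \<subseteq> num_semigroup a b c" by blast+
  then show "x \<in> frac_module (num_semigroup a b c) 1"
    using finite_subset[of "supp (laurent x)" "int ` {..degree p}"] by (simp add: frac_module_def)
next
  fix x :: "'k poly fract" assume x: "x \<in> frac_module (num_semigroup a b c) 1"
  define F where "F = supp (laurent x)"
  have F: "finite F" "F \<subseteq> num_semigroup a b c" using x by (auto simp: frac_module_def F_def)
  define p where "p = (\<Sum>i\<in>F. monom (laurent x $$ i) (nat i))"
  have to_fract_sum: "to_fract (\<Sum>i\<in>F. h i) = (\<Sum>i\<in>F. to_fract (h i :: 'k poly))" for h
    using F(1) by (induction F rule: finite_induct) simp_all
  have "x = (\<Sum>i\<in>F. tmon (laurent x $$ i) i)"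
    unfolding F_def by (rule laurent_tmon_decomposition[symmetric]) (use F in \<open>simp add: F_def\<close>)
  also have "\<dots> = (\<Sum>i\<in>F. to_fract (monom (laurent x $$ i) (nat i)))"
    by (rule sum.cong[OF refl]) (use F num_semigroup_nonneg in \<open>auto simp: tmon_def to_fract_def\<close>)
  also have "\<dots> = Fract p 1" by (simp add: p_def to_fract_sum flip: to_fract_def)
  finally have "x = Fract p 1" .
  moreover have "int n \<in> num_semigroup a b c" if "coeff p n \<noteq> 0" for n
  proof -
    obtain i where "i \<in> F" "coeff (monom (laurent x $$ i) (nat i)) n \<noteq> 0"
      using \<open>coeff p n \<noteq> 0\<close> unfolding p_def coeff_sum by (rule sum.not_neutral_contains_not_neutral)
    then show ?thesis using F(2) num_semigroup_nonneg[of i] by (auto split: if_splits)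
  qed
  ultimately show "x \<in> monomial_ring a b c" unfolding monomial_ring_def range_Gamma by blast
qed

interpretation num_ring: semigroup_ring "num_semigroup a b c" "TYPE('k::field)" for a b c
  by standard (auto intro: num_semigroup_0 num_semigroup_add num_semigroup_nonneg)

lemma monomial_max_ideal_eq:
  assumes "0 < a" "0 < b" "0 < c"
  shows "monomial_max_ideal a b c = (num_ring.\<mm> a b c :: 'k::field poly fract set)"
proof (intro subset_antisym)
  let ?R = "frac_module (num_semigroup a b c) 1 :: 'k poly fract set"
  let ?G = "{tmon 1 (int a), tmon 1 (int b), tmon 1 (int c)} :: 'k poly fract set"
  interpret cring "ring_on ?R" by (rule num_ring.cring_R)
  have gens: "int a \<in> num_semigroup a b c" "int b \<in> num_semigroup a b c" "int c \<in> num_semigroup a b c"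
    using num_semigroupI[of a 1 b 0 c 0] num_semigroupI[of a 0 b 1 c 0] num_semigroupI[of a 0 b 0 c 1] by simp_all
  have max: "monomial_max_ideal a b c = Idl\<^bsub>ring_on ?R\<^esub> ?G"
    by (simp add: monomial_max_ideal_def monomial_ring_eq Fract_monom)
  have G: "?G \<subseteq> num_ring.\<mm> a b c"
    using assms gens by (auto simp: num_ring.\<mm>_def num_ring.tmon_in_R laurent_tmon_nth)
  then show "monomial_max_ideal a b c \<subseteq> (num_ring.\<mm> a b c :: 'k poly fract set)"
    unfolding max by (rule genideal_minimal[OF num_ring.ideal_\<mm>])
  have GR: "?G \<subseteq> carrier (ring_on ?R)" using G num_ring.\<mm>_subset[of a b c] by auto
  have id: "ideal (monomial_max_ideal a b c) (ring_on ?R)" unfolding max by (rule genideal_ideal[OF GR])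
  note id' = id[unfolded ideal_ring_on_iff[OF num_ring.cring_R]]
  have Gsub: "?G \<subseteq> monomial_max_ideal a b c" unfolding max by (rule genideal_self[OF GR])
  have step: "tmon x (int d + n) \<in> monomial_max_ideal a b c"
    if "tmon 1 (int d) \<in> ?G" "n \<in> num_semigroup a b c" for x :: 'k and n d
  proof -
    have "tmon 1 (int d) \<in> (monomial_max_ideal a b c :: 'k poly fract set)" using Gsub that(1) by (rule subsetD)
    then have "tmon x n * tmon 1 (int d) \<in> monomial_max_ideal a b c"
      using id' num_ring.tmon_in_R[OF that(2), of x] by simp
    then show ?thesis by (simp add: tmon_mult add.commute)
  qed
  have mon: "tmon x n \<in> monomial_max_ideal a b c" if n: "n \<in> num_semigroup a b c" "n \<noteq> 0" for x :: 'k and n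
  proof -
    obtain i j l where ijl: "n = int (a * i + b * j + c * l)" using n(1) unfolding num_semigroup_iff by blast
    have "i \<noteq> 0 \<or> j \<noteq> 0 \<or> l \<noteq> 0" using n(2) by (auto simp: ijl)
    then consider i' where "i = Suc i'" | j' where "j = Suc j'" | l' where "l = Suc l'"
      using not0_implies_Suc by blast
    then show ?thesis
    proof cases
      case 1
      have "n = int a + int (a * i' + b * j + c * l)" by (simp add: ijl 1)
      then show ?thesis using step[of a] num_semigroupI by simp
    next
      case 2
      have "n = int b + int (a * i + b * j' + c * l)" by (simp add: ijl 2)
      then show ?thesis using step[of b] num_semigroupI by simp
    next
      case 3
      have "n = int c + int (a * i + b * j + c * l')" by (simp add: ijl 3)
      then show ?thesis using step[of c] num_semigroupI by simp
    qed
  qed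
  show "(num_ring.\<mm> a b c :: 'k poly fract set) \<subseteq> monomial_max_ideal a b c"
  proof
    fix x :: "'k poly fract" assume x: "x \<in> num_ring.\<mm> a b c"
    then have xR: "finite (supp (laurent x))" "supp (laurent x) \<subseteq> num_semigroup a b c" "0 \<notin> supp (laurent x)"
      by (auto simp: num_ring.\<mm>_def frac_module_def supp_def)
    have sum: "(\<Sum>i\<in>F. h i) \<in> monomial_max_ideal a b c"
      if "finite F" "\<And>i. i \<in> F \<Longrightarrow> h i \<in> monomial_max_ideal a b c" for F and h :: "int \<Rightarrow> 'k poly fract"
      using that by (induction F rule: finite_induct) (use id' in auto)
    have "(\<Sum>i\<in>supp (laurent x). tmon (laurent x $$ i) i) \<in> monomial_max_ideal a b c"
      by (rule sum[OF xR(1)], rule mon) (use xR in auto)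
    then show "x \<in> monomial_max_ideal a b c" by (simp only: laurent_tmon_decomposition[OF xR(1)])
  qed
qed

text \<open>As the radical of \<open>C\<close> is \<mm>, some power of each of the three generators
  lies in \<open>C\<close>. A representation of a large degree must use at least one generator that
  often.\<close>

lemma tmon_in_primary_ideal:
  fixes C :: "'k::field poly fract set"
  assumes pos: "0 < a" "0 < b" "0 < c" "gcd a (gcd b c) = 1"
    and prim: "primary_to (frac_module (num_semigroup a b c) 1) (num_ring.\<mm> a b c) C"
  obtains N where "\<And>n. n \<ge> N \<Longrightarrow> tmon 1 n \<in> C"
proof -
  let ?S = "num_semigroup a b c"
  let ?R = "frac_module ?S 1 :: 'k poly fract set"
  have C: "ideal C (ring_on ?R)" and rad: "{x \<in> ?R. \<exists>n. x ^ n \<in> C} = num_ring.\<mm> a b c"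
    using prim by (simp_all add: primary_to_def)
  note C' = C[unfolded ideal_ring_on_iff[OF num_ring.cring_R]]
  have power: "\<exists>m. tmon 1 (int d * int m) \<in> C" if "int d \<in> ?S" "0 < d" for d
  proof -
    have "tmon 1 (int d) \<in> (num_ring.\<mm> a b c :: 'k poly fract set)"
      using that num_ring.tmon_in_R[of "int d" a b c "1 :: 'k"] by (simp add: num_ring.\<mm>_def laurent_tmon_nth)
    then have "\<exists>m. (tmon 1 (int d) :: 'k poly fract) ^ m \<in> C" unfolding rad[symmetric] by blast
    then show ?thesis by (simp add: tmon_power)
  qed
  have gens: "int a \<in> ?S" "int b \<in> ?S" "int c \<in> ?S"
    using num_semigroupI[of a 1 b 0 c 0] num_semigroupI[of a 0 b 1 c 0] num_semigroupI[of a 0 b 0 c 1] by simp_all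
  obtain m1 where m1: "tmon 1 (int a * int m1) \<in> C" using power[OF gens(1) pos(1)] by blast
  obtain m2 where m2: "tmon 1 (int b * int m2) \<in> C" using power[OF gens(2) pos(2)] by blast
  obtain m3 where m3: "tmon 1 (int c * int m3) \<in> C" using power[OF gens(3) pos(3)] by blast
  obtain N where N: "\<And>n. n \<ge> N \<Longrightarrow> n \<in> ?S" using num_semigroup_cofinite[OF pos(4)] by blast
  have shift: "tmon 1 (s + n) \<in> C" if "tmon 1 n \<in> C" "s \<in> ?S" for s n
  proof -
    have "tmon 1 s * tmon 1 n \<in> C" using C' that num_ring.tmon_in_R[OF that(2), of "1 :: 'k"] by simp
    then show ?thesis by (simp add: tmon_mult)
  qed
  have "tmon 1 n \<in> C" if n: "n \<ge> max N (int (a * m1 + b * m2 + c * m3))" for n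
  proof -
    have "n \<in> ?S" using N n by simp
    then obtain i j l where ijl: "n = int (a * i + b * j + c * l)" unfolding num_semigroup_iff by blast
    have "m1 \<le> i \<or> m2 \<le> j \<or> m3 \<le> l"
    proof (rule ccontr)
      assume "\<not> ?thesis"
      then have "a * i < a * m1" "b * j < b * m2" "c * l < c * m3" using pos by simp_all
      then have "n < int (a * m1 + b * m2 + c * m3)" unfolding ijl by linarith
      then show False using n by simp
    qed
    then consider x where "i = m1 + x" | x where "j = m2 + x" | x where "l = m3 + x"
      using le_Suc_ex by blast
    then show ?thesis
    proof cases
      case 1
      have "n = int (a * x + b * j + c * l) + int a * int m1" by (simp add: ijl 1 algebra_simps)
      then show ?thesis using shift[OF m1 num_semigroupI] by simp
    next
      case 2
      have "n = int (a * i + b * x + c * l) + int b * int m2" by (simp add: ijl 2 algebra_simps)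
      then show ?thesis using shift[OF m2 num_semigroupI] by simp
    next
      case 3
      have "n = int (a * i + b * j + c * x) + int c * int m3" by (simp add: ijl 3 algebra_simps)
      then show ?thesis using shift[OF m3 num_semigroupI] by simp
    qed
  qed
  then show ?thesis using that by blast
qed

lemma (in semigroup_ring) bideg_frac_module:
  fixes g :: int and C :: "'k poly fract set"
  assumes S: "cofinite_above S" and u: "u \<noteq> 0" and C: "ideal C (ring_on R)" "C \<noteq> {0}"
  defines "K \<equiv> {n. g - n \<notin> S}"
  assumes CK: "C = frac_module K u" and fin: "finite (set_colon S (set_colon S K) - K)"
  shows "bideg R C = enat (card (set_colon S (set_colon S K) - K))"
proof -
  note C' = C(1)[unfolded ideal_ring_on_iff[OF cring_R]]
  obtain x0 where x0: "x0 \<in> C" "x0 \<noteq> 0" using C(2) C' by blast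
  obtain N where N: "\<And>n. n \<ge> N \<Longrightarrow> n \<in> S" using S unfolding cofinite_above_def by blast
  \<comment> \<open>Since \<open>S\<close> contains all large integers, \<open>K\<close> is bounded
    below. This makes the dual exponent set contain all large integers, so that the second colon can
    be computed like the first.\<close>
  have K_low: "g - N < n" if "n \<in> K" for n
    using that N[of "g - n"] by (cases "g - N < n") (auto simp: K_def)
  have K_cof: "cofinite_above K"
    unfolding cofinite_above_def K_def by (rule exI[of _ "g + 1"]) (use S_nonneg in force)
  have SK_cof: "cofinite_above (set_colon S K)"
    unfolding cofinite_above_def set_colon_def
  proof (intro exI[of _ "N - (g - N)"] allI impI CollectI ballI N)
    fix n e assume "N - (g - N) \<le> n" "e \<in> K"
    then show "N \<le> n + e" using K_low[of e] by simp
  qed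
  have colon: "colon R (colon R C) = frac_module (set_colon S (set_colon S K)) u"
    using colon_frac_module[OF u K_cof, of S] colon_frac_module[of "inverse u", OF _ SK_cof, of S] u
    by (simp add: CK)
  have K_ideal: "S_ideal K" unfolding K_def by (rule S_ideal_canonical)
  have colon_ideal: "S_ideal (set_colon S E)" for E
    using S_add by (auto simp: S_ideal_def set_colon_def add.assoc)
  have sub: "K \<subseteq> set_colon S (set_colon S K)"
    by (auto simp: set_colon_def add.commute)
  show ?thesis
    unfolding bideg_eq_quotient_length[OF cring_R C(1) x0] colon
    unfolding CK by (rule quotient_length_frac_module[OF u K_ideal colon_ideal sub K_cof fin])
qed

theorem proposition6p1:
  fixes a b c a1 a2 b1 b2 c1 c2 :: nat
    and R :: "'k::field poly fract set"
    and C :: "'k poly fract set"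
  assumes "0 < a" and "a < b" and "b < c" and "gcd a (gcd b c) = 1"
    and "R = monomial_ring a b c"
    and "\<not> gorenstein R"
    and "0 < a1" and "0 < a2" and "0 < b1" and "0 < b2" and "0 < c1" and "0 < c2"
    and "{p :: 'k poly3. Gamma a b c p = 0} = I2 (herzog_matrix a1 a2 b1 b2 c1 c2)"
    and "a1 \<le> a2" and "b2 \<le> b1" and "c1 \<le> c2"
    and "canonical_ideal R C" and "primary_to R (monomial_max_ideal a b c) C"
  shows "bideg R C = enat (a1 * b2 * c1)"
proof -
  let ?S = "num_semigroup a b c"
  have pos: "0 < a" "0 < b" "0 < c" using assms by auto
  interpret H: ordered_herzog_semigroup a b c a1 a2 b1 b2 c1 c2
  proof (rule ordered_herzog_semigroup.intro)
    show "herzog_semigroup a b c a1 a2 b1 b2 c1 c2"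
      using pos assms by (intro herzog_semigroup_if_kernel[where 'k = 'k]) auto
    show "ordered_herzog_semigroup_axioms a1 a2 b1 b2 c1 c2"
      by standard (use assms in auto)
  qed
  have R: "R = frac_module ?S 1" using assms(5) by (simp add: monomial_ring_eq)
  have prim: "primary_to (frac_module ?S 1) (num_ring.\<mm> a b c) C"
    using assms(18) by (simp add: R monomial_max_ideal_eq[OF pos])
  have can: "canonical_ideal (frac_module ?S 1) C" using assms(17) by (simp add: R)
  have C: "ideal C (ring_on (frac_module ?S 1))" using can by (simp add: canonical_ideal_def)
  note C' = C[unfolded ideal_ring_on_iff[OF num_ring.cring_R]]
  obtain N where N: "\<And>n. n \<ge> N \<Longrightarrow> tmon 1 n \<in> C"
    using tmon_in_primary_ideal[OF pos assms(4) prim] by blast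
  have one: "1 \<notin> C"
  proof
    assume "1 \<in> C"
    then have "r \<in> C" if "r \<in> frac_module ?S 1" for r using C' that by (metis mult.right_neutral)
    then show False using C' prim unfolding primary_to_def by blast
  qed
  \<comment> \<open>A nonzero element of \<mm>, required for dividing by \<tau> in the computation
    of the socle.\<close>
  define \<tau> where "\<tau> = (tmon 1 (int a) :: 'k poly fract)"
  have \<tau>_nth: "laurent \<tau> $$ i = (if i = int a then 1 else 0)" for i
    by (simp add: \<tau>_def laurent_tmon_nth)
  have "int a \<in> ?S" using num_semigroupI[of a 1 b 0 c 0] by simp
  then have \<tau>: "\<tau> \<in> num_ring.\<mm> a b c"
    using num_ring.tmon_in_R[of "int a" a b c "1 :: 'k"] \<tau>_nth[of 0] pos by (simp add: num_ring.\<mm>_def \<tau>_def)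
  have \<tau>0: "\<tau> \<noteq> 0" using \<tau>_nth[of "int a"] by (auto simp: laurent_0)
  obtain g u where u: "u \<noteq> 0" "C = frac_module {n. g - n \<notin> ?S} u"
    using num_ring.one_dim_socle_imp_frac_module[OF C one N num_ring.canonical_ideal_socle[OF can \<tau> \<tau>0]] by blast
  have "cofinite_above ?S" using num_semigroup_cofinite[OF assms(4)] unfolding cofinite_above_def by metis
  moreover have "C \<noteq> {0}"
  proof
    assume "C = {0}"
    then have "laurent (tmon (1::'k) N) = 0" using N[of N] by (simp add: laurent_0)
    then have "laurent (tmon (1::'k) N) $$ N = 0" by simp
    then show False by (simp only: laurent_tmon_nth) simp
  qed
  ultimately have "bideg (frac_module ?S 1) C =
      enat (card (set_colon ?S (set_colon ?S (H.canonical_set g)) - H.canonical_set g))"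
    using num_ring.bideg_frac_module[OF _ u(1) C _ u(2)] H.card_bidual_minus_canonical_set(1)[of g]
    unfolding H.canonical_set_def by blast
  then show ?thesis by (simp add: R H.card_bidual_minus_canonical_set(2))
qed

end
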